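(* Let $F_1\subseteq F_2\subseteq\cdots\subseteq F_n$ be a chain of finite groups with simple (multiplicity free) branching, and for each $\mu\in F_1^{\wedge}$ fix a basis $B^{\mu}$ of $V^{\mu}$. Let $Z_i=Z[\mathbb{C}[F_i]]$ be the center of the group algebra $\mathbb{C}[F_i]$, and let $\mathcal{A}_0(n)\subseteq\mathcal{A}_1(n)\subseteq\mathcal{A}_2(n)\subseteq\mathbb{C}[F_n]$ be the subalgebras of elements which, in every irreducible $F_n$-module $V^\lambda$, act by a scalar on each GZ-subspace, act diagonally in the distinguished basis of each GZ-subspace, and leave each GZ-subspace invariant, respectively. Then (i) $\mathcal{A}_0(n)=\langle Z_1,Z_2,\ldots,Z_n\rangle$; (ii) $\mathcal{A}_1(n)=\langle \mathcal{A}_1(1),Z_1,Z_2,\ldots,Z_n\rangle$; (iii) $\mathcal{A}_2(n)=\langle \mathbb{C}[F_1],Z_1,Z_2,\ldots,Z_n\rangle$.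
   Context: All representations are finite-dimensional over $\mathbb{C}$. For a finite group $F$, $F^{\wedge}$ is the set of isomorphism classes of irreducible $F$-modules and $V^{\lambda}$ is the irreducible module of class $\lambda$. The group $F_1$ need not be trivial. Simple branching means: for $2\le i\le n$, every $\mu\in F_{i-1}^{\wedge}$ has multiplicity $0$ or $1$ in the restriction to $F_{i-1}$ of every $\lambda\in F_i^{\wedge}$; write $\mu\nearrow\lambda$ if the multiplicity is $1$. Then each $V^\lambda$, $\lambda\in F_n^\wedge$, decomposes canonically into irreducible $F_{n-1}$-modules, each of these canonically into irreducible $F_{n-2}$-modules, and so on, giving a canonical decomposition $V^{\lambda}=\bigoplus_T V_T$ into irreducible $F_1$-modules, indexed by chains $T=(\lambda_1\nearrow\lambda_2\nearrow\cdots\nearrow\lambda_n)$ with $\lambda_i\in F_i^{\wedge}$, $\lambda_n=\lambda$, where $V_T\cong V^{\lambda_1}$ as an $F_1$-module. The $V_T$ are the Gelfand-Tsetlin subspaces (GZ-subspaces) of $V^\lambda$. The distinguished basis of $V_T$ is the image of $B^{\lambda_1}$ under an $F_1$-isomorphism $V^{\lambda_1}\to V_T$ (unique up to a scalar, so acting diagonally in it is well defined). $\mathcal{A}_1(1)$ is the same definition for the one-term chain $F_1$: the elements of $\mathbb{C}[F_1]$ acting diagonally in $B^\mu$ on $V^\mu$ for all $\mu\in F_1^\wedge$. Subalgebras contain the unit, and $\langle A_1,\dots,A_k\rangle$ denotes the subalgebra generated by $A_1\cup\cdots\cup A_k$. *)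

theory Defs
  imports "HOL-Algebra.Algebra" "HOL-Library.Function_Algebras"
begin

definition cscale :: "complex \<Rightarrow> ('i \<Rightarrow> complex) \<Rightarrow> 'i \<Rightarrow> complex" (infixr "*\<^sub>c" 75)
  where "c *\<^sub>c f = (\<lambda>i. c * f i)"

global_interpretation cfun: vector_space cscale
  by unfold_locales (auto simp: cscale_def fun_eq_iff algebra_simps)

definition linear_on ::
  "('i \<Rightarrow> complex) set \<Rightarrow> ('j \<Rightarrow> complex) set \<Rightarrow> (('i \<Rightarrow> complex) \<Rightarrow> 'j \<Rightarrow> complex) \<Rightarrow> bool"
  where "linear_on V W f \<longleftrightarrow>
    f \<in> V \<rightarrow> W \<and>
    (\<forall>x\<in>V. \<forall>y\<in>V. f (x + y) = f x + f y) \<and>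
    (\<forall>c. \<forall>x\<in>V. f (c *\<^sub>c x) = c *\<^sub>c f x)"

definition basis_of :: "('i \<Rightarrow> complex) set \<Rightarrow> ('i \<Rightarrow> complex) set \<Rightarrow> bool"
  where "basis_of B V \<longleftrightarrow> cfun.independent B \<and> cfun.span B = V"

definition direct_sum :: "('i \<Rightarrow> complex) set \<Rightarrow> nat \<Rightarrow> (nat \<Rightarrow> ('i \<Rightarrow> complex) set) \<Rightarrow> bool"
  where "direct_sum V k W \<longleftrightarrow>
    (\<forall>j<k. cfun.subspace (W j) \<and> W j \<subseteq> V) \<and>
    (\<forall>v\<in>V. \<exists>!w. w \<in> (\<Pi>\<^sub>E j\<in>{..<k}. W j) \<and> v = (\<Sum>j<k. w j))"

text \<open>
  A finite-dimensional complex representation is a pair of a finite-dimensional subspace \<open>V\<close>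
  of the fixed infinite-dimensional space \<open>nat \<Rightarrow> complex\<close> and an action on \<open>V\<close>.  Every
  finite-dimensional representation is isomorphic to one of this form, and fixing the ambient
  space is what makes the isomorphism classes of all representations form a set.  Only the
  values \<open>\<rho> g v\<close> with \<open>g\<close> in the group and \<open>v \<in> V\<close> matter, so restricting to a subgroup or to an
  invariant subspace leaves \<open>\<rho>\<close> unchanged.
\<close>

type_synonym 'g rep = "(nat \<Rightarrow> complex) set \<times> ('g \<Rightarrow> (nat \<Rightarrow> complex) \<Rightarrow> nat \<Rightarrow> complex)"

definition is_rep :: "'g monoid \<Rightarrow> 'g rep \<Rightarrow> bool"
  where "is_rep G M \<longleftrightarrow> (case M of (V, \<rho>) \<Rightarrow>
    cfun.subspace V \<and> (\<exists>S. finite S \<and> cfun.span S = V) \<and>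
    (\<forall>g\<in>carrier G. linear_on V V (\<rho> g)) \<and>
    (\<forall>v\<in>V. \<rho> \<one>\<^bsub>G\<^esub> v = v) \<and>
    (\<forall>g\<in>carrier G. \<forall>h\<in>carrier G. \<forall>v\<in>V. \<rho> (g \<otimes>\<^bsub>G\<^esub> h) v = \<rho> g (\<rho> h v)))"

definition submodule_of :: "'g monoid \<Rightarrow> 'g rep \<Rightarrow> (nat \<Rightarrow> complex) set \<Rightarrow> bool"
  where "submodule_of G M W \<longleftrightarrow> (case M of (V, \<rho>) \<Rightarrow>
    cfun.subspace W \<and> W \<subseteq> V \<and> (\<forall>g\<in>carrier G. \<forall>w\<in>W. \<rho> g w \<in> W))"

definition irreducible_rep :: "'g monoid \<Rightarrow> 'g rep \<Rightarrow> bool"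
  where "irreducible_rep G M \<longleftrightarrow>
    is_rep G M \<and> fst M \<noteq> {0} \<and> (\<forall>W. submodule_of G M W \<longrightarrow> W = {0} \<or> W = fst M)"

definition rep_iso :: "'g monoid \<Rightarrow> 'g rep \<Rightarrow> 'g rep \<Rightarrow> ((nat \<Rightarrow> complex) \<Rightarrow> nat \<Rightarrow> complex) \<Rightarrow> bool"
  where "rep_iso G M N \<phi> \<longleftrightarrow> (case (M, N) of ((V, \<rho>), (W, \<sigma>)) \<Rightarrow>
    linear_on V W \<phi> \<and> bij_betw \<phi> V W \<and>
    (\<forall>g\<in>carrier G. \<forall>v\<in>V. \<phi> (\<rho> g v) = \<sigma> g (\<phi> v)))"

text \<open>The set \<open>G\<^sup>\<and>\<close>: an element is itself a set of irreducible representations.\<close>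

definition irr_classes :: "'g monoid \<Rightarrow> 'g rep set set"
  where "irr_classes G =
    {M. irreducible_rep G M} //
    {(M, N). irreducible_rep G M \<and> irreducible_rep G N \<and> (\<exists>\<phi>. rep_iso G M N \<phi>)}"

definition irr_decomposition ::
  "'g monoid \<Rightarrow> 'g rep \<Rightarrow> nat \<Rightarrow> (nat \<Rightarrow> (nat \<Rightarrow> complex) set) \<Rightarrow> bool"
  where "irr_decomposition H M k W \<longleftrightarrow>
    direct_sum (fst M) k W \<and>
    (\<forall>j<k. submodule_of H M (W j) \<and> irreducible_rep H (W j, snd M))"

text \<open>
  The choice is immaterial: for finite \<open>H\<close> a decomposition exists (Maschke) and the number of
  summands in a given class does not depend on it.
\<close>

definition multiplicity_in :: "'g monoid \<Rightarrow> 'g rep set \<Rightarrow> 'g rep \<Rightarrow> nat"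
  where "multiplicity_in H \<mu> M =
    (SOME m. \<exists>k W. irr_decomposition H M k W \<and> m = card {j. j < k \<and> (W j, snd M) \<in> \<mu>})"

definition branches_to :: "'g monoid \<Rightarrow> 'g rep set \<Rightarrow> 'g rep set \<Rightarrow> bool"
  where "branches_to H \<mu> \<kappa> \<longleftrightarrow> (\<exists>M\<in>\<kappa>. multiplicity_in H \<mu> M = 1)"

definition group_chain :: "(nat \<Rightarrow> 'g monoid) \<Rightarrow> nat \<Rightarrow> bool"
  where "group_chain F n \<longleftrightarrow>
    (\<forall>i\<in>{1..n}. group (F i) \<and> finite (carrier (F i))) \<and>
    (\<forall>i\<in>{1..<n}. subgroup (carrier (F i)) (F (Suc i)) \<and>
      (\<forall>x\<in>carrier (F i). \<forall>y\<in>carrier (F i). x \<otimes>\<^bsub>F i\<^esub> y = x \<otimes>\<^bsub>F (Suc i)\<^esub> y))"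

definition simple_branching :: "(nat \<Rightarrow> 'g monoid) \<Rightarrow> nat \<Rightarrow> bool"
  where "simple_branching F n \<longleftrightarrow>
    (\<forall>i\<in>{2..n}. \<forall>\<mu>\<in>irr_classes (F (i - 1)). \<forall>\<kappa>\<in>irr_classes (F i). \<forall>M\<in>\<kappa>.
      multiplicity_in (F (i - 1)) \<mu> M \<in> {0, 1})"

definition branching_chain :: "(nat \<Rightarrow> 'g monoid) \<Rightarrow> nat \<Rightarrow> (nat \<Rightarrow> 'g rep set) \<Rightarrow> bool"
  where "branching_chain F n T \<longleftrightarrow>
    (\<forall>i\<in>{1..n}. T i \<in> irr_classes (F i)) \<and>
    (\<forall>i\<in>{2..n}. branches_to (F (i - 1)) (T (i - 1)) (T i))"

text \<open>
  \<open>GZ_subspace F n M T W\<close> says that \<open>W\<close> is the subspace \<open>V\<^sub>T\<close> of the irreducible module \<open>M\<close>.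
  Starting from \<open>U n = V\<close>, the subspace \<open>U (i - 1)\<close> is the constituent of class \<open>T (i - 1)\<close> in
  the decomposition of \<open>U i\<close> into irreducible \<open>F (i - 1)\<close>-modules; for multiplicity free branching
  the constituents of that decomposition are precisely the irreducible submodules, so
  that \<open>W\<close> is determined by \<open>T\<close>.
\<close>

definition GZ_subspace ::
  "(nat \<Rightarrow> 'g monoid) \<Rightarrow> nat \<Rightarrow> 'g rep \<Rightarrow> (nat \<Rightarrow> 'g rep set) \<Rightarrow> (nat \<Rightarrow> complex) set \<Rightarrow> bool"
  where "GZ_subspace F n M T W \<longleftrightarrow>
    branching_chain F n T \<and> M \<in> T n \<and>
    (\<exists>U. U n = fst M \<and> U 1 = W \<and>
      (\<forall>i\<in>{2..n}. submodule_of (F (i - 1)) (U i, snd M) (U (i - 1)) \<and>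
                  (U (i - 1), snd M) \<in> T (i - 1)))"

text \<open>
  Elements of \<open>\<complex>[G]\<close> are functions vanishing outside \<open>carrier G\<close>, so that for a subgroup \<open>H\<close>
  the inclusion of \<open>\<complex>[H]\<close> in \<open>\<complex>[G]\<close> is an inclusion of sets.
\<close>

definition group_algebra :: "'g monoid \<Rightarrow> ('g \<Rightarrow> complex) set"
  where "group_algebra G = {a. \<forall>x. x \<notin> carrier G \<longrightarrow> a x = 0}"

definition ga_one :: "'g monoid \<Rightarrow> 'g \<Rightarrow> complex"
  where "ga_one G = (\<lambda>x. if x = \<one>\<^bsub>G\<^esub> then 1 else 0)"

definition ga_mult :: "'g monoid \<Rightarrow> ('g \<Rightarrow> complex) \<Rightarrow> ('g \<Rightarrow> complex) \<Rightarrow> 'g \<Rightarrow> complex"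
  where "ga_mult G a b =
    (\<lambda>x. if x \<in> carrier G then \<Sum>y\<in>carrier G. a y * b (inv\<^bsub>G\<^esub> y \<otimes>\<^bsub>G\<^esub> x) else 0)"

definition ga_center :: "'g monoid \<Rightarrow> ('g \<Rightarrow> complex) set"
  where "ga_center G =
    {z \<in> group_algebra G. \<forall>a\<in>group_algebra G. ga_mult G z a = ga_mult G a z}"

definition ga_subalgebra :: "'g monoid \<Rightarrow> ('g \<Rightarrow> complex) set \<Rightarrow> bool"
  where "ga_subalgebra G A \<longleftrightarrow>
    A \<subseteq> group_algebra G \<and> cfun.subspace A \<and> ga_one G \<in> A \<and>
    (\<forall>a\<in>A. \<forall>b\<in>A. ga_mult G a b \<in> A)"

definition ga_generated :: "'g monoid \<Rightarrow> ('g \<Rightarrow> complex) set \<Rightarrow> ('g \<Rightarrow> complex) set"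
  where "ga_generated G S = ga_subalgebra G hull S"

definition ga_act ::
  "'g monoid \<Rightarrow> 'g rep \<Rightarrow> ('g \<Rightarrow> complex) \<Rightarrow> (nat \<Rightarrow> complex) \<Rightarrow> nat \<Rightarrow> complex"
  where "ga_act G M a v = (\<Sum>g\<in>carrier G. a g *\<^sub>c snd M g v)"

definition alg0 :: "(nat \<Rightarrow> 'g monoid) \<Rightarrow> nat \<Rightarrow> ('g \<Rightarrow> complex) set"
  where "alg0 F n = {a \<in> group_algebra (F n).
    \<forall>M T W. irreducible_rep (F n) M \<longrightarrow> GZ_subspace F n M T W \<longrightarrow>
      (\<exists>c. \<forall>w\<in>W. ga_act (F n) M a w = c *\<^sub>c w)}"

text \<open>
  \<open>V \<mu>\<close> is the chosen module of class \<open>\<mu> \<in> F\<^sub>1\<^sup>\<and>\<close> and \<open>B \<mu>\<close> its chosen basis.  The distinguished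
  basis of \<open>V\<^sub>T\<close> is \<open>\<phi> ` B (T 1)\<close> for an \<open>F\<^sub>1\<close>-isomorphism \<open>\<phi>\<close>.
\<close>

definition alg1 :: "('g rep set \<Rightarrow> 'g rep) \<Rightarrow> ('g rep set \<Rightarrow> (nat \<Rightarrow> complex) set) \<Rightarrow>
    (nat \<Rightarrow> 'g monoid) \<Rightarrow> nat \<Rightarrow> ('g \<Rightarrow> complex) set"
  where "alg1 V B F n = {a \<in> group_algebra (F n).
    \<forall>M T W. irreducible_rep (F n) M \<longrightarrow> GZ_subspace F n M T W \<longrightarrow>
      (\<forall>\<phi>. rep_iso (F 1) (V (T 1)) (W, snd M) \<phi> \<longrightarrow>
        (\<forall>b\<in>\<phi> ` B (T 1). \<exists>c. ga_act (F n) M a b = c *\<^sub>c b))}"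

definition alg2 :: "(nat \<Rightarrow> 'g monoid) \<Rightarrow> nat \<Rightarrow> ('g \<Rightarrow> complex) set"
  where "alg2 F n = {a \<in> group_algebra (F n).
    \<forall>M T W. irreducible_rep (F n) M \<longrightarrow> GZ_subspace F n M T W \<longrightarrow>
      (\<forall>w\<in>W. ga_act (F n) M a w \<in> W)}"

end

theory Submission
  imports Defs "HOL-Computational_Algebra.Fundamental_Theorem_Algebra"
begin

text \<open>
  The three statements are one. Let \<open>P\<close> be a condition on endomorphisms of irreducible \<open>F\<^sub>1\<close>-modules that
  holds for scalars, is stable under sums and products, and is invariant under isomorphism. Let
  \<open>A\<^sub>P(m)\<close> consist of the elements of \<open>\<complex>[F\<^sub>m]\<close> that preserve each Gelfand-Tsetlin subspace and satisfy \<open>P\<close>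
  there (\<open>gz_alg\<close>). Being a scalar, being diagonal in the distinguished basis, and no condition at all
  give \<open>\<A>\<^sub>0\<close>, \<open>\<A>\<^sub>1\<close> and \<open>\<A>\<^sub>2\<close>. The general statement is that \<open>A\<^sub>P(n)\<close> is generated by \<open>A\<^sub>P(1)\<close> and
  \<open>Z\<^sub>1, \<dots>, Z\<^sub>n\<close> (\<open>gz_alg_generated\<close>); moreover \<open>\<A>\<^sub>0(1) = Z\<^sub>1\<close> and \<open>\<A>\<^sub>2(1) = \<complex>[F\<^sub>1]\<close>.

  The generators belong to \<open>A\<^sub>P(n)\<close> because \<open>V\<^sub>T\<close> is an irreducible \<open>F\<^sub>1\<close>-module contained in an irreducible
  \<open>F\<^sub>i\<close>-submodule, on which \<open>Z\<^sub>i\<close> acts by scalars. Conversely it suffices that \<open>A\<^sub>P(i + 1)\<close> lies in the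
  algebra generated by \<open>A\<^sub>P(i)\<close> and \<open>Z\<^sub>i\<^sub>+\<^sub>1\<close> (\<open>gz_alg_step\<close>). Let \<open>a \<in> A\<^sub>P(i + 1)\<close>, and let \<open>V\<^sup>\<lambda>\<close> be an irreducible
  \<open>F\<^sub>i\<^sub>+\<^sub>1\<close>-module. Over \<open>F\<^sub>i\<close> it is a direct sum of pairwise non-isomorphic irreducible modules, and \<open>a\<close>
  preserves each of them because they are spanned by Gelfand-Tsetlin subspaces. Operators on pairwise
  non-isomorphic irreducible modules can be prescribed independently by an element of the group
  algebra, so some \<open>b\<^sub>\<lambda> \<in> \<complex>[F\<^sub>i]\<close> acts on \<open>V\<^sup>\<lambda>\<close> as \<open>a\<close> does and annihilates the irreducible \<open>F\<^sub>i\<close>-modules not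
  occurring in \<open>V\<^sup>\<lambda>\<close>; then \<open>b\<^sub>\<lambda> \<in> A\<^sub>P(i)\<close> (\<open>action_realised_below\<close>). If \<open>p\<^sub>\<lambda> \<in> Z\<^sub>i\<^sub>+\<^sub>1\<close> is the projector to the
  class \<open>\<lambda>\<close>, then \<open>a\<close> and \<open>\<Sum>\<^sub>\<lambda> b\<^sub>\<lambda> p\<^sub>\<lambda>\<close> act in the same way on every irreducible module, hence are equal.

  The representation theory behind this is Maschke's theorem, Schur's lemma, faithfulness of the group
  algebra on irreducible modules (\<open>irreducibles_faithful\<close>, from the regular representation) and the
  realisation of arbitrary operators (\<open>operator_realised\<close>). The last one rests on matrix coefficients:
  for a linear functional \<open>f\<close> and a vector \<open>u\<close> of an irreducible module, \<open>\<Sum>\<^sub>g f(g\<^sup>-\<^sup>1 u) g\<close> acts on that module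
  as a nonzero multiple of \<open>x \<mapsto> f(x) u\<close>, and as zero on the other irreducible modules.
\<close>

section \<open>Linear maps on finite-dimensional subspaces\<close>

lemma sum_fun_apply: "(\<Sum>i\<in>I. f i) x = (\<Sum>i\<in>I. f i x)"
  by (induction I rule: infinite_finite_induct) auto

lemma cscale_apply [simp]: "(c *\<^sub>c f) x = c * f x"
  by (simp add: cscale_def)

lemma linear_on_mem: "linear_on V W f \<Longrightarrow> x \<in> V \<Longrightarrow> f x \<in> W"
  by (auto simp: linear_on_def)

lemma linear_on_add: "linear_on V W f \<Longrightarrow> x \<in> V \<Longrightarrow> y \<in> V \<Longrightarrow> f (x + y) = f x + f y"
  by (auto simp: linear_on_def)

lemma linear_on_scale: "linear_on V W f \<Longrightarrow> x \<in> V \<Longrightarrow> f (c *\<^sub>c x) = c *\<^sub>c f x"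
  by (auto simp: linear_on_def)

lemma linear_on_zero: "linear_on V W f \<Longrightarrow> cfun.subspace V \<Longrightarrow> f 0 = 0"
  using linear_on_scale[of V W f 0 0] by (auto simp: cfun.subspace_0)

lemma linear_on_diff:
  assumes "linear_on V W f" "cfun.subspace V" "x \<in> V" "y \<in> V"
  shows "f (x - y) = f x - f y"
proof -
  have "f x = f ((x - y) + y)" by simp
  also have "\<dots> = f (x - y) + f y"
    using assms(2-4) by (intro linear_on_add[OF assms(1)] cfun.subspace_diff)
  finally show ?thesis by simp
qed

lemma linear_on_sum:
  assumes "linear_on V W f" "cfun.subspace V" "\<And>i. i \<in> I \<Longrightarrow> x i \<in> V"
  shows "f (\<Sum>i\<in>I. x i) = (\<Sum>i\<in>I. f (x i))"
  using assms(3)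
proof (induction I rule: infinite_finite_induct)
  case (insert i I)
  then have "x i \<in> V" "sum x I \<in> V" by (auto intro: cfun.subspace_sum[OF assms(2)])
  then have "f (x i + sum x I) = f (x i) + (\<Sum>i\<in>I. f (x i))"
    using insert by (subst linear_on_add[OF assms(1)]) auto
  then show ?case
    unfolding sum.insert[OF insert(1,2)] .
qed (simp_all add: linear_on_zero[OF assms(1,2)])

lemma linear_on_comp:
  "linear_on U V f \<Longrightarrow> linear_on V W g \<Longrightarrow> linear_on U W (\<lambda>x. g (f x))"
  by (auto simp: linear_on_def Pi_iff)

lemma linear_on_subset:
  "linear_on V W f \<Longrightarrow> V' \<subseteq> V \<Longrightarrow> (\<And>x. x \<in> V' \<Longrightarrow> f x \<in> W') \<Longrightarrow> linear_on V' W' f"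
  by (auto simp: linear_on_def Pi_iff subset_eq)

lemma linear_on_image_subspace:
  assumes f: "linear_on V W f" and U: "cfun.subspace U" "U \<subseteq> V"
  shows "cfun.subspace (f ` U)"
proof (rule cfun.subspaceI)
  have "linear_on U W f"
    using linear_on_subset[OF f U(2)] linear_on_mem[OF f] U(2) by blast
  then have "f 0 = 0" using U(1) by (rule linear_on_zero)
  then show "0 \<in> f ` U" using cfun.subspace_0[OF U(1)] by force
next
  fix x y assume "x \<in> f ` U" "y \<in> f ` U"
  then obtain a b where "x = f a" "y = f b" "a \<in> U" "b \<in> U" by auto
  then show "x + y \<in> f ` U"
    using linear_on_add[OF f, of a b] U cfun.subspace_add[OF U(1), of a b]
    by (metis image_eqI subsetD)
next
  fix c x assume "x \<in> f ` U"
  then obtain a where "x = f a" "a \<in> U" by auto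
  then show "c *\<^sub>c x \<in> f ` U"
    using linear_on_scale[OF f, of a c] U cfun.subspace_scale[OF U(1), of a c]
    by (metis image_eqI subsetD)
qed

text \<open>
  The ambient space \<open>'i \<Rightarrow> complex\<close> may be infinite-dimensional, so finiteness of the dimension has to be carried
  by each subspace.
\<close>

definition fin_dim :: "('i \<Rightarrow> complex) set \<Rightarrow> bool"
  where "fin_dim V \<longleftrightarrow> (\<exists>S. finite S \<and> cfun.span S = V)"

lemma fin_dim_basis:
  assumes "fin_dim V" "cfun.subspace U" "U \<subseteq> V"
  obtains B where "finite B" "cfun.independent B" "cfun.span B = U" "card B = cfun.dim U"
proof -
  obtain B where B: "B \<subseteq> U" "cfun.independent B" "U \<subseteq> cfun.span B" "card B = cfun.dim U"
    by (rule cfun.basis_exists)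
  obtain S where S: "finite S" "cfun.span S = V" using assms(1) by (auto simp: fin_dim_def)
  have "finite B"
    using cfun.independent_span_bound[OF S(1) B(2)] B(1) S(2) assms(3) by auto
  moreover have "cfun.span B = U"
    using B(1,3) assms(2) by (meson cfun.span_minimal subset_antisym)
  ultimately show ?thesis using that B by auto
qed

lemma fin_dim_subspace: "fin_dim V \<Longrightarrow> cfun.subspace U \<Longrightarrow> U \<subseteq> V \<Longrightarrow> fin_dim U"
  by (metis fin_dim_basis fin_dim_def)

lemma dim_proper_subspace:
  assumes V: "fin_dim V" "cfun.subspace V" and U: "cfun.subspace U" "U \<subset> V"
  shows "cfun.dim U < cfun.dim V"
proof -
  obtain B where B: "finite B" "cfun.independent B" "cfun.span B = U" "card B = cfun.dim U"
    using fin_dim_basis[OF V(1) U(1)] U(2) by blast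
  obtain C where C: "finite C" "cfun.independent C" "cfun.span C = V" "card C = cfun.dim V"
    using fin_dim_basis[OF V] by blast
  obtain v where v: "v \<in> V" "v \<notin> U" using U(2) by auto
  have "cfun.independent (insert v B)"
    using v B by (intro cfun.independent_insertI) auto
  moreover have "insert v B \<subseteq> cfun.span C"
    using v U(2) B(3) C(3) cfun.span_superset[of B] by auto
  ultimately have "card (insert v B) \<le> card C"
    using cfun.independent_span_bound[OF C(1)] by auto
  moreover have "v \<notin> B" using v B(3) cfun.span_superset[of B] by auto
  ultimately show ?thesis using B C by simp
qed

text \<open>
  The projection exists because the inclusion of \<open>W\<close> has a linear left inverse.
\<close>

lemma projection_exists:
  fixes W :: "('i \<Rightarrow> complex) set"
  assumes "cfun.subspace W"
  obtains p where "linear_on UNIV W p" "\<And>w. w \<in> W \<Longrightarrow> p w = w"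
proof -
  interpret vector_space_pair "cscale :: complex \<Rightarrow> ('i \<Rightarrow> complex) \<Rightarrow> _"
      "cscale :: complex \<Rightarrow> ('i \<Rightarrow> complex) \<Rightarrow> _" ..
  have "Vector_Spaces.linear cscale cscale (id :: ('i \<Rightarrow> complex) \<Rightarrow> _)"
    by (rule cfun.linear_id)
  then obtain p where p: "range p \<subseteq> W" "Vector_Spaces.linear cscale cscale p" "\<forall>v\<in>W. p (id v) = v"
    using linear_exists_left_inverse_on[of id W] assms by auto
  then have "linear_on UNIV W p"
    by (auto simp: linear_on_def linear_add linear_scale)
  with p that show ?thesis by auto
qed

text \<open>
  The vector \<open>p(\<phi>) v\<close>. Everything about eigenvectors is read off from the polynomials that
  annihilate one fixed vector.
\<close>

definition poly_op ::
    "(('i \<Rightarrow> complex) \<Rightarrow> 'i \<Rightarrow> complex) \<Rightarrow> ('i \<Rightarrow> complex) \<Rightarrow> complex poly \<Rightarrow> 'i \<Rightarrow> complex"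
  where "poly_op \<phi> v p = (\<Sum>i\<le>Polynomial.degree p. poly.coeff p i *\<^sub>c (\<phi> ^^ i) v)"

lemma poly_op_bound:
  assumes "Polynomial.degree p \<le> m"
  shows "poly_op \<phi> v p = (\<Sum>i\<le>m. poly.coeff p i *\<^sub>c (\<phi> ^^ i) v)"
  unfolding poly_op_def using assms
  by (intro sum.mono_neutral_left) (auto simp: Polynomial.coeff_eq_0 not_le)

lemma linear_on_funpow: "linear_on V V \<phi> \<Longrightarrow> v \<in> V \<Longrightarrow> (\<phi> ^^ i) v \<in> V"
  by (induction i) (auto simp: linear_on_mem[of V V])

lemma poly_op_linear_factor:
  assumes \<phi>: "linear_on V V \<phi>" and V: "cfun.subspace V" and v: "v \<in> V"
  shows "poly_op \<phi> v ([:-z, 1:] * q) = \<phi> (poly_op \<phi> v q) - z *\<^sub>c poly_op \<phi> v q"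
proof -
  define m where "m = Polynomial.degree q"
  have "Polynomial.degree ([:-z, 1:] * q) \<le> Polynomial.degree [:-z, 1:] + m"
    unfolding m_def by (rule Polynomial.degree_mult_le)
  then have deg: "Polynomial.degree ([:-z, 1:] * q) \<le> Suc m" by simp
  have cf: "poly.coeff ([:-z, 1:] * q) i = (case i of 0 \<Rightarrow> 0 | Suc j \<Rightarrow> poly.coeff q j) - z * poly.coeff q i" for i
    by (simp add: coeff_pCons split: nat.split)
  have "poly_op \<phi> v ([:-z, 1:] * q) =
      (\<Sum>i\<le>Suc m. (case i of 0 \<Rightarrow> 0 | Suc j \<Rightarrow> poly.coeff q j) *\<^sub>c (\<phi> ^^ i) v)
      - (\<Sum>i\<le>Suc m. (z * poly.coeff q i) *\<^sub>c (\<phi> ^^ i) v)"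
    unfolding poly_op_bound[OF deg] cf cfun.scale_left_diff_distrib sum_subtractf ..
  also have "(\<Sum>i\<le>Suc m. (case i of 0 \<Rightarrow> 0 | Suc j \<Rightarrow> poly.coeff q j) *\<^sub>c (\<phi> ^^ i) v)
      = (\<Sum>i\<le>m. poly.coeff q i *\<^sub>c \<phi> ((\<phi> ^^ i) v))"
    by (subst sum.atMost_Suc_shift) simp
  also have "\<dots> = (\<Sum>i\<le>m. \<phi> (poly.coeff q i *\<^sub>c (\<phi> ^^ i) v))"
    by (intro sum.cong refl) (simp add: linear_on_scale[OF \<phi> linear_on_funpow[OF \<phi> v]])
  also have "\<dots> = \<phi> (poly_op \<phi> v q)"
    unfolding poly_op_def m_def
    by (intro linear_on_sum[OF \<phi> V, symmetric] cfun.subspace_scale[OF V] linear_on_funpow[OF \<phi> v])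
  also have "(\<Sum>i\<le>Suc m. (z * poly.coeff q i) *\<^sub>c (\<phi> ^^ i) v) = z *\<^sub>c poly_op \<phi> v q"
    by (subst poly_op_bound[of q "Suc m"]) (simp_all add: m_def cfun.scale_sum_right algebra_simps)
  finally show ?thesis .
qed

text \<open>
  The vectors \<open>v, \<phi> v, \<phi>\<^sup>2 v, \<dots>\<close> cannot all be independent. In the first case of the proof two
  of them coincide, in the second they are distinct and satisfy a linear relation.
\<close>

lemma poly_op_annihilator:
  assumes \<phi>: "linear_on V V \<phi>" and V: "fin_dim V" and v: "v \<in> V"
  obtains p where "p \<noteq> 0" "poly_op \<phi> v p = 0"
proof -
  obtain S where S: "finite S" "cfun.span S = V" using V by (auto simp: fin_dim_def)
  define x where "x = (\<lambda>i. (\<phi> ^^ i) v)"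
  have xV: "x i \<in> V" for i unfolding x_def by (rule linear_on_funpow[OF \<phi> v])
  show ?thesis
  proof (cases "inj_on x {..card S}")
    case False
    then obtain i j where ij: "i \<noteq> j" "x i = x j" by (auto simp: inj_on_def)
    define p :: "complex poly" where "p = Polynomial.monom 1 i - Polynomial.monom 1 j"
    have "poly.coeff p i \<noteq> 0" using ij by (simp add: p_def)
    moreover have "poly_op \<phi> v p = 0"
    proof -
      have deg: "Polynomial.degree p \<le> max i j"
        unfolding p_def by (intro degree_diff_le_max[THEN order_trans]) (simp add: degree_monom_eq)
      have "poly_op \<phi> v p = (\<Sum>k\<le>max i j. (if i = k then x k else 0) - (if j = k then x k else 0))"
        unfolding poly_op_bound[OF deg] unfolding p_def x_def
        by (intro sum.cong refl) (simp add: cfun.scale_left_diff_distrib)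
      also have "\<dots> = 0" using ij(2) by (simp add: sum_subtractf)
      finally show ?thesis .
    qed
    ultimately show ?thesis using that[of p] by (metis coeff_0)
  next
    case True
    have "\<not> cfun.independent (x ` {..card S})"
      using cfun.independent_span_bound[OF S(1), of "x ` {..card S}"] S(2) xV True
      by (auto simp: card_image)
    then obtain u where u: "\<exists>w\<in>x ` {..card S}. u w \<noteq> 0" "(\<Sum>w\<in>x ` {..card S}. u w *\<^sub>c w) = 0"
      by (auto simp: cfun.dependent_finite)
    define p where "p = (\<Sum>i\<le>card S. Polynomial.monom (u (x i)) i)"
    have cp: "poly.coeff p k = (if k \<le> card S then u (x k) else 0)" for k
      by (simp add: p_def coeff_sum)
    have deg: "Polynomial.degree p \<le> card S"
      by (rule Polynomial.degree_le) (simp add: cp)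
    have "poly_op \<phi> v p = (\<Sum>i\<le>card S. u (x i) *\<^sub>c x i)"
      unfolding poly_op_bound[OF deg] by (intro sum.cong refl) (simp add: cp x_def)
    also have "\<dots> = 0" using u(2) True by (simp add: sum.reindex)
    finally have "poly_op \<phi> v p = 0" .
    moreover have "p \<noteq> 0" using u(1) cp by (auto simp: poly_eq_iff)
    ultimately show ?thesis using that by auto
  qed
qed

text \<open>
  Let \<open>p\<close> have the least degree among the nonzero polynomials with \<open>p(\<phi>) v = 0\<close>. It has a root \<open>z\<close>; if
  \<open>p = (X - z) q\<close> then \<open>q(\<phi>) v\<close> is nonzero by minimality and is killed by \<open>\<phi> - z\<close>.
\<close>

lemma eigenvector_exists:
  assumes \<phi>: "linear_on V V \<phi>" and V: "cfun.subspace V" "fin_dim V" "V \<noteq> {0}"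
  obtains c v where "v \<in> V" "v \<noteq> 0" "\<phi> v = c *\<^sub>c v"
proof -
  obtain v where v: "v \<in> V" "v \<noteq> 0" using V cfun.subspace_0 by blast
  define Q where "Q = (\<lambda>p. p \<noteq> 0 \<and> poly_op \<phi> v p = 0)"
  obtain p0 where "Q p0" using poly_op_annihilator[OF \<phi> V(2) v(1)] by (auto simp: Q_def)
  then obtain p where p: "Q p" "\<And>q. Q q \<Longrightarrow> Polynomial.degree p \<le> Polynomial.degree q"
    using ex_has_least_nat[of Q p0 Polynomial.degree] by auto
  have "Polynomial.degree p \<noteq> 0"
  proof
    assume d: "Polynomial.degree p = 0"
    then obtain c where "p = [:c:]" by (rule degree_eq_zeroE)
    with p(1) v(2) show False by (auto simp: Q_def poly_op_def)
  qed
  then have "\<not> constant (poly p)" by (simp add: constant_degree)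
  then obtain z where "poly p z = 0" using fundamental_theorem_of_algebra by blast
  then obtain q where q: "p = [:-z, 1:] * q" by (auto simp: poly_eq_0_iff_dvd)
  then have "q \<noteq> 0" using p(1) by (auto simp: Q_def)
  then have "Polynomial.degree p = Suc (Polynomial.degree q)"
    unfolding q by (subst Polynomial.degree_mult_eq) auto
  then have "poly_op \<phi> v q \<noteq> 0" using p(2)[of q] \<open>q \<noteq> 0\<close> by (auto simp: Q_def)
  moreover have "poly_op \<phi> v q \<in> V"
    unfolding poly_op_def
    by (intro cfun.subspace_sum[OF V(1)] cfun.subspace_scale[OF V(1)] linear_on_funpow[OF \<phi> v(1)])
  moreover have "\<phi> (poly_op \<phi> v q) = z *\<^sub>c poly_op \<phi> v q"
    using poly_op_linear_factor[OF \<phi> V(1) v(1), of z q] p(1) by (simp add: Q_def q)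
  ultimately show ?thesis using that by blast
qed

lemma linear_on_sumI:
  assumes "\<And>i. i \<in> I \<Longrightarrow> linear_on V W (f i)" "cfun.subspace W"
  shows "linear_on V W (\<lambda>v. \<Sum>i\<in>I. f i v)"
  unfolding linear_on_def
proof (intro conjI ballI allI)
  show "(\<lambda>v. \<Sum>i\<in>I. f i v) \<in> V \<rightarrow> W"
    using assms by (auto intro!: cfun.subspace_sum intro: linear_on_mem)
next
  fix x y assume "x \<in> V" "y \<in> V"
  then have "(\<Sum>i\<in>I. f i (x + y)) = (\<Sum>i\<in>I. f i x + f i y)"
    by (intro sum.cong refl linear_on_add[OF assms(1)])
  then show "(\<Sum>i\<in>I. f i (x + y)) = (\<Sum>i\<in>I. f i x) + (\<Sum>i\<in>I. f i y)"
    by (simp only: sum.distrib)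
next
  fix c x assume "x \<in> V"
  then have "(\<Sum>i\<in>I. f i (c *\<^sub>c x)) = (\<Sum>i\<in>I. c *\<^sub>c f i x)"
    by (intro sum.cong refl linear_on_scale[OF assms(1)])
  then show "(\<Sum>i\<in>I. f i (c *\<^sub>c x)) = c *\<^sub>c (\<Sum>i\<in>I. f i x)"
    by (simp only: cfun.scale_sum_right)
qed

lemma linear_on_scaleI:
  assumes f: "linear_on V W f" and W: "cfun.subspace W"
  shows "linear_on V W (\<lambda>v. c *\<^sub>c f v)"
  unfolding linear_on_def
proof (intro conjI ballI allI)
  show "(\<lambda>v. c *\<^sub>c f v) \<in> V \<rightarrow> W"
    using linear_on_mem[OF f] cfun.subspace_scale[OF W] by auto
next
  fix x y assume "x \<in> V" "y \<in> V"
  then show "c *\<^sub>c f (x + y) = c *\<^sub>c f x + c *\<^sub>c f y"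
    by (simp only: linear_on_add[OF f] cfun.scale_right_distrib)
next
  fix d x assume "x \<in> V"
  then show "c *\<^sub>c f (d *\<^sub>c x) = d *\<^sub>c c *\<^sub>c f x"
    by (simp only: linear_on_scale[OF f] cfun.scale_scale mult.commute)
qed

section \<open>Representations and Schur's lemma\<close>

lemma is_rep_iff: "is_rep G M \<longleftrightarrow>
    cfun.subspace (fst M) \<and> fin_dim (fst M) \<and>
    (\<forall>g\<in>carrier G. linear_on (fst M) (fst M) (snd M g)) \<and>
    (\<forall>v\<in>fst M. snd M \<one>\<^bsub>G\<^esub> v = v) \<and>
    (\<forall>g\<in>carrier G. \<forall>h\<in>carrier G. \<forall>v\<in>fst M. snd M (g \<otimes>\<^bsub>G\<^esub> h) v = snd M g (snd M h v))"
  by (simp add: is_rep_def fin_dim_def case_prod_beta)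

lemma
  assumes "is_rep G M"
  shows rep_subspace: "cfun.subspace (fst M)"
    and rep_fin_dim: "fin_dim (fst M)"
    and rep_linear: "g \<in> carrier G \<Longrightarrow> linear_on (fst M) (fst M) (snd M g)"
    and rep_one: "v \<in> fst M \<Longrightarrow> snd M \<one>\<^bsub>G\<^esub> v = v"
    and rep_mult: "g \<in> carrier G \<Longrightarrow> h \<in> carrier G \<Longrightarrow> v \<in> fst M \<Longrightarrow>
        snd M (g \<otimes>\<^bsub>G\<^esub> h) v = snd M g (snd M h v)"
    and rep_mem: "g \<in> carrier G \<Longrightarrow> v \<in> fst M \<Longrightarrow> snd M g v \<in> fst M"
  using assms by (auto simp: is_rep_iff intro: linear_on_mem)

lemma submodule_iff: "submodule_of G M W \<longleftrightarrow>
    cfun.subspace W \<and> W \<subseteq> fst M \<and> (\<forall>g\<in>carrier G. \<forall>w\<in>W. snd M g w \<in> W)"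
  by (simp add: submodule_of_def case_prod_beta)

lemma submodule_is_rep:
  assumes M: "is_rep G M" and W: "submodule_of G M W"
  shows "is_rep G (W, snd M)"
proof -
  have *: "cfun.subspace W" "W \<subseteq> fst M" "\<forall>g\<in>carrier G. \<forall>w\<in>W. snd M g w \<in> W"
    using W by (auto simp: submodule_iff)
  have "fin_dim W" by (rule fin_dim_subspace[OF rep_fin_dim[OF M] *(1,2)])
  moreover have "linear_on W W (snd M g)" if "g \<in> carrier G" for g
    by (rule linear_on_subset[OF rep_linear[OF M that] *(2)]) (use *(3) that in auto)
  moreover have "\<forall>v\<in>W. snd M \<one>\<^bsub>G\<^esub> v = v" using rep_one[OF M] *(2) by auto
  moreover have "\<forall>g\<in>carrier G. \<forall>h\<in>carrier G. \<forall>v\<in>W. snd M (g \<otimes>\<^bsub>G\<^esub> h) v = snd M g (snd M h v)"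
    using rep_mult[OF M] *(2) by auto
  ultimately show ?thesis using *(1) unfolding is_rep_iff by simp
qed

lemma submodule_trans:
  "submodule_of G M U \<Longrightarrow> submodule_of G (U, snd M) W \<Longrightarrow> submodule_of G M W"
  by (auto simp: submodule_iff)

lemma irreducible_is_rep: "irreducible_rep G M \<Longrightarrow> is_rep G M"
  by (simp add: irreducible_rep_def)

definition intertwiner ::
    "'g monoid \<Rightarrow> 'g rep \<Rightarrow> 'g rep \<Rightarrow> ((nat \<Rightarrow> complex) \<Rightarrow> nat \<Rightarrow> complex) \<Rightarrow> bool"
  where "intertwiner G M N \<phi> \<longleftrightarrow> linear_on (fst M) (fst N) \<phi> \<and>
    (\<forall>g\<in>carrier G. \<forall>v\<in>fst M. \<phi> (snd M g v) = snd N g (\<phi> v))"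

lemma rep_iso_iff: "rep_iso G M N \<phi> \<longleftrightarrow> intertwiner G M N \<phi> \<and> bij_betw \<phi> (fst M) (fst N)"
  by (auto simp: rep_iso_def intertwiner_def case_prod_beta)

lemma intertwiner_linear: "intertwiner G M N \<phi> \<Longrightarrow> linear_on (fst M) (fst N) \<phi>"
  by (simp add: intertwiner_def)

lemma intertwiner_equivariant:
  "intertwiner G M N \<phi> \<Longrightarrow> g \<in> carrier G \<Longrightarrow> v \<in> fst M \<Longrightarrow> \<phi> (snd M g v) = snd N g (\<phi> v)"
  by (simp add: intertwiner_def)

lemma intertwiner_image_submodule:
  assumes \<phi>: "intertwiner G M N \<phi>" and U: "submodule_of G M U"
  shows "submodule_of G N (\<phi> ` U)"
  unfolding submodule_iff
proof (intro conjI ballI)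
  have *: "cfun.subspace U" "U \<subseteq> fst M" "\<forall>g\<in>carrier G. \<forall>w\<in>U. snd M g w \<in> U"
    using U by (auto simp: submodule_iff)
  show "cfun.subspace (\<phi> ` U)"
    by (rule linear_on_image_subspace[OF intertwiner_linear[OF \<phi>] *(1,2)])
  show "\<phi> ` U \<subseteq> fst N" using linear_on_mem[OF intertwiner_linear[OF \<phi>]] *(2) by auto
  fix g w assume g: "g \<in> carrier G" and "w \<in> \<phi> ` U"
  then obtain u where u: "u \<in> U" "w = \<phi> u" by auto
  then have "snd N g w = \<phi> (snd M g u)"
    using intertwiner_equivariant[OF \<phi> g, of u] *(2) by auto
  then show "snd N g w \<in> \<phi> ` U" using *(3) g u by auto
qed

text \<open>
  With \<open>\<psi> = 0\<close> this is the kernel of \<open>\<phi>\<close>, with \<open>\<psi>\<close> a scalar it is an eigenspace; these are the two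
  submodules to which Schur's lemma applies irreducibility.
\<close>

lemma equalizer_submodule:
  assumes M: "is_rep G M" and N: "is_rep G N"
    and \<phi>: "intertwiner G M N \<phi>" and \<psi>: "intertwiner G M N \<psi>"
  shows "submodule_of G M {v \<in> fst M. \<phi> v = \<psi> v}"
  unfolding submodule_iff
proof (intro conjI ballI)
  note [simp] = cfun.subspace_0[OF rep_subspace[OF M]] cfun.subspace_add[OF rep_subspace[OF M]]
    cfun.subspace_scale[OF rep_subspace[OF M]] rep_mem[OF M]
    linear_on_zero[OF intertwiner_linear[OF \<phi>] rep_subspace[OF M]]
    linear_on_zero[OF intertwiner_linear[OF \<psi>] rep_subspace[OF M]]
    linear_on_add[OF intertwiner_linear[OF \<phi>]] linear_on_add[OF intertwiner_linear[OF \<psi>]]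
    linear_on_scale[OF intertwiner_linear[OF \<phi>]] linear_on_scale[OF intertwiner_linear[OF \<psi>]]
    intertwiner_equivariant[OF \<phi>] intertwiner_equivariant[OF \<psi>]
  show "cfun.subspace {v \<in> fst M. \<phi> v = \<psi> v}"
    by (rule cfun.subspaceI) simp_all
  show "{v \<in> fst M. \<phi> v = \<psi> v} \<subseteq> fst M" by auto
  show "snd M g w \<in> {v \<in> fst M. \<phi> v = \<psi> v}" if "g \<in> carrier G" "w \<in> {v \<in> fst M. \<phi> v = \<psi> v}" for g w
    using that by simp
qed

lemma intertwiner_zero:
  assumes "is_rep G M" "is_rep G N" shows "intertwiner G M N (\<lambda>v. 0)"
  unfolding intertwiner_def linear_on_def
  using cfun.subspace_0[OF rep_subspace[OF assms(2)]]
    linear_on_zero[OF rep_linear[OF assms(2)] rep_subspace[OF assms(2)]]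
  by simp

lemma intertwiner_scale:
  assumes M: "is_rep G M" shows "intertwiner G M M (\<lambda>v. c *\<^sub>c v)"
  unfolding intertwiner_def
proof (intro conjI ballI)
  have "linear_on (fst M) (fst M) (\<lambda>v. v)" by (simp add: linear_on_def)
  then show "linear_on (fst M) (fst M) (\<lambda>v. c *\<^sub>c v)"
    using rep_subspace[OF M] by (rule linear_on_scaleI)
qed (simp add: linear_on_scale[OF rep_linear[OF M]])

lemma schur_zero_or_iso:
  assumes M: "irreducible_rep G M" and N: "irreducible_rep G N" and \<phi>: "intertwiner G M N \<phi>"
  shows "(\<forall>v\<in>fst M. \<phi> v = 0) \<or> rep_iso G M N \<phi>"
proof -
  note rM = irreducible_is_rep[OF M] and rN = irreducible_is_rep[OF N]
  define K where "K = {v \<in> fst M. \<phi> v = 0}"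
  have "submodule_of G M K"
    using equalizer_submodule[OF rM rN \<phi> intertwiner_zero[OF rM rN]] by (simp add: K_def)
  then consider "K = fst M" | "K = {0}" using M by (auto simp: irreducible_rep_def)
  then show ?thesis
  proof cases
    case 1
    then show ?thesis by (auto simp: K_def)
  next
    case 2
    have "submodule_of G M (fst M)"
      using rep_subspace[OF rM] rep_mem[OF rM] by (simp add: submodule_iff)
    from intertwiner_image_submodule[OF \<phi> this]
    have "\<phi> ` fst M = {0} \<or> \<phi> ` fst M = fst N" using N by (simp add: irreducible_rep_def)
    moreover have "\<phi> ` fst M \<noteq> {0}"
    proof
      assume "\<phi> ` fst M = {0}"
      then have "K = fst M" by (auto simp: K_def)
      with 2 M show False by (simp add: irreducible_rep_def)
    qed
    moreover have "inj_on \<phi> (fst M)"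
    proof (rule inj_onI)
      fix x y assume xy: "x \<in> fst M" "y \<in> fst M" "\<phi> x = \<phi> y"
      then have "\<phi> (x - y) = 0"
        using linear_on_diff[OF intertwiner_linear[OF \<phi>] rep_subspace[OF rM]] by simp
      then have "x - y \<in> K"
        using xy cfun.subspace_diff[OF rep_subspace[OF rM]] by (simp add: K_def)
      with 2 show "x = y" by simp
    qed
    ultimately show ?thesis using \<phi> by (auto simp: rep_iso_iff bij_betw_def)
  qed
qed

lemma schur_scalar:
  assumes M: "irreducible_rep G M" and \<phi>: "intertwiner G M M \<phi>"
  obtains c where "\<And>v. v \<in> fst M \<Longrightarrow> \<phi> v = c *\<^sub>c v"
proof -
  note rM = irreducible_is_rep[OF M]
  have "fst M \<noteq> {0}" using M by (simp add: irreducible_rep_def)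
  then obtain c v where v: "v \<in> fst M" "v \<noteq> 0" "\<phi> v = c *\<^sub>c v"
    using eigenvector_exists[OF intertwiner_linear[OF \<phi>] rep_subspace[OF rM] rep_fin_dim[OF rM]]
    by blast
  have "submodule_of G M {v \<in> fst M. \<phi> v = c *\<^sub>c v}"
    by (rule equalizer_submodule[OF rM rM \<phi> intertwiner_scale[OF rM]])
  then have "{v \<in> fst M. \<phi> v = c *\<^sub>c v} = {0} \<or> {v \<in> fst M. \<phi> v = c *\<^sub>c v} = fst M"
    using M by (simp add: irreducible_rep_def)
  moreover have "{v \<in> fst M. \<phi> v = c *\<^sub>c v} \<noteq> {0}" using v by blast
  ultimately show ?thesis using that by blast
qed

lemma rep_iso_refl:
  assumes "is_rep G M" shows "rep_iso G M M (\<lambda>v. v)"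
  using intertwiner_scale[OF assms, of 1] by (simp add: rep_iso_iff bij_betw_def)

lemma rep_iso_trans:
  assumes "rep_iso G L M \<phi>" "rep_iso G M N \<psi>"
  shows "rep_iso G L N (\<lambda>v. \<psi> (\<phi> v))"
proof -
  have "linear_on (fst L) (fst N) (\<lambda>v. \<psi> (\<phi> v))"
    using assms by (auto simp: rep_iso_iff intertwiner_def intro: linear_on_comp)
  moreover have "bij_betw (\<lambda>v. \<psi> (\<phi> v)) (fst L) (fst N)"
    using bij_betw_trans[of \<phi> "fst L" "fst M" \<psi> "fst N"] assms by (simp add: rep_iso_iff comp_def)
  moreover have "\<phi> v \<in> fst M" if "v \<in> fst L" for v
    using assms(1) that by (auto simp: rep_iso_iff bij_betw_def)
  ultimately show ?thesis using assms by (auto simp: rep_iso_iff intertwiner_def)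
qed

lemma rep_iso_sym:
  assumes M: "is_rep G M" and \<phi>: "rep_iso G M N \<phi>"
  shows "rep_iso G N M (inv_into (fst M) \<phi>)"
proof -
  let ?\<psi> = "inv_into (fst M) \<phi>"
  have i: "intertwiner G M N \<phi>" and b: "bij_betw \<phi> (fst M) (fst N)"
    using \<phi> by (auto simp: rep_iso_iff)
  note lin = intertwiner_linear[OF i] and sub = rep_subspace[OF M]
  have b': "bij_betw ?\<psi> (fst N) (fst M)" using b by (rule bij_betw_inv_into)
  have mem: "?\<psi> y \<in> fst M" if "y \<in> fst N" for y using b' that by (auto simp: bij_betw_def)
  have r: "\<phi> (?\<psi> y) = y" if "y \<in> fst N" for y using bij_betw_inv_into_right[OF b that] .
  have eq: "?\<psi> y = x" if "x \<in> fst M" "\<phi> x = y" for x y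
    using bij_betw_inv_into_left[OF b that(1)] that(2) by simp
  have "?\<psi> (x + y) = ?\<psi> x + ?\<psi> y" if "x \<in> fst N" "y \<in> fst N" for x y
    using that by (intro eq cfun.subspace_add[OF sub] mem) (simp_all only: linear_on_add[OF lin mem mem] r)
  moreover have "?\<psi> (c *\<^sub>c x) = c *\<^sub>c ?\<psi> x" if "x \<in> fst N" for c x
    using that by (intro eq cfun.subspace_scale[OF sub] mem) (simp_all only: linear_on_scale[OF lin mem] r)
  moreover have "?\<psi> (snd N g y) = snd M g (?\<psi> y)" if "g \<in> carrier G" "y \<in> fst N" for g y
    using that by (intro eq rep_mem[OF M] mem) (simp_all only: intertwiner_equivariant[OF i that(1) mem] r)
  ultimately show ?thesis
    using b' mem by (auto simp: rep_iso_iff intertwiner_def linear_on_def)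
qed

text \<open>
  The group may shrink together with the space; this is how an isomorphism of \<open>F\<^sub>i\<close>-modules is
  restricted to the \<open>F\<^sub>j\<close>-submodules, \<open>j \<le> i\<close>, of a Gelfand-Tsetlin flag.
\<close>

lemma rep_iso_restrict:
  assumes \<phi>: "rep_iso G M N \<phi>" and U: "U \<subseteq> fst M" and H: "carrier H \<subseteq> carrier G"
  shows "rep_iso H (U, snd M) (\<phi> ` U, snd N) \<phi>"
proof -
  have "linear_on U (\<phi> ` U) \<phi>"
    using \<phi> U by (auto simp: rep_iso_iff intertwiner_def intro: linear_on_subset)
  moreover have "bij_betw \<phi> U (\<phi> ` U)"
    using \<phi> U by (auto simp: rep_iso_iff bij_betw_def intro: inj_on_subset)
  ultimately show ?thesis using \<phi> U H by (auto simp: rep_iso_iff intertwiner_def subset_eq)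
qed

lemma rep_iso_irreducible:
  assumes M: "irreducible_rep G M" and N: "is_rep G N" and \<phi>: "rep_iso G M N \<phi>"
  shows "irreducible_rep G N"
  unfolding irreducible_rep_def
proof (intro conjI allI impI)
  note rM = irreducible_is_rep[OF M]
  let ?\<psi> = "inv_into (fst M) \<phi>"
  have \<psi>: "rep_iso G N M ?\<psi>" by (rule rep_iso_sym[OF rM \<phi>])
  have b: "bij_betw ?\<psi> (fst N) (fst M)" using \<psi> by (simp add: rep_iso_iff)
  have z: "?\<psi> 0 = 0"
    using \<psi> linear_on_zero[OF _ rep_subspace[OF N], of "fst M" ?\<psi>]
    by (simp add: rep_iso_iff intertwiner_def)
  show "is_rep G N" by fact
  show "fst N \<noteq> {0}"
  proof
    assume "fst N = {0}"
    then have "fst M = {0}" using b z by (auto simp: bij_betw_def)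
    with M show False by (simp add: irreducible_rep_def)
  qed
  fix W assume W: "submodule_of G N W"
  then have sub: "W \<subseteq> fst N" and "0 \<in> W" by (auto simp: submodule_iff cfun.subspace_0)
  have "submodule_of G M (?\<psi> ` W)"
    using \<psi> W by (auto simp: rep_iso_iff intro: intertwiner_image_submodule)
  then consider "?\<psi> ` W = {0}" | "?\<psi> ` W = fst M" using M by (auto simp: irreducible_rep_def)
  then show "W = {0} \<or> W = fst N"
  proof cases
    case 1
    have "w = 0" if "w \<in> W" for w
    proof -
      have "?\<psi> w = ?\<psi> 0" using 1 that z by auto
      moreover have "w \<in> fst N" "0 \<in> fst N" using sub that \<open>0 \<in> W\<close> by auto
      ultimately show ?thesis using b by (auto simp: bij_betw_def dest: inj_onD)
    qed
    then show ?thesis using \<open>0 \<in> W\<close> by auto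
  next
    case 2
    then have "?\<psi> ` W = ?\<psi> ` fst N" using b by (simp add: bij_betw_def)
    then have "W = fst N" using b sub inj_on_image_eq_iff[of ?\<psi> "fst N" W "fst N"]
      by (auto simp: bij_betw_def)
    then show ?thesis ..
  qed
qed

lemma ga_act_linear:
  assumes "is_rep G M" shows "linear_on (fst M) (fst M) (ga_act G M a)"
  unfolding ga_act_def
  by (intro linear_on_sumI linear_on_scaleI rep_linear[OF assms] rep_subspace[OF assms])

lemma ga_act_sub_rep [simp]: "ga_act G (W, snd M) = ga_act G M"
  by (simp add: ga_act_def fun_eq_iff)

lemma ga_act_add: "ga_act G M (a + b) v = ga_act G M a v + ga_act G M b v"
  by (simp add: ga_act_def cfun.scale_left_distrib sum.distrib)

lemma ga_act_scale: "ga_act G M (c *\<^sub>c a) v = c *\<^sub>c ga_act G M a v"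
  by (simp add: ga_act_def cfun.scale_sum_right)

lemma ga_act_zero: "ga_act G M 0 v = 0"
  by (simp add: ga_act_def)

lemma ga_act_sum: "ga_act G M (\<Sum>i\<in>I. a i) v = (\<Sum>i\<in>I. ga_act G M (a i) v)"
  by (induction I rule: infinite_finite_induct) (simp_all only: ga_act_zero ga_act_add sum.infinite sum.empty sum.insert simp_thms)

lemma intertwiner_ga_act:
  assumes M: "is_rep G M" and \<phi>: "intertwiner G M N \<phi>" and v: "v \<in> fst M"
  shows "\<phi> (ga_act G M a v) = ga_act G N a (\<phi> v)"
proof -
  note lin = intertwiner_linear[OF \<phi>] and sub = rep_subspace[OF M]
  have "\<phi> (ga_act G M a v) = (\<Sum>g\<in>carrier G. \<phi> (a g *\<^sub>c snd M g v))"
    unfolding ga_act_def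
    by (intro linear_on_sum[OF lin sub] cfun.subspace_scale[OF sub] rep_mem[OF M] v)
  also have "\<dots> = (\<Sum>g\<in>carrier G. a g *\<^sub>c snd N g (\<phi> v))"
    by (intro sum.cong refl) (simp add: linear_on_scale[OF lin] rep_mem[OF M] v intertwiner_equivariant[OF \<phi>])
  finally show ?thesis by (simp add: ga_act_def)
qed

section \<open>Averaging over a finite group and complete reducibility\<close>

locale finite_group = group G for G :: "'g monoid" (structure) +
  assumes finite_carrier: "finite (carrier G)"
begin

lemma bij_left_mult: "g \<in> carrier G \<Longrightarrow> bij_betw (\<lambda>h. g \<otimes> h) (carrier G) (carrier G)"
  by (simp add: bij_betw_def inj_on_cmult surj_const_mult)

lemma sum_left_mult: "g \<in> carrier G \<Longrightarrow> (\<Sum>h\<in>carrier G. f (g \<otimes> h)) = (\<Sum>h\<in>carrier G. f h)"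
  by (rule sum.reindex_bij_betw[OF bij_left_mult])

text \<open>
  Substituting \<open>g \<otimes> h\<close> for \<open>h\<close> in the sum moves \<open>g\<close> across. The lemma is used for a projection
  (Maschke's theorem) and for a rank one operator (matrix coefficients).
\<close>

lemma average_intertwiner:
  assumes M: "is_rep G M" and N: "is_rep G N" and L: "linear_on (fst M) (fst N) L"
  shows "intertwiner G M N (\<lambda>v. \<Sum>h\<in>carrier G. snd N h (L (snd M (inv h) v)))"
    (is "intertwiner G M N ?\<Phi>")
  unfolding intertwiner_def
proof (intro conjI ballI)
  have "linear_on (fst M) (fst N) (\<lambda>v. snd N h (L (snd M (inv h) v)))" if "h \<in> carrier G" for h
    by (rule linear_on_comp[OF linear_on_comp[OF rep_linear[OF M] L] rep_linear[OF N that]])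
      (simp add: that)
  then show "linear_on (fst M) (fst N) ?\<Phi>"
    by (rule linear_on_sumI[OF _ rep_subspace[OF N]])
  fix g v assume g: "g \<in> carrier G" and v: "v \<in> fst M"
  have "?\<Phi> (snd M g v) = (\<Sum>h\<in>carrier G. snd N (g \<otimes> h) (L (snd M (inv (g \<otimes> h)) (snd M g v))))"
    using g by (rule sum_left_mult[symmetric])
  also have "\<dots> = (\<Sum>h\<in>carrier G. snd N g (snd N h (L (snd M (inv h) v))))"
  proof (rule sum.cong[OF refl])
    fix h assume h: "h \<in> carrier G"
    have "snd M (inv (g \<otimes> h)) (snd M g v) = snd M (inv (g \<otimes> h) \<otimes> g) v"
      using g h v by (simp add: rep_mult[OF M])
    also have "inv (g \<otimes> h) \<otimes> g = inv h"
      using g h by (simp add: inv_mult_group m_assoc)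
    finally show "snd N (g \<otimes> h) (L (snd M (inv (g \<otimes> h)) (snd M g v)))
        = snd N g (snd N h (L (snd M (inv h) v)))"
      using rep_mult[OF N g h] linear_on_mem[OF L] rep_mem[OF M] h v by simp
  qed
  also have "\<dots> = snd N g (?\<Phi> v)"
    by (rule linear_on_sum[OF rep_linear[OF N g] rep_subspace[OF N], symmetric])
      (use rep_mem[OF N] rep_mem[OF M] linear_on_mem[OF L] v in simp)
  finally show "?\<Phi> (snd M g v) = snd N g (?\<Phi> v)" .
qed

text \<open>
  The average of a linear projection onto \<open>W\<close> is an intertwiner that acts on \<open>W\<close> as multiplication by
  the group order, so its kernel is an invariant complement.
\<close>

lemma maschke:
  assumes M: "is_rep G M" and W: "submodule_of G M W"
  obtains W' where "submodule_of G M W'" "W \<inter> W' = {0}"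
    "\<And>v. v \<in> fst M \<Longrightarrow> \<exists>w\<in>W. \<exists>w'\<in>W'. v = w + w'"
proof -
  have sW: "cfun.subspace W" and WM: "W \<subseteq> fst M"
    and gW: "\<And>g w. g \<in> carrier G \<Longrightarrow> w \<in> W \<Longrightarrow> snd M g w \<in> W"
    using W by (auto simp: submodule_iff)
  have N: "is_rep G (W, snd M)" by (rule submodule_is_rep[OF M W])
  obtain p where p: "linear_on UNIV W p" "\<And>w. w \<in> W \<Longrightarrow> p w = w"
    using projection_exists[OF sW] by blast
  define S where "S = (\<lambda>v. \<Sum>h\<in>carrier G. snd M h (p (snd M (inv h) v)))"
  have "linear_on (fst M) W p"
    using linear_on_subset[OF p(1) subset_UNIV] linear_on_mem[OF p(1)] by blast
  then have S: "intertwiner G M (W, snd M) S"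
    using average_intertwiner[OF M N, of p] by (simp add: S_def)
  define W' where "W' = {v \<in> fst M. S v = 0}"
  define m where "m = of_nat (card (carrier G)) * (1::complex)"
  have m: "m \<noteq> 0" using finite_carrier one_closed by (auto simp: m_def)
  have SW: "S w = m *\<^sub>c w" if w: "w \<in> W" for w
  proof -
    have "S w = (\<Sum>h\<in>carrier G. w)"
      unfolding S_def
    proof (rule sum.cong[OF refl])
      fix h assume h: "h \<in> carrier G"
      have "snd M h (p (snd M (inv h) w)) = snd M (h \<otimes> inv h) w"
        using h w WM rep_mult[OF M h inv_closed[OF h], of w] by (subst p(2)) (auto simp: gW)
      then show "snd M h (p (snd M (inv h) w)) = w"
        using h w WM rep_one[OF M] by auto
    qed
    also have "\<dots> = m *\<^sub>c w" by (simp add: m_def sum_fun_apply fun_eq_iff)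
    finally show ?thesis .
  qed
  have "submodule_of G M W'"
    unfolding W'_def using equalizer_submodule[OF M N S intertwiner_zero[OF M N]] .
  moreover have "W \<inter> W' = {0}"
  proof -
    have "w = 0" if "w \<in> W" "w \<in> W'" for w
      using SW[OF that(1)] that(2) m by (simp add: W'_def)
    moreover have "0 \<in> W \<inter> W'"
      using cfun.subspace_0[OF sW] calculation \<open>submodule_of G M W'\<close>
      by (auto simp: submodule_iff cfun.subspace_0)
    ultimately show ?thesis by auto
  qed
  moreover have "\<exists>w\<in>W. \<exists>w'\<in>W'. v = w + w'" if v: "v \<in> fst M" for v
  proof (intro bexI)
    let ?w = "(1 / m) *\<^sub>c S v"
    show w: "?w \<in> W"
      using linear_on_mem[OF intertwiner_linear[OF S] v] cfun.subspace_scale[OF sW] by simp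
    have "S (v - ?w) = S v - S ?w"
      using linear_on_diff[OF intertwiner_linear[OF S] rep_subspace[OF M] v] w WM by auto
    also have "\<dots> = 0" using SW[OF w] m by simp
    finally show "v - ?w \<in> W'"
      using v w WM cfun.subspace_diff[OF rep_subspace[OF M]] by (auto simp: W'_def)
  qed simp
  ultimately show ?thesis using that by blast
qed

lemma ga_act_one: "is_rep G M \<Longrightarrow> v \<in> fst M \<Longrightarrow> ga_act G M (ga_one G) v = v"
proof -
  assume M: "is_rep G M" and v: "v \<in> fst M"
  have "ga_act G M (ga_one G) v = (\<Sum>g\<in>carrier G. if g = \<one> then snd M g v else 0)"
    unfolding ga_act_def by (intro sum.cong refl) (simp add: ga_one_def)
  also have "\<dots> = snd M \<one> v" using finite_carrier by (simp add: sum.delta')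
  finally show ?thesis using rep_one[OF M v] by simp
qed

text \<open>
  Composition of actions turns into convolution by substituting \<open>y \<otimes> g\<close> for \<open>g\<close> in the inner sum.
\<close>

lemma ga_act_mult:
  assumes M: "is_rep G M" and v: "v \<in> fst M"
  shows "ga_act G M (ga_mult G a b) v = ga_act G M a (ga_act G M b v)"
proof -
  note sub = rep_subspace[OF M]
  have "ga_act G M (ga_mult G a b) v =
      (\<Sum>g\<in>carrier G. \<Sum>y\<in>carrier G. (a y * b (inv y \<otimes> g)) *\<^sub>c snd M g v)"
    unfolding ga_act_def by (intro sum.cong refl) (simp add: ga_mult_def cfun.scale_sum_left)
  also have "\<dots> = (\<Sum>y\<in>carrier G. \<Sum>g\<in>carrier G. (a y * b (inv y \<otimes> g)) *\<^sub>c snd M g v)"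
    by (rule sum.swap)
  also have "\<dots> = (\<Sum>y\<in>carrier G. a y *\<^sub>c snd M y (ga_act G M b v))"
  proof (rule sum.cong[OF refl])
    fix y assume y: "y \<in> carrier G"
    have "(\<Sum>g\<in>carrier G. (a y * b (inv y \<otimes> g)) *\<^sub>c snd M g v) =
        (\<Sum>g\<in>carrier G. (a y * b (inv y \<otimes> (y \<otimes> g))) *\<^sub>c snd M (y \<otimes> g) v)"
      using y by (rule sum_left_mult[symmetric])
    also have "\<dots> = (\<Sum>g\<in>carrier G. a y *\<^sub>c snd M y (b g *\<^sub>c snd M g v))"
      using y v
      by (intro sum.cong refl)
        (simp add: rep_mult[OF M] rep_mem[OF M] linear_on_scale[OF rep_linear[OF M]] m_assoc[symmetric])
    also have "\<dots> = a y *\<^sub>c (\<Sum>g\<in>carrier G. snd M y (b g *\<^sub>c snd M g v))"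
      by (rule cfun.scale_sum_right[symmetric])
    also have "(\<Sum>g\<in>carrier G. snd M y (b g *\<^sub>c snd M g v)) = snd M y (ga_act G M b v)"
      unfolding ga_act_def using v
      by (intro linear_on_sum[OF rep_linear[OF M y] sub, symmetric] cfun.subspace_scale[OF sub] rep_mem[OF M])
    finally show "(\<Sum>g\<in>carrier G. (a y * b (inv y \<otimes> g)) *\<^sub>c snd M g v) = a y *\<^sub>c snd M y (ga_act G M b v)" .
  qed
  finally show ?thesis by (simp add: ga_act_def)
qed

end

text \<open>
  The new summand is put at the last index so that decompositions can be built one irreducible
  constituent at a time.
\<close>

lemma direct_sum_snoc:
  assumes V': "direct_sum V' k W" "cfun.subspace V'" "V' \<subseteq> V"
    and V0: "cfun.subspace V0" "V0 \<subseteq> V" "V0 \<inter> V' = {0}"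
    and sum: "\<And>v. v \<in> V \<Longrightarrow> \<exists>x\<in>V0. \<exists>y\<in>V'. v = x + y"
  shows "direct_sum V (Suc k) (W(k := V0))"
  unfolding direct_sum_def
proof (intro conjI ballI)
  let ?W = "W(k := V0)"
  have sW: "cfun.subspace (W j)" "W j \<subseteq> V'" if "j < k" for j
    using V'(1) that by (auto simp: direct_sum_def)
  show "\<forall>j<Suc k. cfun.subspace (?W j) \<and> ?W j \<subseteq> V"
    using sW V'(3) V0 by (auto simp: less_Suc_eq)
  fix v assume "v \<in> V"
  then obtain x y where xy: "x \<in> V0" "y \<in> V'" "v = x + y" using sum by blast
  then have "\<exists>!w. w \<in> (\<Pi>\<^sub>E j\<in>{..<k}. W j) \<and> y = (\<Sum>j<k. w j)"
    using V'(1) by (auto simp: direct_sum_def)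
  then obtain w where w: "w \<in> (\<Pi>\<^sub>E j\<in>{..<k}. W j)" "y = (\<Sum>j<k. w j)"
    and uniq: "\<And>w'. w' \<in> (\<Pi>\<^sub>E j\<in>{..<k}. W j) \<Longrightarrow> y = (\<Sum>j<k. w' j) \<Longrightarrow> w' = w"
    by blast
  show "\<exists>!w. w \<in> (\<Pi>\<^sub>E j\<in>{..<Suc k}. ?W j) \<and> v = (\<Sum>j<Suc k. w j)"
  proof (rule ex1I[of _ "w(k := x)"], intro conjI)
    show "w(k := x) \<in> (\<Pi>\<^sub>E j\<in>{..<Suc k}. ?W j)"
      using w(1) xy(1) by (auto simp: PiE_iff extensional_def less_Suc_eq)
    have "(\<Sum>j<k. (w(k := x)) j) = y" unfolding w(2) by (intro sum.cong) auto
    then show "v = (\<Sum>j<Suc k. (w(k := x)) j)"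
      unfolding sum.lessThan_Suc xy(3) by (simp add: add.commute)
    fix u assume u: "u \<in> (\<Pi>\<^sub>E j\<in>{..<Suc k}. ?W j) \<and> v = (\<Sum>j<Suc k. u j)"
    define y' where "y' = (\<Sum>j<k. u j)"
    have uW: "u j \<in> W j" if "j < k" for j
      using u that by (auto simp: PiE_iff Ball_def less_Suc_eq split: if_splits)
    have uk: "u k \<in> V0" using PiE_mem[OF conjunct1[OF u], of k] by simp
    have y': "y' \<in> V'"
      unfolding y'_def using uW sW(2) by (intro cfun.subspace_sum[OF V'(2)]) auto
    have e: "x + y = u k + y'"
      using u unfolding sum.lessThan_Suc y'_def xy(3) by (simp add: add.commute)
    \<comment> \<open>the difference of two decompositions lies in both summands\<close>
    have "x - u k = y' - y" using e by (metis add_diff_cancel_left add_diff_cancel_right' add_diff_eq diff_add_cancel diff_diff_eq2)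
    moreover have "x - u k \<in> V0" using cfun.subspace_diff[OF V0(1) xy(1) uk] .
    moreover have "y' - y \<in> V'" using cfun.subspace_diff[OF V'(2) y' xy(2)] .
    ultimately have "x - u k \<in> V0 \<inter> V'" by simp
    then have x: "u k = x" using V0(3) by simp
    then have "y' = y" using e by simp
    moreover have "restrict u {..<k} \<in> (\<Pi>\<^sub>E j\<in>{..<k}. W j)" using uW by auto
    moreover have "(\<Sum>j<k. restrict u {..<k} j) = y'" unfolding y'_def by (intro sum.cong) auto
    ultimately have r: "restrict u {..<k} = w" using uniq by metis
    show "u = w(k := x)"
    proof
      fix j
      consider "j < k" | "j = k" | "k < j" by linarith
      then show "u j = (w(k := x)) j"
      proof cases
        case 1
        then show ?thesis using fun_cong[OF r, of j] by simp
      next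
        case 3
        then show ?thesis using u w(1) by (auto simp: PiE_iff extensional_def)
      qed (simp add: x)
    qed
  qed
qed

text \<open>
  The last property is the uniqueness of the decomposition. It reduces linearity and equivariance of
  the components to the same properties of an explicit family of vectors.
\<close>

lemma direct_sum_components:
  assumes "direct_sum V k W"
  obtains p where "\<And>j v. j < k \<Longrightarrow> v \<in> V \<Longrightarrow> p j v \<in> W j"
    "\<And>v. v \<in> V \<Longrightarrow> v = (\<Sum>j<k. p j v)"
    "\<And>v w j. v \<in> V \<Longrightarrow> (\<And>i. i < k \<Longrightarrow> w i \<in> W i) \<Longrightarrow> v = (\<Sum>j<k. w j) \<Longrightarrow> j < k \<Longrightarrow> p j v = w j"
proof -
  define q where "q = (\<lambda>v. THE w. w \<in> (\<Pi>\<^sub>E j\<in>{..<k}. W j) \<and> v = (\<Sum>j<k. w j))"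
  have ex: "\<exists>!w. w \<in> (\<Pi>\<^sub>E j\<in>{..<k}. W j) \<and> v = (\<Sum>j<k. w j)" if "v \<in> V" for v
    using assms that by (auto simp: direct_sum_def)
  have q: "q v \<in> (\<Pi>\<^sub>E j\<in>{..<k}. W j)" "v = (\<Sum>j<k. q v j)" if "v \<in> V" for v
    using theI'[OF ex[OF that]] by (auto simp: q_def)
  show ?thesis
  proof (rule that[of "\<lambda>j v. q v j"])
    show "q v j \<in> W j" if "j < k" "v \<in> V" for j v using q(1)[OF that(2)] that(1) by auto
    show "v = (\<Sum>j<k. q v j)" if "v \<in> V" for v using q(2)[OF that] .
    fix v w j assume v: "v \<in> V" and w: "\<And>i. i < k \<Longrightarrow> w i \<in> W i" "v = (\<Sum>j<k. w j)" and j: "j < k"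
    have "restrict w {..<k} \<in> (\<Pi>\<^sub>E j\<in>{..<k}. W j)" using w(1) by auto
    moreover have "v = (\<Sum>j<k. restrict w {..<k} j)" unfolding w(2) by (intro sum.cong) auto
    ultimately have "restrict w {..<k} = q v" using ex[OF v] q[OF v] by auto
    then show "q v j = w j" using j by (metis lessThan_iff restrict_apply')
  qed
qed

lemma decomposition_components:
  assumes M: "is_rep G M" and W: "irr_decomposition G M k W"
  obtains p where "\<And>j. j < k \<Longrightarrow> intertwiner G M (W j, snd M) (p j)"
    "\<And>v. v \<in> fst M \<Longrightarrow> v = (\<Sum>j<k. p j v)"
    "\<And>j i v. j < k \<Longrightarrow> i < k \<Longrightarrow> v \<in> W j \<Longrightarrow> p i v = (if i = j then v else 0)"
proof -
  note sub = rep_subspace[OF M]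
  have ds: "direct_sum (fst M) k W" and sm: "\<And>j. j < k \<Longrightarrow> submodule_of G M (W j)"
    using W by (auto simp: irr_decomposition_def)
  have sW: "cfun.subspace (W j)" "W j \<subseteq> fst M" if "j < k" for j
    using sm[OF that] by (auto simp: submodule_iff)
  obtain p where p: "\<And>j v. j < k \<Longrightarrow> v \<in> fst M \<Longrightarrow> p j v \<in> W j"
    "\<And>v. v \<in> fst M \<Longrightarrow> v = (\<Sum>j<k. p j v)"
    "\<And>v w j. v \<in> fst M \<Longrightarrow> (\<And>i. i < k \<Longrightarrow> w i \<in> W i) \<Longrightarrow> v = (\<Sum>j<k. w j) \<Longrightarrow> j < k \<Longrightarrow> p j v = w j"
    using direct_sum_components[OF ds] by metis
  show ?thesis
  proof (rule that[of p])
    fix j assume j: "j < k"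
    have "p j (x + y) = p j x + p j y" if xy: "x \<in> fst M" "y \<in> fst M" for x y
    proof (rule p(3)[of "x + y" "\<lambda>j. p j x + p j y"])
      show "x + y = (\<Sum>j<k. p j x + p j y)"
        unfolding sum.distrib using p(2)[OF xy(1)] p(2)[OF xy(2)] by metis
    qed (use xy j sub sW p(1) in \<open>auto intro: cfun.subspace_add\<close>)
    moreover have "p j (c *\<^sub>c x) = c *\<^sub>c p j x" if x: "x \<in> fst M" for c x
    proof (rule p(3)[of "c *\<^sub>c x" "\<lambda>j. c *\<^sub>c p j x"])
      show "c *\<^sub>c x = (\<Sum>j<k. c *\<^sub>c p j x)"
        unfolding cfun.scale_sum_right[symmetric] using p(2)[OF x] by metis
    qed (use x j sub sW p(1) in \<open>auto intro: cfun.subspace_scale\<close>)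
    moreover have "p j (snd M g x) = snd M g (p j x)" if g: "g \<in> carrier G" and x: "x \<in> fst M" for g x
    proof (rule p(3)[of "snd M g x" "\<lambda>j. snd M g (p j x)"])
      have "(\<Sum>j<k. snd M g (p j x)) = snd M g (\<Sum>j<k. p j x)"
        using p(1)[OF _ x] sW(2) by (intro linear_on_sum[OF rep_linear[OF M g] sub, symmetric]) blast
      then show "snd M g x = (\<Sum>j<k. snd M g (p j x))" using p(2)[OF x] by metis
      show "snd M g (p i x) \<in> W i" if "i < k" for i
        using sm[OF that] p(1)[OF that x] g by (simp add: submodule_iff)
    qed (use x g j rep_mem[OF M] in auto)
    ultimately show "intertwiner G M (W j, snd M) (p j)"
      using p(1)[OF j] by (simp add: intertwiner_def linear_on_def)
  next
    show "v = (\<Sum>j<k. p j v)" if "v \<in> fst M" for v using p(2)[OF that] .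
  next
    fix j i v assume j: "j < k" and i: "i < k" and v: "v \<in> W j"
    show "p i v = (if i = j then v else 0)"
    proof (rule p(3)[of v "\<lambda>i. if i = j then v else 0"])
      show "v = (\<Sum>i<k. if i = j then v else 0)" using j by simp
    qed (use i j v sW in \<open>auto intro: cfun.subspace_0\<close>)
  qed
qed

context finite_group
begin

text \<open>
  A nonzero submodule of least dimension is irreducible; the induction descends to it.
\<close>

lemma irreducible_submodule_exists:
  assumes "is_rep G M" "fst M \<noteq> {0}"
  shows "\<exists>U. submodule_of G M U \<and> irreducible_rep G (U, snd M)"
  using assms
proof (induction "cfun.dim (fst M)" arbitrary: M rule: less_induct)
  case less
  note M = less.prems(1)
  have top: "submodule_of G M (fst M)"
    using rep_subspace[OF M] rep_mem[OF M] by (simp add: submodule_iff)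
  show ?case
  proof (cases "irreducible_rep G M")
    case True
    then show ?thesis using top by (intro exI[of _ "fst M"]) simp
  next
    case False
    then obtain W where W: "submodule_of G M W" "W \<noteq> {0}" "W \<noteq> fst M"
      using less.prems by (auto simp: irreducible_rep_def)
    have r: "is_rep G (W, snd M)" by (rule submodule_is_rep[OF M W(1)])
    have "cfun.dim W < cfun.dim (fst M)"
      using W by (intro dim_proper_subspace rep_fin_dim[OF M] rep_subspace[OF M])
        (auto simp: submodule_iff)
    then obtain U where "submodule_of G (W, snd M) U" "irreducible_rep G (U, snd M)"
      using less.hyps[of "(W, snd M)"] r W(2) by auto
    then show ?thesis using submodule_trans[OF W(1)] by blast
  qed
qed

lemma decomposition_exists:
  assumes "is_rep G M" shows "\<exists>k W. irr_decomposition G M k W"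
  using assms
proof (induction "cfun.dim (fst M)" arbitrary: M rule: less_induct)
  case less
  note M = less.prems(1)
  show ?case
  proof (cases "fst M = {0}")
    case True
    then have "irr_decomposition G M 0 W" for W
      by (auto simp: irr_decomposition_def direct_sum_def)
    then show ?thesis by blast
  next
    case False
    then obtain U where U: "submodule_of G M U" "irreducible_rep G (U, snd M)"
      using irreducible_submodule_exists[OF M] by blast
    obtain U' where U': "submodule_of G M U'" "U \<inter> U' = {0}"
      "\<And>v. v \<in> fst M \<Longrightarrow> \<exists>w\<in>U. \<exists>w'\<in>U'. v = w + w'"
      using maschke[OF M U(1)] by blast
    have sub: "cfun.subspace U" "U \<subseteq> fst M" "cfun.subspace U'" "U' \<subseteq> fst M"
      using U(1) U'(1) by (auto simp: submodule_iff)
    have "U \<noteq> {0}" using U(2) by (simp add: irreducible_rep_def)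
    then have "U' \<noteq> fst M" using sub U'(2) by auto
    then have "cfun.dim U' < cfun.dim (fst M)"
      using sub by (intro dim_proper_subspace rep_fin_dim[OF M] rep_subspace[OF M]) auto
    then obtain k W where kW: "irr_decomposition G (U', snd M) k W"
      using less.hyps[of "(U', snd M)"] submodule_is_rep[OF M U'(1)] by auto
    have "direct_sum (fst M) (Suc k) (W(k := U))"
      using kW sub U'(2,3) by (intro direct_sum_snoc[of U']) (auto simp: irr_decomposition_def)
    then have "irr_decomposition G M (Suc k) (W(k := U))"
      using kW U submodule_trans[OF U'(1)] by (auto simp: irr_decomposition_def less_Suc_eq)
    then show ?thesis by blast
  qed
qed

text \<open>
  A representation must live on functions \<open>nat \<Rightarrow> complex\<close>, so the regular representation needs a
  numbering of the group.
\<close>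

definition carrier_index where "carrier_index = (SOME e. bij_betw e (carrier G) {..<card (carrier G)})"

lemma carrier_index_bij: "bij_betw carrier_index (carrier G) {..<card (carrier G)}"
proof -
  have "\<exists>e. bij_betw e (carrier G) {..<card (carrier G)}"
    using ex_bij_betw_finite_nat[OF finite_carrier] by (auto simp: atLeast0LessThan)
  then show ?thesis unfolding carrier_index_def by (rule someI_ex)
qed

definition carrier_element where "carrier_element = inv_into (carrier G) carrier_index"

lemma carrier_index_less: "h \<in> carrier G \<Longrightarrow> carrier_index h < card (carrier G)"
  using carrier_index_bij by (auto simp: bij_betw_def)

lemma carrier_element_carrier_index [simp]: "h \<in> carrier G \<Longrightarrow> carrier_element (carrier_index h) = h"
  unfolding carrier_element_def by (rule bij_betw_inv_into_left[OF carrier_index_bij])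

lemma carrier_element_closed: "i < card (carrier G) \<Longrightarrow> carrier_element i \<in> carrier G"
  unfolding carrier_element_def using bij_betw_inv_into[OF carrier_index_bij] by (auto simp: bij_betw_def)

text \<open>
  The left regular representation, on the functions supported on the numbers of group elements.
\<close>

definition regular :: "'g rep" where
  "regular = ({v. \<forall>i\<ge>card (carrier G). v i = 0},
     \<lambda>g v i. if i < card (carrier G) then v (carrier_index (inv g \<otimes> carrier_element i)) else 0)"

end

section \<open>Isomorphism classes and coordinates\<close>

lemma equiv_isomorphism:
  "equiv {M. irreducible_rep G M}
     {(M, N). irreducible_rep G M \<and> irreducible_rep G N \<and> (\<exists>\<phi>. rep_iso G M N \<phi>)}"
proof (rule equivI)
  show "refl_on {M. irreducible_rep G M}
     {(M, N). irreducible_rep G M \<and> irreducible_rep G N \<and> (\<exists>\<phi>. rep_iso G M N \<phi>)}"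
    using rep_iso_refl irreducible_is_rep by (fastforce simp: refl_on_def)
  show "sym {(M, N). irreducible_rep G M \<and> irreducible_rep G N \<and> (\<exists>\<phi>. rep_iso G M N \<phi>)}"
    using rep_iso_sym irreducible_is_rep by (fastforce simp: sym_def)
  show "trans {(M, N). irreducible_rep G M \<and> irreducible_rep G N \<and> (\<exists>\<phi>. rep_iso G M N \<phi>)}"
    using rep_iso_trans by (fastforce simp: trans_def)
qed auto

text \<open>
  The four ways in which a class is used: all its members are irreducible and isomorphic, it contains
  everything isomorphic to a member, and it is determined by any member.
\<close>

lemma
  assumes \<kappa>: "\<kappa> \<in> irr_classes G" and M: "M \<in> \<kappa>"
  shows irr_class_irreducible: "irreducible_rep G M"
    and irr_class_iso: "N \<in> \<kappa> \<Longrightarrow> \<exists>\<phi>. rep_iso G M N \<phi>"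
    and irr_class_closed: "irreducible_rep G N \<Longrightarrow> rep_iso G M N \<phi> \<Longrightarrow> N \<in> \<kappa>"
    and irr_class_unique: "\<kappa>' \<in> irr_classes G \<Longrightarrow> M \<in> \<kappa>' \<Longrightarrow> \<kappa>' = \<kappa>"
proof -
  note e = equiv_isomorphism[of G]
  note q = \<kappa>[unfolded irr_classes_def]
  show M': "irreducible_rep G M" using in_quotient_imp_subset[OF e q] M by auto
  show "\<exists>\<phi>. rep_iso G M N \<phi>" if "N \<in> \<kappa>"
    using quotient_eq_iff[OF e q q M that] by auto
  show "N \<in> \<kappa>" if "irreducible_rep G N" "rep_iso G M N \<phi>"
    using in_quotient_imp_closed[OF e q M, of N] M' that by auto
  show "\<kappa>' = \<kappa>" if "\<kappa>' \<in> irr_classes G" "M \<in> \<kappa>'"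
    using quotient_disj[OF e q that(1)[unfolded irr_classes_def]] M that(2) by auto
qed

lemma irr_class_nonempty: "\<kappa> \<in> irr_classes G \<Longrightarrow> \<exists>M. M \<in> \<kappa>"
  using in_quotient_imp_non_empty[OF equiv_isomorphism, of \<kappa> G]
  by (simp only: irr_classes_def ex_in_conv simp_thms not_False_eq_True)

definition irr_class_of :: "'g monoid \<Rightarrow> 'g rep \<Rightarrow> 'g rep set"
  where "irr_class_of G M = {N. irreducible_rep G M \<and> irreducible_rep G N \<and> (\<exists>\<phi>. rep_iso G M N \<phi>)}"

lemma
  assumes M: "irreducible_rep G M"
  shows irr_class_of_mem: "M \<in> irr_class_of G M"
    and irr_class_of_class: "irr_class_of G M \<in> irr_classes G"
proof -
  show "M \<in> irr_class_of G M"
    using M rep_iso_refl[OF irreducible_is_rep[OF M]] by (auto simp: irr_class_of_def)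
  have "{(M, N). irreducible_rep G M \<and> irreducible_rep G N \<and> (\<exists>\<phi>. rep_iso G M N \<phi>)} `` {M} \<in> irr_classes G"
    unfolding irr_classes_def using M by (intro quotientI) simp
  then show "irr_class_of G M \<in> irr_classes G" by (simp add: irr_class_of_def Image_singleton)
qed

definition linear_functional :: "('i \<Rightarrow> complex) set \<Rightarrow> (('i \<Rightarrow> complex) \<Rightarrow> complex) \<Rightarrow> bool"
  where "linear_functional V f \<longleftrightarrow>
    (\<forall>x\<in>V. \<forall>y\<in>V. f (x + y) = f x + f y) \<and> (\<forall>c. \<forall>x\<in>V. f (c *\<^sub>c x) = c * f x)"

lemma linear_functional_sum:
  assumes f: "linear_functional V f" and V: "cfun.subspace V" and x: "\<And>i. i \<in> I \<Longrightarrow> x i \<in> V"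
  shows "f (\<Sum>i\<in>I. c i *\<^sub>c x i) = (\<Sum>i\<in>I. c i * f (x i))"
proof -
  have z: "f 0 = 0"
    using f cfun.subspace_0[OF V] unfolding linear_functional_def by (metis cfun.scale_zero_left mult_zero_left)
  show ?thesis
    using x
  proof (induction I rule: infinite_finite_induct)
    case (insert i I)
    then have "c i *\<^sub>c x i \<in> V" "(\<Sum>i\<in>I. c i *\<^sub>c x i) \<in> V" "x i \<in> V"
      by (auto intro!: cfun.subspace_sum[OF V] cfun.subspace_scale[OF V])
    then have "f (c i *\<^sub>c x i + (\<Sum>i\<in>I. c i *\<^sub>c x i)) = c i * f (x i) + f (\<Sum>i\<in>I. c i *\<^sub>c x i)"
      using f by (simp add: linear_functional_def)
    moreover have "f (\<Sum>i\<in>I. c i *\<^sub>c x i) = (\<Sum>i\<in>I. c i * f (x i))"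
      using insert.prems by (intro insert.IH) blast
    ultimately show ?case by (simp only: sum.insert[OF insert(1,2)])
  qed (simp_all only: sum.infinite sum.empty z not_False_eq_True)
qed

lemma coordinates_exist:
  assumes "fin_dim V" "cfun.subspace V"
  obtains B f where "finite B" "B \<subseteq> V" "\<forall>b\<in>B. linear_functional V (f b)"
    "\<forall>v\<in>V. v = (\<Sum>b\<in>B. f b v *\<^sub>c b)" "\<forall>b\<in>B. f b b = 1"
proof -
  obtain B where B: "finite B" "cfun.independent B" "cfun.span B = V"
    using fin_dim_basis[OF assms(1,2)] by blast
  show ?thesis
  proof (rule that[of B "\<lambda>b v. cfun.representation B v b"])
    show "B \<subseteq> V" using B(3) cfun.span_superset by auto
    show "\<forall>b\<in>B. linear_functional V (\<lambda>v. cfun.representation B v b)"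
      using B(2,3) by (simp add: linear_functional_def cfun.representation_add cfun.representation_scale)
    show "\<forall>v\<in>V. v = (\<Sum>b\<in>B. cfun.representation B v b *\<^sub>c b)"
      using cfun.sum_representation_eq[OF B(2) _ B(1) order_refl] B(3) by simp
    show "\<forall>b\<in>B. cfun.representation B b b = 1"
      using cfun.representation_basis[OF B(2)] by simp
  qed (rule B(1))
qed

lemma group_algebra_subspace: "cfun.subspace (group_algebra G)"
  by (rule cfun.subspaceI) (auto simp: group_algebra_def)

lemma ga_mult_closed: "ga_mult G a b \<in> group_algebra G"
  by (simp add: group_algebra_def ga_mult_def)

section \<open>Faithfulness of the irreducible representations\<close>

context finite_group
begin

lemma regular_is_rep: "is_rep G regular"
proof -
  let ?N = "card (carrier G)"
  define V where "V = {v :: nat \<Rightarrow> complex. \<forall>i\<ge>?N. v i = 0}"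
  define \<delta> where "\<delta> = (\<lambda>i j :: nat. if j = i then 1 else (0::complex))"
  have sV: "cfun.subspace V" by (rule cfun.subspaceI) (auto simp: V_def)
  have "v \<in> cfun.span (\<delta> ` {..<?N})" if "v \<in> V" for v
  proof -
    have "v = (\<Sum>i<?N. v i *\<^sub>c \<delta> i)"
      using that by (auto simp: fun_eq_iff sum_fun_apply \<delta>_def V_def if_distrib cong: if_cong)
    also have "\<dots> \<in> cfun.span (\<delta> ` {..<?N})"
      by (intro cfun.span_sum cfun.span_scale cfun.span_base) auto
    finally show ?thesis .
  qed
  moreover have "cfun.span (\<delta> ` {..<?N}) \<subseteq> V"
    by (rule cfun.span_minimal[OF _ sV]) (auto simp: \<delta>_def V_def)
  ultimately have "cfun.span (\<delta> ` {..<?N}) = V" by auto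
  then have "fin_dim V" unfolding fin_dim_def by (intro exI[of _ "\<delta> ` {..<?N}"]) simp
  moreover have "linear_on V V (snd regular g)" for g
    by (auto simp: linear_on_def regular_def V_def fun_eq_iff)
  moreover have "snd regular \<one> v = v" if "v \<in> V" for v
  proof
    fix i
    have "carrier_index (carrier_element i) = i" if "i < ?N"
      unfolding carrier_element_def using that by (intro bij_betw_inv_into_right[OF carrier_index_bij]) simp
    then show "snd regular \<one> v i = v i"
      using that by (auto simp: regular_def V_def carrier_element_closed)
  qed
  moreover have "snd regular (g \<otimes> h) v = snd regular g (snd regular h v)"
    if "g \<in> carrier G" "h \<in> carrier G" for g h v
    using that by (auto simp: regular_def fun_eq_iff carrier_element_closed carrier_index_less inv_mult_group m_assoc)
  moreover have "fst regular = V" by (simp add: regular_def V_def)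
  ultimately show ?thesis using sV unfolding is_rep_iff by simp
qed

text \<open>
  Applied to the basis vector of the unit element, \<open>a\<close> returns its own coefficients.
\<close>

lemma regular_faithful:
  assumes a: "a \<in> group_algebra G" and zero: "\<And>v. v \<in> fst regular \<Longrightarrow> ga_act G regular a v = 0"
  shows "a = 0"
proof
  fix h
  show "a h = 0 h"
  proof (cases "h \<in> carrier G")
    case True
    define v where "v = (\<lambda>i. if i = carrier_index \<one> then 1 else (0::complex))"
    have v: "v \<in> fst regular" using carrier_index_less[of \<one>] by (auto simp: v_def regular_def)
    have "v (carrier_index (inv g \<otimes> h)) = (if g = h then 1 else 0)" if "g \<in> carrier G" for g
    proof -
      have "carrier_index (inv g \<otimes> h) = carrier_index \<one> \<longleftrightarrow> inv g \<otimes> h = \<one>"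
        using carrier_index_bij that True by (auto simp: bij_betw_def inj_on_eq_iff)
      also have "\<dots> \<longleftrightarrow> g = h"
        using that True by (metis inv_closed inv_equality inv_inv l_inv)
      finally show ?thesis by (simp add: v_def)
    qed
    then have "ga_act G regular a v (carrier_index h) = (\<Sum>g\<in>carrier G. a g * (if g = h then 1 else 0))"
      unfolding ga_act_def sum_fun_apply using carrier_index_less[OF True] True
      by (intro sum.cong refl) (simp add: regular_def)
    also have "\<dots> = a h" using finite_carrier True by (simp add: if_distrib cong: if_cong)
    finally show ?thesis using zero[OF v] by simp
  qed (use a in \<open>simp add: group_algebra_def\<close>)
qed

lemma regular_components_faithful:
  assumes W: "irr_decomposition G regular k W" and a: "a \<in> group_algebra G"
    and zero: "\<And>j v. j < k \<Longrightarrow> v \<in> W j \<Longrightarrow> ga_act G regular a v = 0"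
  shows "a = 0"
proof (rule regular_faithful[OF a])
  fix v assume v: "v \<in> fst regular"
  obtain p where p: "\<And>j. j < k \<Longrightarrow> intertwiner G regular (W j, snd regular) (p j)"
    "\<And>v. v \<in> fst regular \<Longrightarrow> v = (\<Sum>j<k. p j v)"
    using decomposition_components[OF regular_is_rep W] by metis
  have pW: "p j v \<in> W j" if "j < k" for j
    using linear_on_mem[OF intertwiner_linear[OF p(1)[OF that]] v] by simp
  have "ga_act G regular a v = ga_act G regular a (\<Sum>j<k. p j v)" using p(2)[OF v] by simp
  also have "\<dots> = (\<Sum>j<k. ga_act G regular a (p j v))"
    using pW W unfolding irr_decomposition_def submodule_iff
    by (intro linear_on_sum[OF ga_act_linear[OF regular_is_rep] rep_subspace[OF regular_is_rep]]) blast
  also have "\<dots> = 0" using zero pW by simp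
  finally show "ga_act G regular a v = 0" .
qed

text \<open>
  Every element of the group algebra is determined by its actions on irreducible modules, because
  the regular representation is a direct sum of such modules. Centrality of an element and its
  decomposition by classes are checked in this way.
\<close>

lemma irreducibles_faithful:
  assumes a: "a \<in> group_algebra G"
    and zero: "\<And>M v. irreducible_rep G M \<Longrightarrow> v \<in> fst M \<Longrightarrow> ga_act G M a v = 0"
  shows "a = 0"
proof -
  obtain k W where W: "irr_decomposition G regular k W"
    using decomposition_exists[OF regular_is_rep] by blast
  have "ga_act G regular a v = 0" if "j < k" "v \<in> W j" for j v
    using zero[of "(W j, snd regular)" v] that W by (simp add: irr_decomposition_def)
  then show ?thesis by (rule regular_components_faithful[OF W a])
qed

lemma irreducibles_faithful_eq:
  assumes "a \<in> group_algebra G" "b \<in> group_algebra G"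
    and eq: "\<And>M v. irreducible_rep G M \<Longrightarrow> v \<in> fst M \<Longrightarrow> ga_act G M a v = ga_act G M b v"
  shows "a = b"
proof -
  have "a - b = 0"
  proof (rule irreducibles_faithful)
    show "a - b \<in> group_algebra G" using assms(1,2) by (rule cfun.subspace_diff[OF group_algebra_subspace])
    fix M v assume M: "irreducible_rep G M" "v \<in> fst M"
    have "ga_act G M ((a - b) + b) v = ga_act G M (a - b) v + ga_act G M b v" by (rule ga_act_add)
    then show "ga_act G M (a - b) v = 0" using eq[OF M] by simp
  qed
  then show ?thesis by simp
qed

section \<open>Matrix coefficients and central projectors\<close>

text \<open>
  The element \<open>\<Sum>\<^sub>g f(g\<^sup>-\<^sup>1 u) g\<close> of the group algebra. Its action on \<open>x\<close> is, as a function of \<open>u\<close>, the average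
  of the rank one operator \<open>u \<mapsto> f(u) x\<close>, so Schur's lemma controls it.
\<close>

definition matrix_coefficient :: "'g rep \<Rightarrow> ((nat \<Rightarrow> complex) \<Rightarrow> complex) \<Rightarrow> (nat \<Rightarrow> complex) \<Rightarrow> 'g \<Rightarrow> complex"
  where "matrix_coefficient M f u = (\<lambda>g. if g \<in> carrier G then f (snd M (inv g) u) else 0)"

lemma matrix_coefficient_mem: "matrix_coefficient M f u \<in> group_algebra G"
  by (simp add: matrix_coefficient_def group_algebra_def)

lemma ga_act_matrix_coefficient:
  "ga_act G N (matrix_coefficient M f u) x = (\<Sum>g\<in>carrier G. f (snd M (inv g) u) *\<^sub>c snd N g x)"
  unfolding ga_act_def by (intro sum.cong refl) (simp add: matrix_coefficient_def)

lemma matrix_coefficient_intertwiner: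
  assumes M: "is_rep G M" and N: "is_rep G N" and f: "linear_functional (fst M) f" and x: "x \<in> fst N"
  shows "intertwiner G M N (\<lambda>u. ga_act G N (matrix_coefficient M f u) x)"
proof -
  have "linear_on (fst M) (fst N) (\<lambda>u. f u *\<^sub>c x)"
    using f x cfun.subspace_scale[OF rep_subspace[OF N]]
    by (auto simp: linear_on_def linear_functional_def cfun.scale_left_distrib)
  from average_intertwiner[OF M N this]
  have "intertwiner G M N (\<lambda>u. \<Sum>g\<in>carrier G. snd N g (f (snd M (inv g) u) *\<^sub>c x))" .
  also have "(\<lambda>u. \<Sum>g\<in>carrier G. snd N g (f (snd M (inv g) u) *\<^sub>c x)) =
      (\<lambda>u. ga_act G N (matrix_coefficient M f u) x)"
    unfolding ga_act_matrix_coefficient by (intro ext sum.cong refl) (simp add: linear_on_scale[OF rep_linear[OF N] x])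
  finally show ?thesis .
qed

lemma matrix_coefficient_zero:
  assumes M: "irreducible_rep G M" and N: "irreducible_rep G N" and "\<nexists>\<phi>. rep_iso G M N \<phi>"
    and f: "linear_functional (fst M) f" and u: "u \<in> fst M" and x: "x \<in> fst N"
  shows "ga_act G N (matrix_coefficient M f u) x = 0"
  using schur_zero_or_iso[OF M N matrix_coefficient_intertwiner[OF irreducible_is_rep[OF M] irreducible_is_rep[OF N] f x]]
    assms(3) u by blast

text \<open>
  By Schur's lemma the element of \<open>f\<close> and \<open>u\<close> maps \<open>x\<close> to \<open>c f x\<close> times \<open>u\<close>. Pairing with a second
  functional \<open>f'\<close> and replacing \<open>g\<close> by its inverse in the sum exchanges \<open>(f, u)\<close> with \<open>(f', x)\<close>, whence
  \<open>c f x * f' u = c f' u * f x\<close>. Thus \<open>c f x\<close> is a constant multiple \<open>\<kappa> * f x\<close>. The constant is \<open>|G| / dim M\<close>,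
  and that it is not zero follows from faithfulness.
\<close>

lemma matrix_coefficient_rank_one:
  assumes M: "irreducible_rep G M"
  obtains \<kappa> where "\<kappa> \<noteq> 0"
    "\<forall>f u x. linear_functional (fst M) f \<longrightarrow> u \<in> fst M \<longrightarrow> x \<in> fst M \<longrightarrow>
       ga_act G M (matrix_coefficient M f u) x = (\<kappa> * f x) *\<^sub>c u"
proof -
  note rM = irreducible_is_rep[OF M]
  note sub = rep_subspace[OF rM]
  let ?V = "fst M"
  have "\<exists>c. \<forall>u\<in>?V. ga_act G M (matrix_coefficient M f u) x = c *\<^sub>c u"
    if "linear_functional ?V f" "x \<in> ?V" for f x
    using schur_scalar[OF M matrix_coefficient_intertwiner[OF rM rM that]] by metis
  then obtain c where c: "\<And>f x u. linear_functional ?V f \<Longrightarrow> x \<in> ?V \<Longrightarrow> u \<in> ?V \<Longrightarrow>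
      ga_act G M (matrix_coefficient M f u) x = c f x *\<^sub>c u"
    by metis
  have apply_f: "f' (ga_act G M (matrix_coefficient M f u) x) =
      (\<Sum>g\<in>carrier G. f (snd M (inv g) u) * f' (snd M g x))"
    if "linear_functional ?V f'" "x \<in> ?V" for f f' x u
    unfolding ga_act_matrix_coefficient by (rule linear_functional_sum[OF that(1) sub]) (rule rep_mem[OF rM _ that(2)])
  have symm: "c f x * f' u = c f' u * f x"
    if f: "linear_functional ?V f" "linear_functional ?V f'" and x: "x \<in> ?V" "u \<in> ?V" for f f' x u
  proof -
    have "c f x * f' u = f' (ga_act G M (matrix_coefficient M f u) x)"
      using c[OF f(1) x] f(2) x(2) by (simp add: linear_functional_def)
    also have "\<dots> = (\<Sum>g\<in>carrier G. f (snd M (inv g) u) * f' (snd M g x))"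
      by (rule apply_f[OF f(2) x(1)])
    also have "\<dots> = (\<Sum>g\<in>carrier G. f (snd M (inv (inv g)) u) * f' (snd M (inv g) x))"
      by (rule sum.reindex_bij_witness[of _ "\<lambda>g. inv g" "\<lambda>g. inv g"]) auto
    also have "\<dots> = (\<Sum>g\<in>carrier G. f' (snd M (inv g) x) * f (snd M g u))"
      by (intro sum.cong refl) simp
    also have "\<dots> = f (ga_act G M (matrix_coefficient M f' x) u)"
      by (rule apply_f[OF f(1) x(2), symmetric])
    also have "\<dots> = c f' u * f x"
      using c[OF f(2) x(2,1)] f(1) x(1) by (simp add: linear_functional_def)
    finally show ?thesis .
  qed
  obtain B f where B': "finite B" "B \<subseteq> ?V" "\<forall>b\<in>B. linear_functional ?V (f b)"
    "\<forall>v\<in>?V. v = (\<Sum>b\<in>B. f b v *\<^sub>c b)" "\<forall>b\<in>B. f b b = 1"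
    by (rule coordinates_exist[OF rep_fin_dim[OF rM] sub])
  note B = B'(1,2) bspec[OF B'(3)] bspec[OF B'(4)] bspec[OF B'(5)]
  have "B \<noteq> {}"
  proof
    assume "B = {}"
    then have "v = 0" if "v \<in> ?V" for v using B(4)[OF that] by simp
    then have "?V = {0}" using cfun.subspace_0[OF sub] by blast
    with M show False by (simp add: irreducible_rep_def)
  qed
  then obtain b where b: "b \<in> B" by blast
  then have bV: "b \<in> ?V" using B(2) by auto
  define \<kappa> where "\<kappa> = c (f b) b"
  have ck: "c g x = \<kappa> * g x" if "linear_functional ?V g" "x \<in> ?V" for g x
    using symm[OF that(1) B(3)[OF b] that(2) bV] B(5)[OF b] by (simp add: \<kappa>_def)
  have rank1: "ga_act G M (matrix_coefficient M g u) x = (\<kappa> * g x) *\<^sub>c u"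
    if "linear_functional ?V g" "u \<in> ?V" "x \<in> ?V" for g u x
    using c[OF that(1,3,2)] ck[OF that(1,3)] by simp
  \<comment> \<open>If \<open>\<kappa>\<close> were zero, the matrix coefficient of \<open>f b\<close> and \<open>b\<close> would act as zero on every irreducible
    module; but its value at the unit element is \<open>f b b = 1\<close>.\<close>
  have "\<kappa> \<noteq> 0"
  proof
    assume \<kappa>: "\<kappa> = 0"
    let ?a = "matrix_coefficient M (f b) b"
    have "?a = 0"
    proof (rule irreducibles_faithful[OF matrix_coefficient_mem])
      fix N y assume N: "irreducible_rep G N" and y: "y \<in> fst N"
      show "ga_act G N ?a y = 0"
      proof (cases "\<exists>\<phi>. rep_iso G M N \<phi>")
        case False
        then show ?thesis using matrix_coefficient_zero[OF M N _ B(3)[OF b] bV y] by blast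
      next
        case True
        then obtain \<phi> where \<phi>: "intertwiner G M N \<phi>" "bij_betw \<phi> ?V (fst N)"
          by (auto simp: rep_iso_iff)
        then obtain v where v: "v \<in> ?V" "y = \<phi> v" using y by (auto simp: bij_betw_def)
        have "ga_act G N ?a y = \<phi> (ga_act G M ?a v)"
          using intertwiner_ga_act[OF rM \<phi>(1) v(1)] v(2) by simp
        also have "ga_act G M ?a v = 0" using rank1[OF B(3)[OF b] bV v(1)] \<kappa> by simp
        also have "\<phi> 0 = 0" by (rule linear_on_zero[OF intertwiner_linear[OF \<phi>(1)] sub])
        finally show ?thesis .
      qed
    qed
    then have "?a \<one> = 0" by simp
    moreover have "?a \<one> = 1" using B(5)[OF b] rep_one[OF rM bV] by (simp add: matrix_coefficient_def)
    ultimately show False by simp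
  qed
  moreover have "\<forall>f u x. linear_functional (fst M) f \<longrightarrow> u \<in> fst M \<longrightarrow> x \<in> fst M \<longrightarrow>
       ga_act G M (matrix_coefficient M f u) x = (\<kappa> * f x) *\<^sub>c u"
    using rank1 by blast
  ultimately show ?thesis by (rule that)
qed

text \<open>
  Every operator on an irreducible module is a sum of rank one operators, each of which comes from a
  matrix coefficient. The resulting element annihilates all other irreducible modules, so operators
  on finitely many pairwise non-isomorphic irreducible modules can be prescribed simultaneously.
\<close>

lemma operator_realised:
  assumes M: "irreducible_rep G M" and T: "linear_on (fst M) (fst M) T"
  obtains a where "a \<in> group_algebra G" "\<And>v. v \<in> fst M \<Longrightarrow> ga_act G M a v = T v"
    "\<And>N v. irreducible_rep G N \<Longrightarrow> \<nexists>\<phi>. rep_iso G M N \<phi> \<Longrightarrow> v \<in> fst N \<Longrightarrow> ga_act G N a v = 0"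
proof -
  note rM = irreducible_is_rep[OF M]
  note sub = rep_subspace[OF rM]
  let ?V = "fst M"
  obtain \<kappa> where \<kappa>': "\<kappa> \<noteq> 0" "\<forall>f u x. linear_functional ?V f \<longrightarrow> u \<in> ?V \<longrightarrow> x \<in> ?V \<longrightarrow>
       ga_act G M (matrix_coefficient M f u) x = (\<kappa> * f x) *\<^sub>c u"
    by (rule matrix_coefficient_rank_one[OF M])
  note \<kappa> = \<kappa>'(1) \<kappa>'(2)[rule_format]
  obtain B f where B': "finite B" "B \<subseteq> ?V" "\<forall>b\<in>B. linear_functional ?V (f b)"
    "\<forall>v\<in>?V. v = (\<Sum>b\<in>B. f b v *\<^sub>c b)" "\<forall>b\<in>B. f b b = 1"
    by (rule coordinates_exist[OF rep_fin_dim[OF rM] sub])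
  note B = B'(1,2) bspec[OF B'(3)] bspec[OF B'(4)] bspec[OF B'(5)]
  have TV: "T b \<in> ?V" if "b \<in> B" for b using linear_on_mem[OF T] B(2) that by auto
  define a where "a = (\<Sum>b\<in>B. (1 / \<kappa>) *\<^sub>c matrix_coefficient M (f b) (T b))"
  show ?thesis
  proof (rule that[of a])
    show "a \<in> group_algebra G"
      unfolding a_def
      by (intro cfun.subspace_sum cfun.subspace_scale group_algebra_subspace matrix_coefficient_mem)
    fix v assume v: "v \<in> ?V"
    have "ga_act G M a v = (\<Sum>b\<in>B. f b v *\<^sub>c T b)"
      unfolding a_def ga_act_sum ga_act_scale
      by (intro sum.cong refl) (simp add: \<kappa>(2)[OF B(3) TV v] \<kappa>(1))
    also have "\<dots> = (\<Sum>b\<in>B. T (f b v *\<^sub>c b))"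
      using B(2) by (intro sum.cong refl linear_on_scale[OF T, symmetric]) auto
    also have "\<dots> = T (\<Sum>b\<in>B. f b v *\<^sub>c b)"
      using B(2) by (intro linear_on_sum[OF T sub, symmetric] cfun.subspace_scale[OF sub]) auto
    also have "\<dots> = T v" using B(4)[OF v] by simp
    finally show "ga_act G M a v = T v" .
  next
    fix N v assume N: "irreducible_rep G N" "\<nexists>\<phi>. rep_iso G M N \<phi>" "v \<in> fst N"
    show "ga_act G N a v = 0"
      unfolding a_def ga_act_sum ga_act_scale
      by (intro sum.neutral ballI) (simp add: matrix_coefficient_zero[OF M N(1,2) B(3) TV N(3)])
  qed
qed

text \<open>
  Each irreducible module occurs in the regular representation: otherwise an element that acts on it
  as the identity and on all other irreducible modules as zero would vanish on the regular
  representation.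
\<close>

lemma irr_classes_finite: "finite (irr_classes G)"
proof -
  obtain k W where W: "irr_decomposition G regular k W"
    using decomposition_exists[OF regular_is_rep] by blast
  have "\<exists>j<k. \<exists>\<phi>. rep_iso G M (W j, snd regular) \<phi>" if M: "irreducible_rep G M" for M
  proof (rule ccontr)
    assume none: "\<not> ?thesis"
    have "linear_on (fst M) (fst M) (\<lambda>v. v)" by (simp add: linear_on_def)
    then obtain a where a: "a \<in> group_algebra G" "\<And>v. v \<in> fst M \<Longrightarrow> ga_act G M a v = v"
      "\<And>N v. irreducible_rep G N \<Longrightarrow> \<nexists>\<phi>. rep_iso G M N \<phi> \<Longrightarrow> v \<in> fst N \<Longrightarrow> ga_act G N a v = 0"
      using operator_realised[OF M] by metis
    have "ga_act G regular a v = 0" if "j < k" "v \<in> W j" for j v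
      using a(3)[of "(W j, snd regular)" v] none that W by (auto simp: irr_decomposition_def)
    then have "a = 0" by (rule regular_components_faithful[OF W a(1)])
    then have "v = 0" if "v \<in> fst M" for v using a(2)[OF that] by (simp add: ga_act_zero)
    then have "fst M = {0}" using cfun.subspace_0[OF rep_subspace[OF irreducible_is_rep[OF M]]] by blast
    with M show False by (simp add: irreducible_rep_def)
  qed
  then have "irr_classes G \<subseteq> (\<lambda>j. irr_class_of G (W j, snd regular)) ` {..<k}"
  proof (intro subsetI)
    fix \<kappa> assume \<kappa>: "\<kappa> \<in> irr_classes G"
    then obtain M where M: "M \<in> \<kappa>" using irr_class_nonempty by blast
    note iM = irr_class_irreducible[OF \<kappa> M]
    assume "\<And>M. irreducible_rep G M \<Longrightarrow> \<exists>j<k. \<exists>\<phi>. rep_iso G M (W j, snd regular) \<phi>"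
    then obtain j \<phi> where j: "j < k" "rep_iso G M (W j, snd regular) \<phi>" using iM by blast
    have i: "irreducible_rep G (W j, snd regular)" using W j(1) by (simp add: irr_decomposition_def)
    have "(W j, snd regular) \<in> \<kappa>" by (rule irr_class_closed[OF \<kappa> M i j(2)])
    then have "\<kappa> = irr_class_of G (W j, snd regular)"
      using irr_class_unique[OF irr_class_of_class[OF i] irr_class_of_mem[OF i] \<kappa>] by simp
    then show "\<kappa> \<in> (\<lambda>j. irr_class_of G (W j, snd regular)) ` {..<k}" using j(1) by auto
  qed
  then show ?thesis by (rule finite_subset) simp
qed

lemma ga_act_transfer:
  assumes \<kappa>: "\<kappa> \<in> irr_classes G" "M \<in> \<kappa>" "N \<in> \<kappa>"
    and eq: "\<And>v. v \<in> fst M \<Longrightarrow> ga_act G M a v = ga_act G M b v" and w: "w \<in> fst N"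
  shows "ga_act G N a w = ga_act G N b w"
proof -
  obtain \<phi> where \<phi>: "intertwiner G M N \<phi>" "bij_betw \<phi> (fst M) (fst N)"
    using irr_class_iso[OF \<kappa>] by (auto simp: rep_iso_iff)
  obtain v where v: "v \<in> fst M" "w = \<phi> v" using w \<phi>(2) by (auto simp: bij_betw_def)
  show ?thesis
    using intertwiner_ga_act[OF irreducible_is_rep[OF irr_class_irreducible[OF \<kappa>(1,2)]] \<phi>(1) v(1)]
      eq[OF v(1)] v(2) by metis
qed

text \<open>
  The element that acts as the identity on one class and as zero on the others commutes with
  everything in each irreducible module, hence is central.
\<close>

lemma isotypic_projector_exists:
  assumes \<kappa>: "\<kappa> \<in> irr_classes G"
  shows "\<exists>p. p \<in> ga_center G \<and> (\<forall>M\<in>\<kappa>. \<forall>v\<in>fst M. ga_act G M p v = v) \<and>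
    (\<forall>M. irreducible_rep G M \<longrightarrow> M \<notin> \<kappa> \<longrightarrow> (\<forall>v\<in>fst M. ga_act G M p v = 0))"
proof -
  obtain M where M: "M \<in> \<kappa>" using irr_class_nonempty[OF \<kappa>] by blast
  note iM = irr_class_irreducible[OF \<kappa> M]
  have "linear_on (fst M) (fst M) (\<lambda>v. v)" by (simp add: linear_on_def)
  then obtain p where p: "p \<in> group_algebra G" "\<And>v. v \<in> fst M \<Longrightarrow> ga_act G M p v = v"
    "\<And>N v. irreducible_rep G N \<Longrightarrow> \<nexists>\<phi>. rep_iso G M N \<phi> \<Longrightarrow> v \<in> fst N \<Longrightarrow> ga_act G N p v = 0"
    using operator_realised[OF iM] by metis
  have on: "ga_act G N p v = v" if N: "N \<in> \<kappa>" "v \<in> fst N" for N v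
  proof -
    have "ga_act G N p v = ga_act G N (ga_one G) v"
      by (rule ga_act_transfer[OF \<kappa> M N(1) _ N(2)])
        (simp add: p(2) ga_act_one[OF irreducible_is_rep[OF iM]])
    then show ?thesis
      using ga_act_one[OF irreducible_is_rep[OF irr_class_irreducible[OF \<kappa> N(1)]] N(2)] by simp
  qed
  have off: "ga_act G N p v = 0" if N: "irreducible_rep G N" "N \<notin> \<kappa>" "v \<in> fst N" for N v
    using p(3)[OF N(1) _ N(3)] irr_class_closed[OF \<kappa> M N(1)] N(2) by blast
  have "ga_mult G p b = ga_mult G b p" for b
  proof (rule irreducibles_faithful_eq[OF ga_mult_closed ga_mult_closed])
    fix N v assume N: "irreducible_rep G N" and v: "v \<in> fst N"
    note rN = irreducible_is_rep[OF N]
    have lin: "linear_on (fst N) (fst N) (ga_act G N b)" by (rule ga_act_linear[OF rN])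
    show "ga_act G N (ga_mult G p b) v = ga_act G N (ga_mult G b p) v"
      using on[of N] off[OF N] linear_on_mem[OF lin v] linear_on_zero[OF lin rep_subspace[OF rN]] v
      by (cases "N \<in> \<kappa>") (simp_all add: ga_act_mult[OF rN v])
  qed
  then have "p \<in> ga_center G" using p(1) by (simp add: ga_center_def)
  with on off show ?thesis by blast
qed

text \<open>
  An element may be assembled class by class: \<open>b \<kappa>\<close> need only imitate \<open>a\<close> on the modules of class \<open>\<kappa>\<close>,
  since the central element \<open>p \<kappa>\<close> removes its action on all other modules.
\<close>

lemma sum_over_isotypic_projectors:
  assumes a: "a \<in> group_algebra G"
    and b: "\<And>\<kappa>. \<kappa> \<in> irr_classes G \<Longrightarrow> \<exists>M\<in>\<kappa>. \<forall>v\<in>fst M. ga_act G M (b \<kappa>) v = ga_act G M a v"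
  obtains p where "\<And>\<kappa>. \<kappa> \<in> irr_classes G \<Longrightarrow> p \<kappa> \<in> ga_center G"
    "a = (\<Sum>\<kappa>\<in>irr_classes G. ga_mult G (b \<kappa>) (p \<kappa>))"
proof -
  have "\<forall>\<kappa>\<in>irr_classes G. \<exists>p. p \<in> ga_center G \<and> (\<forall>M\<in>\<kappa>. \<forall>v\<in>fst M. ga_act G M p v = v) \<and>
      (\<forall>M. irreducible_rep G M \<longrightarrow> M \<notin> \<kappa> \<longrightarrow> (\<forall>v\<in>fst M. ga_act G M p v = 0))"
    using isotypic_projector_exists by (rule ballI)
  from bchoice[OF this] obtain p where p': "\<forall>\<kappa>\<in>irr_classes G. p \<kappa> \<in> ga_center G \<and>
      (\<forall>M\<in>\<kappa>. \<forall>v\<in>fst M. ga_act G M (p \<kappa>) v = v) \<and>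
      (\<forall>M. irreducible_rep G M \<longrightarrow> M \<notin> \<kappa> \<longrightarrow> (\<forall>v\<in>fst M. ga_act G M (p \<kappa>) v = 0))" ..
  have p: "p \<kappa> \<in> ga_center G" "M \<in> \<kappa> \<Longrightarrow> v \<in> fst M \<Longrightarrow> ga_act G M (p \<kappa>) v = v"
    "irreducible_rep G M \<Longrightarrow> M \<notin> \<kappa> \<Longrightarrow> v \<in> fst M \<Longrightarrow> ga_act G M (p \<kappa>) v = 0"
    if "\<kappa> \<in> irr_classes G" for \<kappa> M v
    using p' that by blast+
  have "a = (\<Sum>\<kappa>\<in>irr_classes G. ga_mult G (b \<kappa>) (p \<kappa>))"
  proof (rule irreducibles_faithful_eq[OF a])
    show "(\<Sum>\<kappa>\<in>irr_classes G. ga_mult G (b \<kappa>) (p \<kappa>)) \<in> group_algebra G"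
      by (intro cfun.subspace_sum group_algebra_subspace ga_mult_closed)
    fix N v assume N: "irreducible_rep G N" and v: "v \<in> fst N"
    note rN = irreducible_is_rep[OF N]
    let ?\<kappa> = "irr_class_of G N"
    note \<kappa> = irr_class_of_class[OF N] and N\<kappa> = irr_class_of_mem[OF N]
    have "ga_act G N (ga_mult G (b \<kappa>') (p \<kappa>')) v = (if \<kappa>' = ?\<kappa> then ga_act G N a v else 0)"
      if \<kappa>': "\<kappa>' \<in> irr_classes G" for \<kappa>'
    proof (cases "\<kappa>' = ?\<kappa>")
      case True
      obtain M where "M \<in> ?\<kappa>" "\<forall>v\<in>fst M. ga_act G M (b ?\<kappa>) v = ga_act G M a v"
        using b[OF \<kappa>] by blast
      then have "ga_act G N (b ?\<kappa>) v = ga_act G N a v"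
        using ga_act_transfer[OF \<kappa> _ N\<kappa> _ v] by blast
      then show ?thesis using True p(2)[OF \<kappa> N\<kappa> v] by (simp add: ga_act_mult[OF rN v])
    next
      case False
      then have "N \<notin> \<kappa>'" using irr_class_unique[OF \<kappa> N\<kappa> \<kappa>'] by blast
      then have "ga_act G N (p \<kappa>') v = 0" by (rule p(3)[OF \<kappa>' N _ v])
      then show ?thesis
        using False linear_on_zero[OF ga_act_linear[OF rN] rep_subspace[OF rN]]
        by (simp add: ga_act_mult[OF rN v])
    qed
    then have "(\<Sum>\<kappa>'\<in>irr_classes G. ga_act G N (ga_mult G (b \<kappa>') (p \<kappa>')) v) =
        (\<Sum>\<kappa>'\<in>irr_classes G. if \<kappa>' = ?\<kappa> then ga_act G N a v else 0)"
      by (rule sum.cong[OF refl])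
    also have "\<dots> = ga_act G N a v" using irr_classes_finite \<kappa> by (simp add: sum.delta')
    finally show "ga_act G N a v = ga_act G N (\<Sum>\<kappa>\<in>irr_classes G. ga_mult G (b \<kappa>) (p \<kappa>)) v"
      unfolding ga_act_sum by simp
  qed
  with p(1) show ?thesis using that by blast
qed

end

section \<open>Multiplicity-free restriction\<close>

lemma intertwiner_restrict:
  "intertwiner G M N \<phi> \<Longrightarrow> U \<subseteq> fst M \<Longrightarrow> intertwiner G (U, snd M) N \<phi>"
  using linear_on_mem by (fastforce simp: intertwiner_def intro: linear_on_subset)

context finite_group
begin

text \<open>
  The projections of \<open>U\<close> to constituents outside \<open>\<mu>\<close> vanish by Schur's lemma, so \<open>U\<close> lies in the sum of the
  constituents in \<open>\<mu>\<close>, which is a single one.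
\<close>

lemma submodule_of_class:
  assumes M: "is_rep G M" and W: "irr_decomposition G M k W" and \<mu>: "\<mu> \<in> irr_classes G"
    and le1: "card {j. j < k \<and> (W j, snd M) \<in> \<mu>} \<in> {0, 1}"
    and U: "submodule_of G M U" "(U, snd M) \<in> \<mu>"
  obtains j where "{j. j < k \<and> (W j, snd M) \<in> \<mu>} = {j}" "U = W j"
proof -
  define S where "S = {j. j < k \<and> (W j, snd M) \<in> \<mu>}"
  have iU: "irreducible_rep G (U, snd M)" by (rule irr_class_irreducible[OF \<mu> U(2)])
  have subU: "cfun.subspace U" "U \<subseteq> fst M" using U(1) by (auto simp: submodule_iff)
  have U0: "U \<noteq> {0}" using iU by (simp add: irreducible_rep_def)
  have iW: "irreducible_rep G (W j, snd M)" if "j < k" for j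
    using W that by (simp add: irr_decomposition_def)
  obtain p where p: "\<And>j. j < k \<Longrightarrow> intertwiner G M (W j, snd M) (p j)"
    "\<And>v. v \<in> fst M \<Longrightarrow> v = (\<Sum>j<k. p j v)"
    using decomposition_components[OF M W] by metis
  have off: "p j u = 0" if j: "j < k" "j \<notin> S" and u: "u \<in> U" for j u
  proof -
    have "(\<nexists>\<phi>. rep_iso G (U, snd M) (W j, snd M) \<phi>)"
      using irr_class_closed[OF \<mu> U(2) iW[OF j(1)]] j by (auto simp: S_def)
    then show ?thesis
      using schur_zero_or_iso[OF iU iW[OF j(1)] intertwiner_restrict[OF p(1)[OF j(1)] subU(2)]] u
      by auto
  qed
  have on: "u = (\<Sum>j\<in>S. p j u)" if u: "u \<in> U" for u
  proof -
    have "u = (\<Sum>j<k. p j u)" using p(2) u subU(2) by auto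
    also have "\<dots> = (\<Sum>j\<in>S. p j u)"
      by (rule sum.mono_neutral_right) (use off[OF _ _ u] in \<open>auto simp: S_def\<close>)
    finally show ?thesis .
  qed
  have "S \<noteq> {}"
  proof
    assume "S = {}"
    then have "u = 0" if "u \<in> U" for u using on[OF that] by simp
    then show False using U0 cfun.subspace_0[OF subU(1)] by blast
  qed
  moreover have "finite S" by (simp add: S_def)
  ultimately have "card S = 1" using le1 by (auto simp: S_def)
  then obtain j where j: "S = {j}" by (auto simp: card_1_singleton_iff)
  then have jk: "j < k" by (auto simp: S_def)
  have "U \<subseteq> W j"
  proof
    fix u assume u: "u \<in> U"
    have "u = p j u" using on[OF u] j by simp
    moreover have "p j u \<in> W j"
      using linear_on_mem[OF intertwiner_linear[OF p(1)[OF jk]], of u] u subU(2) by auto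
    ultimately show "u \<in> W j" by simp
  qed
  then have "submodule_of G (W j, snd M) U" using U(1) by (auto simp: submodule_iff)
  then have "U = W j" using iW[OF jk] U0 by (auto simp: irreducible_rep_def)
  with j show ?thesis using that by (simp add: S_def)
qed

text \<open>
  The number is defined by a choice of decomposition, so a bound on it is used through one
  decomposition that realises it.
\<close>

lemma multiplicity_realised:
  assumes "is_rep G M"
  shows "\<exists>k W. irr_decomposition G M k W \<and>
    multiplicity_in G \<mu> M = card {j. j < k \<and> (W j, snd M) \<in> \<mu>}"
  unfolding multiplicity_in_def
  by (rule someI_ex[of "\<lambda>m. \<exists>k W. irr_decomposition G M k W \<and> m = card {j. j < k \<and> (W j, snd M) \<in> \<mu>}"])
    (use decomposition_exists[OF assms] in blast)

text \<open>
  The two uses of multiplicity at most one: a constituent that occurs has multiplicity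
  exactly one, and as a subspace it is determined by its class.
\<close>

lemma
  assumes M: "is_rep G M" and \<mu>: "\<mu> \<in> irr_classes G" and le1: "multiplicity_in G \<mu> M \<in> {0, 1}"
    and U: "submodule_of G M U" "(U, snd M) \<in> \<mu>"
  shows multiplicity_one_of_submodule: "multiplicity_in G \<mu> M = 1"
    and multiplicity_free_unique: "submodule_of G M U' \<Longrightarrow> (U', snd M) \<in> \<mu> \<Longrightarrow> U' = U"
proof -
  obtain k W where W: "irr_decomposition G M k W"
    "multiplicity_in G \<mu> M = card {j. j < k \<and> (W j, snd M) \<in> \<mu>}"
    using multiplicity_realised[OF M] by blast
  note le1' = le1[unfolded W(2)]
  obtain j where j: "{j. j < k \<and> (W j, snd M) \<in> \<mu>} = {j}" "U = W j"
    by (rule submodule_of_class[OF M W(1) \<mu> le1' U])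
  then show "multiplicity_in G \<mu> M = 1" using W(2) by simp
  assume U': "submodule_of G M U'" "(U', snd M) \<in> \<mu>"
  obtain j' where "{j. j < k \<and> (W j, snd M) \<in> \<mu>} = {j'}" "U' = W j'"
    by (rule submodule_of_class[OF M W(1) \<mu> le1' U'])
  with j show "U' = U" by simp
qed

text \<open>
  Commuting with the group elements makes the action of \<open>z\<close> an intertwiner.
\<close>

lemma center_scalar:
  assumes z: "z \<in> ga_center G" and M: "irreducible_rep G M"
  obtains c where "\<And>v. v \<in> fst M \<Longrightarrow> ga_act G M z v = c *\<^sub>c v"
proof -
  note rM = irreducible_is_rep[OF M]
  have "ga_act G M z (snd M g v) = snd M g (ga_act G M z v)" if g: "g \<in> carrier G" and v: "v \<in> fst M" for g v
  proof -
    \<comment> \<open>the group element \<open>g\<close>, as an element of the group algebra\<close>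
    define d where "d = (\<lambda>x. if x = g then 1 else (0::complex))"
    have d: "ga_act G M d w = snd M g w" for w
    proof -
      have "ga_act G M d w = (\<Sum>x\<in>carrier G. if x = g then snd M x w else 0)"
        unfolding ga_act_def by (intro sum.cong refl) (simp add: d_def)
      then show ?thesis using finite_carrier g by simp
    qed
    have "d \<in> group_algebra G" using g by (simp add: d_def group_algebra_def)
    then have "ga_mult G z d = ga_mult G d z" using z by (simp add: ga_center_def)
    then have "ga_act G M z (ga_act G M d v) = ga_act G M d (ga_act G M z v)"
      using ga_act_mult[OF rM v] by metis
    then show ?thesis by (simp add: d)
  qed
  then have "intertwiner G M M (ga_act G M z)"
    using ga_act_linear[OF rM] by (simp add: intertwiner_def)
  from schur_scalar[OF M this] show ?thesis using that by blast
qed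

end

section \<open>Chains of groups\<close>

locale multiplicity_free_chain =
  fixes F :: "nat \<Rightarrow> 'g monoid" and n :: nat
  assumes chain: "group_chain F n" and branching: "simple_branching F n"
begin

lemma finite_group_F: "1 \<le> i \<Longrightarrow> i \<le> n \<Longrightarrow> finite_group (F i)"
  using chain unfolding group_chain_def finite_group_def finite_group_axioms_def by simp

lemma chain_carrier:
  assumes "1 \<le> i" "i \<le> j" "j \<le> n"
  shows "carrier (F i) \<subseteq> carrier (F j)"
    and "\<And>x y. x \<in> carrier (F i) \<Longrightarrow> y \<in> carrier (F i) \<Longrightarrow> x \<otimes>\<^bsub>F j\<^esub> y = x \<otimes>\<^bsub>F i\<^esub> y"
proof -
  have "carrier (F i) \<subseteq> carrier (F j) \<and>
    (\<forall>x\<in>carrier (F i). \<forall>y\<in>carrier (F i). x \<otimes>\<^bsub>F j\<^esub> y = x \<otimes>\<^bsub>F i\<^esub> y)"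
    using assms(2,3)
  proof (induction j rule: dec_induct)
    case (step j)
    have sub: "carrier (F j) \<subseteq> carrier (F (Suc j))"
      using chain step assms(1) by (intro subgroup.subset) (auto simp: group_chain_def)
    have mult: "\<forall>x\<in>carrier (F j). \<forall>y\<in>carrier (F j). x \<otimes>\<^bsub>F j\<^esub> y = x \<otimes>\<^bsub>F (Suc j)\<^esub> y"
      using chain step assms(1) by (auto simp: group_chain_def)
    have IH: "carrier (F i) \<subseteq> carrier (F j)"
      "\<forall>x\<in>carrier (F i). \<forall>y\<in>carrier (F i). x \<otimes>\<^bsub>F j\<^esub> y = x \<otimes>\<^bsub>F i\<^esub> y"
      using step by auto
    show ?case
    proof (intro conjI ballI)
      fix x y assume "x \<in> carrier (F i)" "y \<in> carrier (F i)"
      then show "x \<otimes>\<^bsub>F (Suc j)\<^esub> y = x \<otimes>\<^bsub>F i\<^esub> y" using mult IH by (metis subsetD)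
    qed (use sub IH(1) in auto)
  qed simp
  then show "carrier (F i) \<subseteq> carrier (F j)"
    "\<And>x y. x \<in> carrier (F i) \<Longrightarrow> y \<in> carrier (F i) \<Longrightarrow> x \<otimes>\<^bsub>F j\<^esub> y = x \<otimes>\<^bsub>F i\<^esub> y" by auto
qed

lemma chain_one:
  assumes ij: "1 \<le> i" "i \<le> j" "j \<le> n"
  shows "\<one>\<^bsub>F j\<^esub> = \<one>\<^bsub>F i\<^esub>"
proof -
  interpret i: finite_group "F i" using ij by (intro finite_group_F) auto
  interpret j: finite_group "F j" using ij by (intro finite_group_F) auto
  have "\<one>\<^bsub>F i\<^esub> \<otimes>\<^bsub>F j\<^esub> \<one>\<^bsub>F i\<^esub> = \<one>\<^bsub>F i\<^esub>" using chain_carrier(2)[OF ij] by simp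
  moreover have "\<one>\<^bsub>F i\<^esub> \<in> carrier (F j)" using chain_carrier(1)[OF ij] by auto
  ultimately show ?thesis using j.l_cancel_one by metis
qed

lemma chain_inv:
  assumes ij: "1 \<le> i" "i \<le> j" "j \<le> n" and x: "x \<in> carrier (F i)"
  shows "inv\<^bsub>F j\<^esub> x = inv\<^bsub>F i\<^esub> x"
proof -
  interpret i: finite_group "F i" using ij by (intro finite_group_F) auto
  interpret j: finite_group "F j" using ij by (intro finite_group_F) auto
  have "inv\<^bsub>F i\<^esub> x \<otimes>\<^bsub>F j\<^esub> x = \<one>\<^bsub>F j\<^esub>"
    using chain_carrier(2)[OF ij] chain_one[OF ij] x by simp
  moreover have "x \<in> carrier (F j)" "inv\<^bsub>F i\<^esub> x \<in> carrier (F j)"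
    using chain_carrier(1)[OF ij] x by auto
  ultimately show ?thesis by (intro j.inv_equality)
qed

lemma group_algebra_chain:
  assumes "1 \<le> i" "i \<le> j" "j \<le> n" shows "group_algebra (F i) \<subseteq> group_algebra (F j)"
  using chain_carrier(1)[OF assms] by (auto simp: group_algebra_def)

lemma ga_act_chain:
  assumes ij: "1 \<le> i" "i \<le> j" "j \<le> n" and a: "a \<in> group_algebra (F i)"
  shows "ga_act (F j) M a = ga_act (F i) M a"
proof
  interpret j: finite_group "F j" using ij by (intro finite_group_F) auto
  show "ga_act (F j) M a v = ga_act (F i) M a v" for v
    unfolding ga_act_def using j.finite_carrier chain_carrier(1)[OF ij] a
    by (intro sum.mono_neutral_right) (auto simp: group_algebra_def)
qed

text \<open>
  The terms of the larger convolution vanish unless both \<open>y\<close> and \<open>inv y \<otimes> x\<close> lie in the subgroup, and then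
  so does \<open>x\<close>.
\<close>

lemma ga_mult_chain:
  assumes ij: "1 \<le> i" "i \<le> j" "j \<le> n" and a: "a \<in> group_algebra (F i)" and b: "b \<in> group_algebra (F i)"
  shows "ga_mult (F j) a b = ga_mult (F i) a b"
proof
  fix x
  interpret i: finite_group "F i" using ij by (intro finite_group_F) auto
  interpret j: finite_group "F j" using ij by (intro finite_group_F) auto
  note sub = chain_carrier(1)[OF ij]
  have *: "inv\<^bsub>F j\<^esub> y \<otimes>\<^bsub>F j\<^esub> x = inv\<^bsub>F i\<^esub> y \<otimes>\<^bsub>F i\<^esub> x" if "y \<in> carrier (F i)" "x \<in> carrier (F i)" for y
    using that chain_inv[OF ij] chain_carrier(2)[OF ij] by simp
  have out: "b (inv\<^bsub>F j\<^esub> y \<otimes>\<^bsub>F j\<^esub> x) = 0"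
    if y: "y \<in> carrier (F i)" and x: "x \<in> carrier (F j)" "x \<notin> carrier (F i)" for y
  proof -
    let ?z = "inv\<^bsub>F j\<^esub> y \<otimes>\<^bsub>F j\<^esub> x"
    have "?z \<notin> carrier (F i)"
    proof
      assume z: "?z \<in> carrier (F i)"
      have "x = y \<otimes>\<^bsub>F j\<^esub> ?z" using y x(1) sub by (auto simp: j.m_assoc[symmetric])
      also have "\<dots> = y \<otimes>\<^bsub>F i\<^esub> ?z" using chain_carrier(2)[OF ij y z] .
      finally show False using x(2) i.m_closed[OF y z] by simp
    qed
    then show ?thesis using b by (simp add: group_algebra_def)
  qed
  have "(\<Sum>y\<in>carrier (F j). a y * b (inv\<^bsub>F j\<^esub> y \<otimes>\<^bsub>F j\<^esub> x)) =
      (\<Sum>y\<in>carrier (F i). a y * b (inv\<^bsub>F j\<^esub> y \<otimes>\<^bsub>F j\<^esub> x))"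
    using j.finite_carrier sub a by (intro sum.mono_neutral_right) (auto simp: group_algebra_def)
  then have expand: "ga_mult (F j) a b x = (if x \<in> carrier (F j) then
      \<Sum>y\<in>carrier (F i). a y * b (inv\<^bsub>F j\<^esub> y \<otimes>\<^bsub>F j\<^esub> x) else 0)"
    by (simp add: ga_mult_def)
  show "ga_mult (F j) a b x = ga_mult (F i) a b x"
  proof (cases "x \<in> carrier (F i)")
    case True
    then have "x \<in> carrier (F j)" using sub by auto
    with True show ?thesis unfolding expand by (simp add: ga_mult_def *)
  next
    case False
    then show ?thesis unfolding expand by (simp add: ga_mult_def out)
  qed
qed

lemma is_rep_chain:
  assumes ij: "1 \<le> i" "i \<le> j" "j \<le> n" and M: "is_rep (F j) M"
  shows "is_rep (F i) M"
proof -
  note sub = subsetD[OF chain_carrier(1)[OF ij]]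
  have "snd M (g \<otimes>\<^bsub>F i\<^esub> h) v = snd M g (snd M h v)"
    if "g \<in> carrier (F i)" "h \<in> carrier (F i)" "v \<in> fst M" for g h v
    using rep_mult[OF M sub sub, of g h v] that chain_carrier(2)[OF ij] by simp
  then show ?thesis
    using rep_subspace[OF M] rep_fin_dim[OF M] rep_linear[OF M sub] rep_one[OF M] chain_one[OF ij]
    unfolding is_rep_iff by simp
qed

lemma submodule_chain:
  assumes ij: "1 \<le> i" "i \<le> j" "j \<le> n" and U: "submodule_of (F j) M U"
  shows "submodule_of (F i) M U"
  using U chain_carrier(1)[OF ij] by (auto simp: submodule_iff)

text \<open>
  By simple branching every irreducible \<open>F\<^sub>i\<close>-submodule continues a branching chain, and distinct ones are not isomorphic.
\<close>

lemma
  assumes i: "1 \<le> i" "Suc i \<le> n" and N: "irreducible_rep (F (Suc i)) N"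
    and \<mu>: "\<mu> \<in> irr_classes (F i)" and U: "submodule_of (F i) N U" "(U, snd N) \<in> \<mu>"
  shows branches_to_of_submodule: "branches_to (F i) \<mu> (irr_class_of (F (Suc i)) N)"
    and submodule_unique: "submodule_of (F i) N U' \<Longrightarrow> (U', snd N) \<in> \<mu> \<Longrightarrow> U' = U"
proof -
  interpret G: finite_group "F i" using i by (intro finite_group_F) auto
  have r: "is_rep (F i) N"
    using i by (intro is_rep_chain[OF _ _ _ irreducible_is_rep[OF N]]) auto
  have "Suc i \<in> {2..n}" using i by auto
  then have le1: "multiplicity_in (F i) \<mu> N \<in> {0, 1}"
    using branching \<mu> irr_class_of_class[OF N] irr_class_of_mem[OF N]
    unfolding simple_branching_def by fastforce
  show "branches_to (F i) \<mu> (irr_class_of (F (Suc i)) N)"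
    unfolding branches_to_def
    using G.multiplicity_one_of_submodule[OF r \<mu> le1 U] irr_class_of_mem[OF N] by blast
  show "submodule_of (F i) N U' \<Longrightarrow> (U', snd N) \<in> \<mu> \<Longrightarrow> U' = U"
    by (rule G.multiplicity_free_unique[OF r \<mu> le1 U])
qed

section \<open>Gelfand-Tsetlin subspaces\<close>

text \<open>
  The whole flag between \<open>V\<^sub>T\<close> and \<open>M\<close>. Its member at level \<open>j\<close> is irreducible over \<open>F\<^sub>j\<close> and contains \<open>V\<^sub>T\<close>,
  which is what makes the centre of \<open>\<complex>[F\<^sub>j]\<close> act on \<open>V\<^sub>T\<close> by scalars.
\<close>

lemma GZ_flag:
  assumes m: "1 \<le> m" "m \<le> n" and M: "is_rep (F m) M" and GZ: "GZ_subspace F m M T W"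
  obtains U where "U m = fst M" "U 1 = W"
    "\<forall>j\<in>{2..m}. submodule_of (F (j - 1)) (U j, snd M) (U (j - 1))"
    "\<forall>j\<in>{1..m}. submodule_of (F j) M (U j) \<and> (U j, snd M) \<in> T j \<and> T j \<in> irr_classes (F j) \<and> W \<subseteq> U j"
proof -
  obtain U where U: "U m = fst M" "U 1 = W"
    and flag: "\<forall>j\<in>{2..m}. submodule_of (F (j - 1)) (U j, snd M) (U (j - 1)) \<and> (U (j - 1), snd M) \<in> T (j - 1)"
    using GZ by (auto simp: GZ_subspace_def)
  have T: "T j \<in> irr_classes (F j)" if "j \<in> {1..m}" for j
    using GZ that by (auto simp: GZ_subspace_def branching_chain_def)
  have cls: "(U j, snd M) \<in> T j" if "j \<in> {1..m}" for j
  proof (cases "j = m")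
    case True
    then show ?thesis using GZ U(1) by (simp add: GZ_subspace_def)
  next
    case False
    then have "Suc j \<in> {2..m}" using that by auto
    then show ?thesis using bspec[OF flag, of "Suc j"] by simp
  qed
  have below: "submodule_of (F j) (U (Suc j), snd M) (U j)" if "1 \<le> j" "j < m" for j
    using bspec[OF flag, of "Suc j"] that by simp
  have sub: "submodule_of (F j) M (U j)" if "1 \<le> j" "j \<le> m" for j
    using that(2,1)
  proof (induction j rule: inc_induct)
    case base
    then show ?case using U(1) rep_subspace[OF M] rep_mem[OF M] by (simp add: submodule_iff)
  next
    case (step j)
    then have "submodule_of (F j) (U (Suc j), snd M) (U j)" by (intro below) auto
    moreover have "submodule_of (F j) M (U (Suc j))"
      using step m by (intro submodule_chain[of j "Suc j"]) auto
    ultimately show ?case by (rule submodule_trans[rotated])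
  qed
  have le: "W \<subseteq> U j" if "1 \<le> j" "j \<le> m" for j
    using that
  proof (induction j rule: dec_induct)
    case base
    then show ?case using U(2) by simp
  next
    case (step j)
    then have "submodule_of (F j) (U (Suc j), snd M) (U j)" by (intro below) auto
    then have "U j \<subseteq> U (Suc j)" by (simp add: submodule_iff)
    then show ?case using step by auto
  qed
  show ?thesis
    by (rule that[OF U]) (use flag cls T sub le in auto)
qed

lemma
  assumes m: "1 \<le> m" "m \<le> n" and M: "is_rep (F m) M" and GZ: "GZ_subspace F m M T W"
  shows GZ_bottom_class: "(W, snd M) \<in> T 1" "T 1 \<in> irr_classes (F 1)"
    and GZ_subset: "W \<subseteq> fst M"
    and GZ_vector_subspace: "cfun.subspace W"
proof -
  obtain U where "U m = fst M" "U 1 = W"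
    "\<forall>j\<in>{2..m}. submodule_of (F (j - 1)) (U j, snd M) (U (j - 1))"
    and U: "\<forall>j\<in>{1..m}. submodule_of (F j) M (U j) \<and> (U j, snd M) \<in> T j \<and> T j \<in> irr_classes (F j) \<and> W \<subseteq> U j"
    by (rule GZ_flag[OF m M GZ])
  then show "(W, snd M) \<in> T 1" "T 1 \<in> irr_classes (F 1)" "W \<subseteq> fst M" "cfun.subspace W"
    using m bspec[OF U, of 1] by (auto simp: submodule_iff)
qed

text \<open>
  The class at the new top level is forced, and the constituent \<open>U\<close> branches to it by simple branching.
\<close>

lemma GZ_extend:
  assumes i: "1 \<le> i" "Suc i \<le> n" and N: "irreducible_rep (F (Suc i)) N"
    and U: "submodule_of (F i) N U" and GZ: "GZ_subspace F i (U, snd N) T W"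
  shows "GZ_subspace F (Suc i) N (T(Suc i := irr_class_of (F (Suc i)) N)) W"
proof -
  let ?T = "T(Suc i := irr_class_of (F (Suc i)) N)"
  obtain Y where Y: "Y i = U" "Y 1 = W"
    "\<forall>j\<in>{2..i}. submodule_of (F (j - 1)) (Y j, snd N) (Y (j - 1)) \<and> (Y (j - 1), snd N) \<in> T (j - 1)"
    using GZ by (auto simp: GZ_subspace_def)
  have T: "\<forall>j\<in>{1..i}. T j \<in> irr_classes (F j)" "\<forall>j\<in>{2..i}. branches_to (F (j - 1)) (T (j - 1)) (T j)"
    "(U, snd N) \<in> T i"
    using GZ by (auto simp: GZ_subspace_def branching_chain_def)
  have "branches_to (F i) (T i) (irr_class_of (F (Suc i)) N)"
    using T(1,3) i by (intro branches_to_of_submodule[OF i N _ U]) auto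
  then have "branching_chain F (Suc i) ?T"
    using T(1,2) irr_class_of_class[OF N] unfolding branching_chain_def
    by (auto simp: le_Suc_eq)
  moreover have "N \<in> ?T (Suc i)" using irr_class_of_mem[OF N] by simp
  moreover have "\<forall>j\<in>{2..Suc i}. submodule_of (F (j - 1)) ((Y(Suc i := fst N)) j, snd N) ((Y(Suc i := fst N)) (j - 1)) \<and>
      ((Y(Suc i := fst N)) (j - 1), snd N) \<in> ?T (j - 1)"
    using Y T(3) U by (auto simp: le_Suc_eq)
  ultimately show ?thesis
    unfolding GZ_subspace_def using Y(2) i by (intro conjI exI[of _ "Y(Suc i := fst N)"]) auto
qed

text \<open>
  An isomorphism carries the whole flag along.
\<close>

lemma GZ_transport:
  assumes m: "1 \<le> m" "m \<le> n" and M: "irreducible_rep (F m) M" and N: "irreducible_rep (F m) N"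
    and \<psi>: "rep_iso (F m) M N \<psi>" and GZ: "GZ_subspace F m M T W"
  shows "GZ_subspace F m N T (\<psi> ` W)"
proof -
  note rM = irreducible_is_rep[OF M] and rN = irreducible_is_rep[OF N]
  obtain U where U: "U m = fst M" "U 1 = W"
    "\<forall>j\<in>{2..m}. submodule_of (F (j - 1)) (U j, snd M) (U (j - 1))"
    "\<forall>j\<in>{1..m}. submodule_of (F j) M (U j) \<and> (U j, snd M) \<in> T j \<and> T j \<in> irr_classes (F j) \<and> W \<subseteq> U j"
    by (rule GZ_flag[OF m rM GZ])
  have sub: "U j \<subseteq> fst M" if "1 \<le> j" "j \<le> m" for j
    using U(4) that by (auto simp: submodule_iff)
  have \<psi>': "rep_iso (F i) (U j, snd M) (\<psi> ` U j, snd N) \<psi>" if "1 \<le> i" "i \<le> m" "1 \<le> j" "j \<le> m" for i j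
    using that m chain_carrier(1)[of i m] by (intro rep_iso_restrict[OF \<psi> sub]) auto
  have cls: "(\<psi> ` U j, snd N) \<in> T j" if j: "1 \<le> j" "j \<le> m" for j
  proof -
    have Uj: "submodule_of (F j) M (U j)" "(U j, snd M) \<in> T j" "T j \<in> irr_classes (F j)" using U(4) j by auto
    have "intertwiner (F j) M N \<psi>"
      using \<psi> chain_carrier(1)[OF j m(2)] by (auto simp: rep_iso_iff intertwiner_def)
    then have "submodule_of (F j) N (\<psi> ` U j)" using Uj(1) by (rule intertwiner_image_submodule)
    then have "is_rep (F j) (\<psi> ` U j, snd N)"
      by (rule submodule_is_rep[OF is_rep_chain[OF j m(2) rN]])
    then have "irreducible_rep (F j) (\<psi> ` U j, snd N)"
      using rep_iso_irreducible[OF irr_class_irreducible[OF Uj(3,2)] _ \<psi>'[OF j j]] by blast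
    then show ?thesis using irr_class_closed[OF Uj(3,2) _ \<psi>'[OF j j]] by blast
  qed
  have "submodule_of (F (j - 1)) (\<psi> ` U j, snd N) (\<psi> ` U (j - 1))" if j: "j \<in> {2..m}" for j
  proof -
    have "rep_iso (F (j - 1)) (U j, snd M) (\<psi> ` U j, snd N) \<psi>" using j by (intro \<psi>') auto
    then show ?thesis
      using bspec[OF U(3) j] intertwiner_image_submodule[of "F (j - 1)" "(U j, snd M)"]
      by (auto simp: rep_iso_iff)
  qed
  moreover have "(\<psi> ` U (j - 1), snd N) \<in> T (j - 1)" if "j \<in> {2..m}" for j
    using that by (intro cls) auto
  moreover have "\<psi> ` U m = fst N" using \<psi> U(1) by (simp add: rep_iso_iff bij_betw_def)
  moreover have "N \<in> T m" using cls[of m] m calculation(3) by simp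
  moreover have "branching_chain F m T" using GZ by (simp add: GZ_subspace_def)
  ultimately show ?thesis
    unfolding GZ_subspace_def using U(2) by (intro conjI exI[of _ "\<lambda>j. \<psi> ` U j"]) auto
qed

text \<open>
  Induction on the level: \<open>N\<close> is the sum of irreducible modules over the next smaller group, and their
  Gelfand-Tsetlin subspaces are Gelfand-Tsetlin subspaces of \<open>N\<close>.
\<close>

lemma GZ_span:
  assumes "1 \<le> m" "m \<le> n" "irreducible_rep (F m) N"
  shows "fst N \<subseteq> cfun.span (\<Union>{W. \<exists>T. GZ_subspace F m N T W})"
  using assms
proof (induction m arbitrary: N rule: dec_induct)
  case base
  have "GZ_subspace F 1 N (\<lambda>_. irr_class_of (F 1) N) (fst N)"
    unfolding GZ_subspace_def branching_chain_def
    using irr_class_of_class[OF base(2)] irr_class_of_mem[OF base(2)] by auto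
  then have "fst N \<subseteq> \<Union>{W. \<exists>T. GZ_subspace F 1 N T W}" by blast
  also have "\<dots> \<subseteq> cfun.span \<dots>" by (rule cfun.span_superset)
  finally show ?case .
next
  case (step i)
  interpret G: finite_group "F i" using step by (intro finite_group_F) auto
  have rN: "is_rep (F i) N"
    using step by (intro is_rep_chain[OF _ _ _ irreducible_is_rep[OF step.prems(2)]]) auto
  obtain k W where W: "irr_decomposition (F i) N k W" using G.decomposition_exists[OF rN] by blast
  let ?S = "\<Union>{Y. \<exists>T. GZ_subspace F (Suc i) N T Y}"
  have Wj: "W j \<subseteq> cfun.span ?S" if j: "j < k" for j
  proof -
    have *: "submodule_of (F i) N (W j)" "irreducible_rep (F i) (W j, snd N)"
      using W j by (auto simp: irr_decomposition_def)
    have "fst (W j, snd N) \<subseteq> cfun.span (\<Union>{Y. \<exists>T. GZ_subspace F i (W j, snd N) T Y})"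
      by (rule step.IH[OF _ *(2)]) (use step.prems in simp)
    then have "W j \<subseteq> cfun.span (\<Union>{Y. \<exists>T. GZ_subspace F i (W j, snd N) T Y})"
      by (simp only: fst_conv)
    also have "\<dots> \<subseteq> cfun.span ?S"
      using GZ_extend[OF step.hyps(1) step.prems(1,2) *(1)] by (intro cfun.span_mono) blast
    finally show ?thesis .
  qed
  show ?case
  proof
    fix v assume v: "v \<in> fst N"
    have "direct_sum (fst N) k W" using W by (simp add: irr_decomposition_def)
    then obtain w where "w \<in> (\<Pi>\<^sub>E j\<in>{..<k}. W j)" "v = (\<Sum>j<k. w j)"
      using v by (auto simp: direct_sum_def dest!: bspec)
    then show "v \<in> cfun.span ?S"
      using Wj by (auto intro!: cfun.span_sum)
  qed
qed

end

section \<open>Algebras defined by a condition on the Gelfand-Tsetlin subspaces\<close>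

text \<open>
  A condition \<open>P \<mu> N f\<close> on an endomorphism \<open>f\<close> of an irreducible \<open>F\<^sub>1\<close>-module \<open>N\<close> of class \<open>\<mu>\<close>. The closure
  properties make the elements that satisfy it on every Gelfand-Tsetlin subspace an algebra
  containing the centres; invariance under isomorphism makes it pass from a submodule of an
  irreducible \<open>F\<^sub>i\<^sub>+\<^sub>1\<close>-module to an abstract irreducible \<open>F\<^sub>i\<close>-module. The class \<open>\<mu>\<close> is an argument because the
  distinguished basis depends on it.
\<close>

locale gz_condition = multiplicity_free_chain F n for F :: "nat \<Rightarrow> 'g monoid" and n +
  fixes P :: "'g rep set \<Rightarrow> 'g rep \<Rightarrow> ((nat \<Rightarrow> complex) \<Rightarrow> nat \<Rightarrow> complex) \<Rightarrow> bool"
  assumes P_scalar: "\<mu> \<in> irr_classes (F 1) \<Longrightarrow> N \<in> \<mu> \<Longrightarrow> (\<And>w. w \<in> fst N \<Longrightarrow> f w = c *\<^sub>c w) \<Longrightarrow> P \<mu> N f"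
    and P_add: "\<mu> \<in> irr_classes (F 1) \<Longrightarrow> N \<in> \<mu> \<Longrightarrow>
      linear_on (fst N) (fst N) f \<Longrightarrow> linear_on (fst N) (fst N) g \<Longrightarrow>
      P \<mu> N f \<Longrightarrow> P \<mu> N g \<Longrightarrow> P \<mu> N (\<lambda>w. f w + g w)"
    and P_comp: "\<mu> \<in> irr_classes (F 1) \<Longrightarrow> N \<in> \<mu> \<Longrightarrow>
      linear_on (fst N) (fst N) f \<Longrightarrow> linear_on (fst N) (fst N) g \<Longrightarrow>
      P \<mu> N f \<Longrightarrow> P \<mu> N g \<Longrightarrow> P \<mu> N (\<lambda>w. f (g w))"
    and P_transfer: "\<mu> \<in> irr_classes (F 1) \<Longrightarrow> N \<in> \<mu> \<Longrightarrow> N' \<in> \<mu> \<Longrightarrow>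
      linear_on (fst N) (fst N) f \<Longrightarrow> linear_on (fst N') (fst N') f' \<Longrightarrow>
      rep_iso (F 1) N' N \<psi> \<Longrightarrow> (\<And>w. w \<in> fst N' \<Longrightarrow> \<psi> (f' w) = f (\<psi> w)) \<Longrightarrow> P \<mu> N f \<Longrightarrow> P \<mu> N' f'"
begin

text \<open>
  Invariance of the subspaces is demanded separately, so that \<open>P\<close> is only ever applied to genuine
  endomorphisms of \<open>W\<close>.
\<close>

definition gz_alg :: "nat \<Rightarrow> ('g \<Rightarrow> complex) set"
  where "gz_alg m = {a \<in> group_algebra (F m).
    \<forall>M T W. irreducible_rep (F m) M \<longrightarrow> GZ_subspace F m M T W \<longrightarrow>
      (\<forall>w\<in>W. ga_act (F m) M a w \<in> W) \<and> P (T 1) (W, snd M) (ga_act (F m) M a)}"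

text \<open>
  \<open>P\<close> sees only the values of \<open>f\<close> on \<open>N\<close>: apply its invariance to the identity map.
\<close>

lemma P_cong:
  assumes \<mu>: "\<mu> \<in> irr_classes (F 1)" "N \<in> \<mu>" and f: "linear_on (fst N) (fst N) f"
    and eq: "\<And>w. w \<in> fst N \<Longrightarrow> f' w = f w" and P: "P \<mu> N f"
  shows "P \<mu> N f'"
proof -
  have rN: "is_rep (F 1) N" by (rule irreducible_is_rep[OF irr_class_irreducible[OF \<mu>]])
  have "f' (c *\<^sub>c x) = c *\<^sub>c f' x" if "x \<in> fst N" for c x
    using eq[OF that] eq[OF cfun.subspace_scale[OF rep_subspace[OF rN] that]]
      linear_on_scale[OF f that] by metis
  moreover have "f' (x + y) = f' x + f' y" if "x \<in> fst N" "y \<in> fst N" for x y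
    using eq[OF that(1)] eq[OF that(2)] eq[OF cfun.subspace_add[OF rep_subspace[OF rN] that]]
      linear_on_add[OF f that] by metis
  ultimately have f': "linear_on (fst N) (fst N) f'"
    using linear_on_mem[OF f] eq by (simp add: linear_on_def)
  show ?thesis
    by (rule P_transfer[OF \<mu>(1,2,2) f f' rep_iso_refl[OF rN] eq P])
qed

lemma gz_algI:
  assumes "a \<in> group_algebra (F m)"
    and "\<And>M T W. irreducible_rep (F m) M \<Longrightarrow> GZ_subspace F m M T W \<Longrightarrow>
      (\<forall>w\<in>W. ga_act (F m) M a w \<in> W) \<and> P (T 1) (W, snd M) (ga_act (F m) M a)"
  shows "a \<in> gz_alg m"
  using assms unfolding gz_alg_def by blast

lemma gz_alg_mem: "a \<in> gz_alg m \<Longrightarrow> a \<in> group_algebra (F m)"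
  by (simp add: gz_alg_def)

lemma GZ_linear:
  assumes m: "1 \<le> m" "m \<le> n" and M: "is_rep (F m) M" and GZ: "GZ_subspace F m M T W"
    and inv: "\<And>w. w \<in> W \<Longrightarrow> ga_act (F m) M a w \<in> W"
  shows "linear_on W W (ga_act (F m) M a)"
  by (rule linear_on_subset[OF ga_act_linear[OF M] GZ_subset[OF m M GZ] inv])

lemma
  assumes m: "1 \<le> m" "m \<le> n" and a: "a \<in> gz_alg m"
    and M: "irreducible_rep (F m) M" and GZ: "GZ_subspace F m M T W"
  shows gz_alg_linear: "linear_on W W (ga_act (F m) M a)"
    and gz_alg_invariant: "w \<in> W \<Longrightarrow> ga_act (F m) M a w \<in> W"
    and gz_alg_condition: "P (T 1) (W, snd M) (ga_act (F m) M a)"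
proof -
  show "P (T 1) (W, snd M) (ga_act (F m) M a)" "w \<in> W \<Longrightarrow> ga_act (F m) M a w \<in> W" for w
    using a M GZ unfolding gz_alg_def by blast+
  then show "linear_on W W (ga_act (F m) M a)"
    using GZ_linear[OF m irreducible_is_rep[OF M] GZ] by blast
qed

lemma gz_alg_scalarI:
  assumes m: "1 \<le> m" "m \<le> n" and a: "a \<in> group_algebra (F m)"
    and sc: "\<And>M T W. irreducible_rep (F m) M \<Longrightarrow> GZ_subspace F m M T W \<Longrightarrow>
      \<exists>c. \<forall>w\<in>W. ga_act (F m) M a w = c *\<^sub>c w"
  shows "a \<in> gz_alg m"
proof -
  have "(\<forall>w\<in>W. ga_act (F m) M a w \<in> W) \<and> P (T 1) (W, snd M) (ga_act (F m) M a)"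
    if M: "irreducible_rep (F m) M" and GZ: "GZ_subspace F m M T W" for M T W
  proof -
    note rM = irreducible_is_rep[OF M]
    obtain c where c: "\<forall>w\<in>W. ga_act (F m) M a w = c *\<^sub>c w" using sc[OF M GZ] by blast
    have "P (T 1) (W, snd M) (ga_act (F m) M a)"
      using c by (intro P_scalar[OF GZ_bottom_class(2,1)[OF m rM GZ], of _ c]) (metis fst_conv)
    moreover have "ga_act (F m) M a w \<in> W" if "w \<in> W" for w
      using c that cfun.subspace_scale[OF GZ_vector_subspace[OF m rM GZ] that] by metis
    ultimately show ?thesis by blast
  qed
  with a show ?thesis by (rule gz_algI)
qed

text \<open>
  Scalar multiples of the unit satisfy the condition, so closure under scaling follows from closure
  under products.
\<close>

lemma gz_alg_subalgebra:
  assumes m: "1 \<le> m" "m \<le> n"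
  shows "ga_subalgebra (F m) (gz_alg m)"
proof -
  interpret G: finite_group "F m" by (rule finite_group_F[OF m])
  have one: "ga_one (F m) \<in> gz_alg m"
  proof (rule gz_alg_scalarI[OF m])
    show "ga_one (F m) \<in> group_algebra (F m)" by (auto simp: ga_one_def group_algebra_def)
    fix M T W assume M: "irreducible_rep (F m) M" and GZ: "GZ_subspace F m M T W"
    note rM = irreducible_is_rep[OF M]
    have "ga_act (F m) M (ga_one (F m)) w = 1 *\<^sub>c w" if "w \<in> W" for w
      using G.ga_act_one[OF rM, of w] GZ_subset[OF m rM GZ] that by auto
    then show "\<exists>c. \<forall>w\<in>W. ga_act (F m) M (ga_one (F m)) w = c *\<^sub>c w" by blast
  qed
  have mult: "ga_mult (F m) a b \<in> gz_alg m" if ab: "a \<in> gz_alg m" "b \<in> gz_alg m" for a b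
  proof -
    have "(\<forall>w\<in>W. ga_act (F m) M (ga_mult (F m) a b) w \<in> W) \<and>
        P (T 1) (W, snd M) (ga_act (F m) M (ga_mult (F m) a b))"
      if M: "irreducible_rep (F m) M" and GZ: "GZ_subspace F m M T W" for M T W
    proof -
      note rM = irreducible_is_rep[OF M]
      note cls = GZ_bottom_class(2,1)[OF m rM GZ]
      note la = gz_alg_linear[OF m ab(1) M GZ] and lb = gz_alg_linear[OF m ab(2) M GZ]
      have eq: "ga_act (F m) M (ga_mult (F m) a b) w = ga_act (F m) M a (ga_act (F m) M b w)" if "w \<in> W" for w
        using G.ga_act_mult[OF rM] GZ_subset[OF m rM GZ] that by blast
      have "P (T 1) (W, snd M) (\<lambda>w. ga_act (F m) M a (ga_act (F m) M b w))"
        by (rule P_comp[OF cls, of "ga_act (F m) M a" "ga_act (F m) M b"])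
          (simp_all only: fst_conv la lb gz_alg_condition[OF m ab(1) M GZ] gz_alg_condition[OF m ab(2) M GZ])
      then have "P (T 1) (W, snd M) (ga_act (F m) M (ga_mult (F m) a b))"
        by (rule P_cong[OF cls _ _, rotated 2]) (simp_all only: fst_conv linear_on_comp[OF lb la] eq)
      moreover have "ga_act (F m) M (ga_mult (F m) a b) w \<in> W" if "w \<in> W" for w
        using eq[OF that] linear_on_mem[OF la linear_on_mem[OF lb that]] by simp
      ultimately show ?thesis by blast
    qed
    with ga_mult_closed show ?thesis by (rule gz_algI)
  qed
  have scalar: "c *\<^sub>c ga_one (F m) \<in> gz_alg m" for c
  proof (rule gz_alg_scalarI[OF m])
    show "c *\<^sub>c ga_one (F m) \<in> group_algebra (F m)" by (auto simp: ga_one_def group_algebra_def)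
    fix M T W assume M: "irreducible_rep (F m) M" and GZ: "GZ_subspace F m M T W"
    note rM = irreducible_is_rep[OF M]
    have "ga_act (F m) M (c *\<^sub>c ga_one (F m)) w = c *\<^sub>c w" if "w \<in> W" for w
    proof -
      have "ga_act (F m) M (ga_one (F m)) w = w"
        using GZ_subset[OF m rM GZ] that by (intro G.ga_act_one[OF rM]) auto
      then show ?thesis by (simp only: ga_act_scale)
    qed
    then show "\<exists>c'. \<forall>w\<in>W. ga_act (F m) M (c *\<^sub>c ga_one (F m)) w = c' *\<^sub>c w" by blast
  qed
  have add: "a + b \<in> gz_alg m" if ab: "a \<in> gz_alg m" "b \<in> gz_alg m" for a b
  proof -
    have "a + b \<in> group_algebra (F m)"
      using ab by (intro cfun.subspace_add[OF group_algebra_subspace] gz_alg_mem)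
    moreover have "(\<forall>w\<in>W. ga_act (F m) M (a + b) w \<in> W) \<and> P (T 1) (W, snd M) (ga_act (F m) M (a + b))"
      if M: "irreducible_rep (F m) M" and GZ: "GZ_subspace F m M T W" for M T W
    proof -
      note rM = irreducible_is_rep[OF M]
      note cls = GZ_bottom_class(2,1)[OF m rM GZ]
      note la = gz_alg_linear[OF m ab(1) M GZ] and lb = gz_alg_linear[OF m ab(2) M GZ]
      have "P (T 1) (W, snd M) (\<lambda>w. ga_act (F m) M a w + ga_act (F m) M b w)"
        by (rule P_add[OF cls, of "ga_act (F m) M a" "ga_act (F m) M b"])
          (simp_all only: fst_conv la lb gz_alg_condition[OF m ab(1) M GZ] gz_alg_condition[OF m ab(2) M GZ])
      then have "P (T 1) (W, snd M) (ga_act (F m) M (a + b))"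
        by (simp only: ga_act_add[symmetric])
      moreover have "ga_act (F m) M (a + b) w \<in> W" if "w \<in> W" for w
        unfolding ga_act_add
        by (rule cfun.subspace_add[OF GZ_vector_subspace[OF m rM GZ] linear_on_mem[OF la that] linear_on_mem[OF lb that]])
      ultimately show ?thesis by blast
    qed
    ultimately show ?thesis by (rule gz_algI)
  qed
  have scale: "c *\<^sub>c a \<in> gz_alg m" if a: "a \<in> gz_alg m" for c a
  proof -
    have "c *\<^sub>c a = ga_mult (F m) (c *\<^sub>c ga_one (F m)) a"
    proof (rule G.irreducibles_faithful_eq)
      show "c *\<^sub>c a \<in> group_algebra (F m)"
        by (rule cfun.subspace_scale[OF group_algebra_subspace gz_alg_mem[OF a]])
      fix M v assume M: "irreducible_rep (F m) M" and v: "v \<in> fst M"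
      note rM = irreducible_is_rep[OF M]
      have "ga_act (F m) M a v \<in> fst M" by (rule linear_on_mem[OF ga_act_linear[OF rM] v])
      then show "ga_act (F m) M (c *\<^sub>c a) v = ga_act (F m) M (ga_mult (F m) (c *\<^sub>c ga_one (F m)) a) v"
        by (simp only: G.ga_act_mult[OF rM v] ga_act_scale G.ga_act_one[OF rM])
    qed (rule ga_mult_closed)
    then show ?thesis using mult[OF scalar a] by metis
  qed
  have "0 *\<^sub>c ga_one (F m) \<in> gz_alg m" by (rule scalar)
  then have "0 \<in> gz_alg m" by (simp only: cfun.scale_zero_left)
  then have "cfun.subspace (gz_alg m)" using add scale by (rule cfun.subspaceI)
  then show ?thesis using one mult gz_alg_mem unfolding ga_subalgebra_def by blast
qed

text \<open>
  Schur's lemma on the member of level \<open>j\<close> of the flag, which contains \<open>W\<close>.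
\<close>

lemma center_scalar_on_GZ:
  assumes j: "1 \<le> j" "j \<le> m" "m \<le> n" and z: "z \<in> ga_center (F j)"
    and M: "irreducible_rep (F m) M" and GZ: "GZ_subspace F m M T W"
  shows "\<exists>c. \<forall>w\<in>W. ga_act (F m) M z w = c *\<^sub>c w"
proof -
  interpret G: finite_group "F j" using j by (intro finite_group_F) auto
  have m: "1 \<le> m" "m \<le> n" using j by auto
  obtain U where "U m = fst M" "U 1 = W"
    "\<forall>j\<in>{2..m}. submodule_of (F (j - 1)) (U j, snd M) (U (j - 1))"
    and U: "\<forall>j\<in>{1..m}. submodule_of (F j) M (U j) \<and> (U j, snd M) \<in> T j \<and> T j \<in> irr_classes (F j) \<and> W \<subseteq> U j"
    by (rule GZ_flag[OF m irreducible_is_rep[OF M] GZ])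
  then have Uj: "(U j, snd M) \<in> T j" "T j \<in> irr_classes (F j)" "W \<subseteq> U j" using j by auto
  obtain c where c: "\<And>v. v \<in> fst (U j, snd M) \<Longrightarrow> ga_act (F j) (U j, snd M) z v = c *\<^sub>c v"
    using G.center_scalar[OF z irr_class_irreducible[OF Uj(2,1)]] by blast
  have "z \<in> group_algebra (F j)" using z by (simp add: ga_center_def)
  then have "ga_act (F m) M z = ga_act (F j) M z" by (rule ga_act_chain[OF j])
  then have "ga_act (F m) M z w = c *\<^sub>c w" if "w \<in> W" for w
    using c[of w] that Uj(3) by auto
  then show ?thesis by blast
qed

lemma center_le_gz_alg:
  assumes j: "1 \<le> j" "j \<le> m" "m \<le> n"
  shows "ga_center (F j) \<subseteq> gz_alg m"
proof
  fix z assume z: "z \<in> ga_center (F j)"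
  then have "z \<in> group_algebra (F m)"
    using group_algebra_chain[OF j] by (auto simp: ga_center_def)
  then show "z \<in> gz_alg m"
    using j center_scalar_on_GZ[OF j z] by (intro gz_alg_scalarI) auto
qed

lemma bottom_le_gz_alg:
  assumes m: "1 \<le> m" "m \<le> n"
  shows "gz_alg 1 \<subseteq> gz_alg m"
proof
  fix a assume a: "a \<in> gz_alg 1"
  have one: "1 \<le> (1::nat)" "1 \<le> n" using m by auto
  have eq: "ga_act (F m) M a = ga_act (F 1) M a" for M
    by (rule ga_act_chain[OF one(1) m gz_alg_mem[OF a]])
  have "a \<in> group_algebra (F m)" using group_algebra_chain[OF one(1) m] gz_alg_mem[OF a] by auto
  moreover have "(\<forall>w\<in>W. ga_act (F m) M a w \<in> W) \<and> P (T 1) (W, snd M) (ga_act (F m) M a)"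
    if M: "irreducible_rep (F m) M" and GZ: "GZ_subspace F m M T W" for M T W
  proof -
    note cls = GZ_bottom_class[OF m irreducible_is_rep[OF M] GZ]
    have iW: "irreducible_rep (F 1) (W, snd M)" by (rule irr_class_irreducible[OF cls(2,1)])
    have GZ1: "GZ_subspace F 1 (W, snd M) T W"
      using cls unfolding GZ_subspace_def branching_chain_def by auto
    show ?thesis
      using gz_alg_invariant[OF one a iW GZ1] gz_alg_condition[OF one a iW GZ1] by (simp add: eq)
  qed
  ultimately show "a \<in> gz_alg m" by (rule gz_algI)
qed

text \<open>
  \<open>U\<close> is spanned by its Gelfand-Tsetlin subspaces, and these are among those of \<open>M\<close>.
\<close>

lemma gz_alg_invariant_submodule:
  assumes i: "1 \<le> i" "Suc i \<le> n" and M: "irreducible_rep (F (Suc i)) M" and a: "a \<in> gz_alg (Suc i)"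
    and U: "submodule_of (F i) M U" "irreducible_rep (F i) (U, snd M)" and u: "u \<in> U"
  shows "ga_act (F (Suc i)) M a u \<in> U"
proof -
  have m: "1 \<le> Suc i" "Suc i \<le> n" using i by auto
  note rM = irreducible_is_rep[OF M]
  have sub: "cfun.subspace U" "U \<subseteq> fst M" using U(1) by (auto simp: submodule_iff)
  let ?S = "\<Union>{Y. \<exists>T. GZ_subspace F i (U, snd M) T Y}"
  have sU: "is_rep (F i) (U, snd M)" by (rule irreducible_is_rep[OF U(2)])
  have GZU: "Y \<subseteq> U" if "GZ_subspace F i (U, snd M) T Y" for T Y
    using GZ_subset[OF _ _ sU that] i by auto
  have "fst (U, snd M) \<subseteq> cfun.span ?S"
    by (rule GZ_span[OF i(1) _ U(2)]) (use i in auto)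
  then have "u \<in> cfun.span ?S" using u by auto
  moreover have "cfun.subspace {v \<in> U. ga_act (F (Suc i)) M a v \<in> U}"
  proof (rule cfun.subspaceI)
    note lin = ga_act_linear[OF rM, of a]
    show "0 \<in> {v \<in> U. ga_act (F (Suc i)) M a v \<in> U}"
      using linear_on_zero[OF lin rep_subspace[OF rM]] cfun.subspace_0[OF sub(1)] by simp
    show "x + y \<in> {v \<in> U. ga_act (F (Suc i)) M a v \<in> U}"
      if "x \<in> {v \<in> U. ga_act (F (Suc i)) M a v \<in> U}" "y \<in> {v \<in> U. ga_act (F (Suc i)) M a v \<in> U}" for x y
    proof -
      have "ga_act (F (Suc i)) M a (x + y) = ga_act (F (Suc i)) M a x + ga_act (F (Suc i)) M a y"
        using that sub(2) by (intro linear_on_add[OF lin]) auto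
      then show ?thesis using that cfun.subspace_add[OF sub(1)] by auto
    qed
    show "c *\<^sub>c x \<in> {v \<in> U. ga_act (F (Suc i)) M a v \<in> U}"
      if "x \<in> {v \<in> U. ga_act (F (Suc i)) M a v \<in> U}" for c x
    proof -
      have "ga_act (F (Suc i)) M a (c *\<^sub>c x) = c *\<^sub>c ga_act (F (Suc i)) M a x"
        using that sub(2) by (intro linear_on_scale[OF lin]) auto
      then show ?thesis using that cfun.subspace_scale[OF sub(1)] by auto
    qed
  qed
  moreover have "?S \<subseteq> {v \<in> U. ga_act (F (Suc i)) M a v \<in> U}"
  proof
    fix v assume "v \<in> ?S"
    then obtain T Y where Y: "GZ_subspace F i (U, snd M) T Y" "v \<in> Y" by blast
    have "ga_act (F (Suc i)) M a v \<in> Y"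
      by (rule gz_alg_invariant[OF m a M GZ_extend[OF i M U(1) Y(1)] Y(2)])
    then show "v \<in> {v \<in> U. ga_act (F (Suc i)) M a v \<in> U}" using GZU[OF Y(1)] Y(2) by auto
  qed
  ultimately have "u \<in> {v \<in> U. ga_act (F (Suc i)) M a v \<in> U}"
    using cfun.span_minimal by blast
  then show ?thesis by simp
qed

text \<open>
  The heart of the induction. Over \<open>F\<^sub>i\<close> the module \<open>M\<close> splits into pairwise non-isomorphic irreducible
  constituents, each invariant under \<open>a\<close>. Hence one element \<open>b\<close> of \<open>\<complex>[F\<^sub>i]\<close> can act on each constituent as \<open>a\<close>
  does and as zero on all irreducible \<open>F\<^sub>i\<close>-modules that do not occur in \<open>M\<close>. Such a \<open>b\<close> again satisfies the
  condition: the Gelfand-Tsetlin subspaces of a constituent are Gelfand-Tsetlin subspaces of \<open>M\<close>, and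
  on the modules that do not occur the action is the scalar zero.
\<close>

lemma action_realised_below:
  assumes i: "1 \<le> i" "Suc i \<le> n" and M: "irreducible_rep (F (Suc i)) M" and a: "a \<in> gz_alg (Suc i)"
  obtains b where "b \<in> gz_alg i" "\<And>v. v \<in> fst M \<Longrightarrow> ga_act (F i) M b v = ga_act (F (Suc i)) M a v"
proof -
  have m: "1 \<le> Suc i" "Suc i \<le> n" and i': "1 \<le> i" "i \<le> n" using i by auto
  interpret G: finite_group "F i" by (rule finite_group_F[OF i'])
  note rM = irreducible_is_rep[OF M]
  have rMi: "is_rep (F i) M" using i by (intro is_rep_chain[OF _ _ _ rM]) auto
  let ?A = "ga_act (F (Suc i)) M a"
  obtain k W where W: "irr_decomposition (F i) M k W" using G.decomposition_exists[OF rMi] by blast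
  have Wj: "submodule_of (F i) M (W j)" "irreducible_rep (F i) (W j, snd M)" if "j < k" for j
    using W that by (auto simp: irr_decomposition_def)
  have WM: "W j \<subseteq> fst M" if "j < k" for j using Wj(1)[OF that] by (simp add: submodule_iff)
  obtain p where p: "\<And>j. j < k \<Longrightarrow> intertwiner (F i) M (W j, snd M) (p j)"
    "\<And>v. v \<in> fst M \<Longrightarrow> v = (\<Sum>j<k. p j v)"
    "\<And>j l v. j < k \<Longrightarrow> l < k \<Longrightarrow> v \<in> W j \<Longrightarrow> p l v = (if l = j then v else 0)"
    using decomposition_components[OF rMi W] by metis
  \<comment> \<open>Isomorphic constituents would coincide as subspaces, contradicting directness of the sum.\<close>
  have noniso: "\<nexists>\<phi>. rep_iso (F i) (W j, snd M) (W l, snd M) \<phi>" if jl: "j < k" "l < k" "j \<noteq> l" for j l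
  proof
    assume "\<exists>\<phi>. rep_iso (F i) (W j, snd M) (W l, snd M) \<phi>"
    then obtain \<phi> where \<phi>: "rep_iso (F i) (W j, snd M) (W l, snd M) \<phi>" by blast
    let ?\<mu> = "irr_class_of (F i) (W j, snd M)"
    note \<mu> = irr_class_of_class[OF Wj(2)[OF jl(1)]] and Wj\<mu> = irr_class_of_mem[OF Wj(2)[OF jl(1)]]
    have "W l = W j"
      by (rule submodule_unique[OF i M \<mu> Wj(1)[OF jl(1)] Wj\<mu> Wj(1)[OF jl(2)]
            irr_class_closed[OF \<mu> Wj\<mu> Wj(2)[OF jl(2)] \<phi>]])
    then have "w = 0" if "w \<in> W j" for w
      using p(3)[OF jl(1,1) that] p(3)[OF jl(2,1), of w] that jl(3) by simp
    moreover have "0 \<in> W j" using Wj(1)[OF jl(1)] by (simp add: submodule_iff cfun.subspace_0)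
    ultimately show False using Wj(2)[OF jl(1)] by (auto simp: irreducible_rep_def)
  qed
  have "\<exists>b. b \<in> group_algebra (F i) \<and> (\<forall>v\<in>W j. ga_act (F i) M b v = ?A v) \<and>
      (\<forall>N. irreducible_rep (F i) N \<longrightarrow> (\<nexists>\<phi>. rep_iso (F i) (W j, snd M) N \<phi>) \<longrightarrow>
        (\<forall>v\<in>fst N. ga_act (F i) N b v = 0))" if j: "j < k" for j
  proof -
    have "linear_on (fst (W j, snd M)) (fst (W j, snd M)) ?A"
      using linear_on_subset[OF ga_act_linear[OF rM] WM[OF j]]
        gz_alg_invariant_submodule[OF i M a Wj[OF j]] by simp
    from G.operator_realised[OF Wj(2)[OF j] this] show ?thesis
      by (metis fst_conv ga_act_sub_rep)
  qed
  then have "\<forall>j\<in>{..<k}. \<exists>b. b \<in> group_algebra (F i) \<and> (\<forall>v\<in>W j. ga_act (F i) M b v = ?A v) \<and>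
      (\<forall>N. irreducible_rep (F i) N \<longrightarrow> (\<nexists>\<phi>. rep_iso (F i) (W j, snd M) N \<phi>) \<longrightarrow>
        (\<forall>v\<in>fst N. ga_act (F i) N b v = 0))" by blast
  from bchoice[OF this] obtain \<beta> where \<beta>: "\<forall>j\<in>{..<k}. \<beta> j \<in> group_algebra (F i) \<and>
      (\<forall>v\<in>W j. ga_act (F i) M (\<beta> j) v = ?A v) \<and>
      (\<forall>N. irreducible_rep (F i) N \<longrightarrow> (\<nexists>\<phi>. rep_iso (F i) (W j, snd M) N \<phi>) \<longrightarrow>
        (\<forall>v\<in>fst N. ga_act (F i) N (\<beta> j) v = 0))" ..
  define b where "b = (\<Sum>j<k. \<beta> j)"
  have bW: "ga_act (F i) M b v = ?A v" if j: "j < k" and v: "v \<in> W j" for j v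
  proof -
    have "ga_act (F i) M (\<beta> l) v = (if l = j then ?A v else 0)" if l: "l < k" for l
    proof (cases "l = j")
      case False
      have "ga_act (F i) (W j, snd M) (\<beta> l) v = 0"
        using \<beta> l Wj(2)[OF j] noniso[OF l j False] v by (metis fst_conv lessThan_iff)
      then show ?thesis using False by simp
    qed (use \<beta> j v in auto)
    then have "(\<Sum>l<k. ga_act (F i) M (\<beta> l) v) = (\<Sum>l<k. if l = j then ?A v else 0)"
      by (intro sum.cong refl) auto
    also have "\<dots> = ?A v" using j by (simp add: sum.delta)
    finally show ?thesis unfolding b_def ga_act_sum .
  qed
  have "ga_act (F i) M b v = ?A v" if v: "v \<in> fst M" for v
  proof -
    have pW: "p j v \<in> W j" if "j < k" for j
      using linear_on_mem[OF intertwiner_linear[OF p(1)[OF that]] v] by simp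
    then have pV: "p j v \<in> fst M" if "j \<in> {..<k}" for j using WM that by blast
    have "ga_act (F i) M b v = ga_act (F i) M b (\<Sum>j<k. p j v)" using p(2)[OF v] by simp
    also have "\<dots> = (\<Sum>j<k. ga_act (F i) M b (p j v))"
      by (rule linear_on_sum[OF ga_act_linear[OF rMi] rep_subspace[OF rM] pV])
    also have "\<dots> = (\<Sum>j<k. ?A (p j v))" using bW pW by (intro sum.cong refl) auto
    also have "\<dots> = ?A (\<Sum>j<k. p j v)"
      by (rule linear_on_sum[OF ga_act_linear[OF rM] rep_subspace[OF rM] pV, symmetric])
    also have "\<dots> = ?A v" using p(2)[OF v] by simp
    finally show ?thesis .
  qed
  moreover have "b \<in> gz_alg i"
  proof -
    have "b \<in> group_algebra (F i)"
      unfolding b_def using \<beta> by (intro cfun.subspace_sum group_algebra_subspace) auto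
    moreover have "(\<forall>w\<in>Y. ga_act (F i) N b w \<in> Y) \<and> P (T 1) (Y, snd N) (ga_act (F i) N b)"
      if N: "irreducible_rep (F i) N" and GZ: "GZ_subspace F i N T Y" for N T Y
    proof -
      note rN = irreducible_is_rep[OF N]
      note cls = GZ_bottom_class(2,1)[OF i' rN GZ]
      note sY = GZ_vector_subspace[OF i' rN GZ] and YN = GZ_subset[OF i' rN GZ]
      show ?thesis
      proof (cases "\<exists>j<k. \<exists>\<phi>. rep_iso (F i) (W j, snd M) N \<phi>")
        case False
        \<comment> \<open>\<open>N\<close> does not occur in \<open>M\<close>, and \<open>b\<close> acts on it as zero.\<close>
        have "ga_act (F i) N (\<beta> j) w = 0" if "j < k" "w \<in> Y" for j w
          using \<beta> False N that YN by blast
        then have z: "ga_act (F i) N b w = 0" if "w \<in> Y" for w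
          unfolding b_def ga_act_sum using that by (intro sum.neutral) auto
        have "P (T 1) (Y, snd N) (ga_act (F i) N b)"
          by (rule P_scalar[OF cls, of _ 0]) (simp only: fst_conv z cfun.scale_zero_left)
        then show ?thesis using z cfun.subspace_0[OF sY] by metis
      next
        case True
        \<comment> \<open>\<open>N\<close> is isomorphic to a constituent, where \<open>b\<close> acts as \<open>a\<close>: carry \<open>Y\<close> there and the condition back.\<close>
        then obtain j \<phi> where j: "j < k" and \<phi>: "rep_iso (F i) (W j, snd M) N \<phi>" by blast
        define \<psi> where "\<psi> = inv_into (W j) \<phi>"
        have \<psi>: "rep_iso (F i) N (W j, snd M) \<psi>"
          using rep_iso_sym[OF irreducible_is_rep[OF Wj(2)[OF j]] \<phi>] by (simp add: \<psi>_def)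
        then have i\<psi>: "intertwiner (F i) N (W j, snd M) \<psi>" and b\<psi>: "bij_betw \<psi> (fst N) (W j)"
          by (auto simp: rep_iso_iff)
        have "GZ_subspace F i (W j, snd M) T (\<psi> ` Y)"
          by (rule GZ_transport[OF i' N Wj(2)[OF j] \<psi> GZ])
        from GZ_extend[OF i M Wj(1)[OF j] this]
        have GZ': "GZ_subspace F (Suc i) M (T(Suc i := irr_class_of (F (Suc i)) M)) (\<psi> ` Y)" .
        have T1: "(T(Suc i := irr_class_of (F (Suc i)) M)) 1 = T 1" using i by simp
        have PA: "P (T 1) (\<psi> ` Y, snd M) ?A" using gz_alg_condition[OF m a M GZ'] unfolding T1 .
        have cls': "(\<psi> ` Y, snd M) \<in> T 1" using GZ_bottom_class(1)[OF m rM GZ'] unfolding T1 .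
        have lA: "linear_on (\<psi> ` Y) (\<psi> ` Y) ?A" by (rule gz_alg_linear[OF m a M GZ'])
        have comm: "\<psi> (ga_act (F i) N b w) = ?A (\<psi> w)" if w: "w \<in> Y" for w
        proof -
          have wN: "w \<in> fst N" using YN w by auto
          have "\<psi> (ga_act (F i) N b w) = ga_act (F i) M b (\<psi> w)"
            using intertwiner_ga_act[OF rN i\<psi> wN, of b] by simp
          also have "\<dots> = ?A (\<psi> w)"
            using b\<psi> wN by (intro bW[OF j]) (auto simp: bij_betw_def)
          finally show ?thesis .
        qed
        have inv: "ga_act (F i) N b w \<in> Y" if w: "w \<in> Y" for w
        proof -
          have "\<psi> (ga_act (F i) N b w) \<in> \<psi> ` Y"
            unfolding comm[OF w] using w by (intro linear_on_mem[OF lA]) auto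
          then obtain y where y: "y \<in> Y" "\<psi> (ga_act (F i) N b w) = \<psi> y" by auto
          have "ga_act (F i) N b w \<in> fst N"
            using linear_on_mem[OF ga_act_linear[OF rN]] w YN by blast
          then have "ga_act (F i) N b w = y"
            using b\<psi> y YN by (auto simp: bij_betw_def dest: inj_onD)
          then show ?thesis using y(1) by simp
        qed
        have "rep_iso (F 1) (Y, snd N) (\<psi> ` Y, snd M) \<psi>"
          using rep_iso_restrict[OF \<psi> YN chain_carrier(1)[of 1 i]] i' by simp
        then have "P (T 1) (Y, snd N) (ga_act (F i) N b)"
          using lA GZ_linear[OF i' rN GZ inv] comm
          by (intro P_transfer[OF cls(1) cls' cls(2) _ _ _ _ PA]) (simp_all only: fst_conv)
        then show ?thesis using inv by blast
      qed
    qed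
    ultimately show ?thesis by (rule gz_algI)
  qed
  ultimately show ?thesis using that by blast
qed

text \<open>
  \<open>a\<close> is the sum over the classes \<open>\<kappa>\<close> of \<open>b \<kappa>\<close>, taken from the algebra one level below, times the central
  projector of \<open>\<kappa>\<close>.
\<close>

lemma gz_alg_step:
  assumes i: "1 \<le> i" "Suc i \<le> n" and A: "ga_subalgebra (F n) A"
    and lower: "gz_alg i \<subseteq> A" and center: "ga_center (F (Suc i)) \<subseteq> A"
  shows "gz_alg (Suc i) \<subseteq> A"
proof
  fix a assume a: "a \<in> gz_alg (Suc i)"
  interpret G: finite_group "F (Suc i)" using i by (intro finite_group_F) auto
  have ii: "1 \<le> i" "i \<le> Suc i" "Suc i \<le> n" and in': "1 \<le> Suc i" "Suc i \<le> n" "n \<le> n" using i by auto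
  have "\<exists>b. b \<in> gz_alg i \<and> (\<exists>M\<in>\<kappa>. \<forall>v\<in>fst M. ga_act (F (Suc i)) M b v = ga_act (F (Suc i)) M a v)"
    if \<kappa>: "\<kappa> \<in> irr_classes (F (Suc i))" for \<kappa>
  proof -
    obtain M where M: "M \<in> \<kappa>" using irr_class_nonempty[OF \<kappa>] by blast
    obtain b where b: "b \<in> gz_alg i" "\<And>v. v \<in> fst M \<Longrightarrow> ga_act (F i) M b v = ga_act (F (Suc i)) M a v"
      using action_realised_below[OF i irr_class_irreducible[OF \<kappa> M] a] by blast
    then show ?thesis using M ga_act_chain[OF ii gz_alg_mem[OF b(1)]] by metis
  qed
  then obtain b where b: "\<And>\<kappa>. \<kappa> \<in> irr_classes (F (Suc i)) \<Longrightarrow> b \<kappa> \<in> gz_alg i"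
    "\<And>\<kappa>. \<kappa> \<in> irr_classes (F (Suc i)) \<Longrightarrow>
      \<exists>M\<in>\<kappa>. \<forall>v\<in>fst M. ga_act (F (Suc i)) M (b \<kappa>) v = ga_act (F (Suc i)) M a v"
    by metis
  obtain p where p: "\<And>\<kappa>. \<kappa> \<in> irr_classes (F (Suc i)) \<Longrightarrow> p \<kappa> \<in> ga_center (F (Suc i))"
    "a = (\<Sum>\<kappa>\<in>irr_classes (F (Suc i)). ga_mult (F (Suc i)) (b \<kappa>) (p \<kappa>))"
    using G.sum_over_isotypic_projectors[OF gz_alg_mem[OF a] b(2)] by blast
  have "ga_mult (F (Suc i)) (b \<kappa>) (p \<kappa>) \<in> A" if \<kappa>: "\<kappa> \<in> irr_classes (F (Suc i))" for \<kappa>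
  proof -
    have "b \<kappa> \<in> group_algebra (F (Suc i))"
      using group_algebra_chain[OF ii] gz_alg_mem[OF b(1)[OF \<kappa>]] by auto
    moreover have "p \<kappa> \<in> group_algebra (F (Suc i))" using p(1)[OF \<kappa>] by (simp add: ga_center_def)
    ultimately have "ga_mult (F (Suc i)) (b \<kappa>) (p \<kappa>) = ga_mult (F n) (b \<kappa>) (p \<kappa>)"
      using i by (intro ga_mult_chain[symmetric]) auto
    also have "\<dots> \<in> A" using A lower center b(1)[OF \<kappa>] p(1)[OF \<kappa>] unfolding ga_subalgebra_def by blast
    finally show ?thesis .
  qed
  then show "a \<in> A"
    unfolding p(2) using A by (intro cfun.subspace_sum) (auto simp: ga_subalgebra_def)
qed

text \<open>
  For the nontrivial inclusion, all levels \<open>m \<le> n\<close> are compared inside one fixed subalgebra of \<open>\<complex>[F\<^sub>n]\<close>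
  that contains the generators, and the induction is on \<open>m\<close>.
\<close>

theorem gz_alg_generated:
  assumes n: "1 \<le> n"
  shows "gz_alg n = ga_generated (F n) (gz_alg 1 \<union> (\<Union>i\<in>{1..n}. ga_center (F i)))"
proof
  show "ga_generated (F n) (gz_alg 1 \<union> (\<Union>i\<in>{1..n}. ga_center (F i))) \<subseteq> gz_alg n"
    unfolding ga_generated_def
  proof (rule hull_minimal)
    show "gz_alg 1 \<union> (\<Union>i\<in>{1..n}. ga_center (F i)) \<subseteq> gz_alg n"
      using bottom_le_gz_alg[OF n order_refl] center_le_gz_alg[OF _ _ order_refl]
      by (intro Un_least UN_least) auto
  qed (rule gz_alg_subalgebra[OF n order_refl])
  have "gz_alg n \<subseteq> A"
    if A: "ga_subalgebra (F n) A" and S: "gz_alg 1 \<union> (\<Union>i\<in>{1..n}. ga_center (F i)) \<subseteq> A" for A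
  proof -
    have "gz_alg m \<subseteq> A" if "1 \<le> m" "m \<le> n" for m
      using that
    proof (induction m rule: dec_induct)
      case base
      then show ?case using S by simp
    next
      case (step i)
      then have "Suc i \<in> {1..n}" by auto
      then have "ga_center (F (Suc i)) \<subseteq> A" using S by blast
      then show ?case using step by (intro gz_alg_step[OF _ _ A]) auto
    qed
    then show ?thesis using n by simp
  qed
  then show "gz_alg n \<subseteq> ga_generated (F n) (gz_alg 1 \<union> (\<Union>i\<in>{1..n}. ga_center (F i)))"
    unfolding ga_generated_def hull_def by blast
qed

end

section \<open>The scalar, diagonal and trivial conditions\<close>

definition scalar_on :: "'g rep set \<Rightarrow> 'g rep \<Rightarrow> ((nat \<Rightarrow> complex) \<Rightarrow> nat \<Rightarrow> complex) \<Rightarrow> bool"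
  where "scalar_on \<mu> N f \<longleftrightarrow> (\<exists>c. \<forall>w\<in>fst N. f w = c *\<^sub>c w)"

definition diagonal_on :: "'g monoid \<Rightarrow> ('g rep set \<Rightarrow> 'g rep) \<Rightarrow> ('g rep set \<Rightarrow> (nat \<Rightarrow> complex) set) \<Rightarrow>
    'g rep set \<Rightarrow> 'g rep \<Rightarrow> ((nat \<Rightarrow> complex) \<Rightarrow> nat \<Rightarrow> complex) \<Rightarrow> bool"
  where "diagonal_on H V B \<mu> N f \<longleftrightarrow>
    (\<forall>\<phi>. rep_iso H (V \<mu>) N \<phi> \<longrightarrow> (\<forall>b\<in>\<phi> ` B \<mu>. \<exists>c. f b = c *\<^sub>c b))"

context multiplicity_free_chain
begin

lemma gz_condition_trivial: "gz_condition F n (\<lambda>_ _ _. True)"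
  by unfold_locales auto

lemma gz_condition_scalar: "gz_condition F n scalar_on"
proof unfold_locales
  fix \<mu> N N' f g \<psi> c
  assume \<mu>: "\<mu> \<in> irr_classes (F 1)" "N \<in> \<mu>"
  show "scalar_on \<mu> N f" if "\<And>w. w \<in> fst N \<Longrightarrow> f w = c *\<^sub>c w"
    using that unfolding scalar_on_def by blast
  show "scalar_on \<mu> N (\<lambda>w. f w + g w)" if fg: "scalar_on \<mu> N f" "scalar_on \<mu> N g"
  proof -
    obtain c d where "\<forall>w\<in>fst N. f w = c *\<^sub>c w" "\<forall>w\<in>fst N. g w = d *\<^sub>c w"
      using fg unfolding scalar_on_def by blast
    then have "\<forall>w\<in>fst N. f w + g w = (c + d) *\<^sub>c w" by (simp only: cfun.scale_left_distrib) simp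
    then show ?thesis unfolding scalar_on_def by blast
  qed
  show "scalar_on \<mu> N (\<lambda>w. f (g w))"
    if "linear_on (fst N) (fst N) g" and fg: "scalar_on \<mu> N f" "scalar_on \<mu> N g"
  proof -
    obtain c d where "\<forall>w\<in>fst N. f w = c *\<^sub>c w" "\<forall>w\<in>fst N. g w = d *\<^sub>c w"
      using fg unfolding scalar_on_def by blast
    then have "\<forall>w\<in>fst N. f (g w) = (c * d) *\<^sub>c w"
      using linear_on_mem[OF that(1)] by (metis cfun.scale_scale)
    then show ?thesis unfolding scalar_on_def by blast
  qed
  show "scalar_on \<mu> N' g"
    if g: "linear_on (fst N') (fst N') g" and \<psi>: "rep_iso (F 1) N' N \<psi>"
      and eq: "\<And>w. w \<in> fst N' \<Longrightarrow> \<psi> (g w) = f (\<psi> w)" and f: "scalar_on \<mu> N f" and N': "N' \<in> \<mu>"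
  proof -
    have lin: "linear_on (fst N') (fst N) \<psi>" and b: "bij_betw \<psi> (fst N') (fst N)"
      using \<psi> by (auto simp: rep_iso_iff intertwiner_def)
    obtain c where c: "\<forall>w\<in>fst N. f w = c *\<^sub>c w" using f unfolding scalar_on_def by blast
    note sub = rep_subspace[OF irreducible_is_rep[OF irr_class_irreducible[OF \<mu>(1) N']]]
    have "g w = c *\<^sub>c w" if w: "w \<in> fst N'" for w
    proof (rule inj_onD[OF bij_betw_imp_inj_on[OF b]])
      show "\<psi> (g w) = \<psi> (c *\<^sub>c w)"
        using eq[OF w] c linear_on_mem[OF lin w] linear_on_scale[OF lin w] by metis
    qed (use linear_on_mem[OF g w] cfun.subspace_scale[OF sub w] in auto)
    then show ?thesis unfolding scalar_on_def by blast
  qed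
qed

lemma gz_condition_diagonal:
  assumes V: "\<And>\<mu>. \<mu> \<in> irr_classes (F 1) \<Longrightarrow> V \<mu> \<in> \<mu>"
    and B: "\<And>\<mu>. \<mu> \<in> irr_classes (F 1) \<Longrightarrow> B \<mu> \<subseteq> fst (V \<mu>)"
  shows "gz_condition F n (diagonal_on (F 1) V B)"
proof unfold_locales
  let ?P = "diagonal_on (F 1) V B"
  fix \<mu> N N' f g \<psi> c
  assume \<mu>: "\<mu> \<in> irr_classes (F 1)" "N \<in> \<mu>"
  have basis: "\<phi> b \<in> fst L" if "rep_iso (F 1) (V \<mu>) L \<phi>" "b \<in> B \<mu>" for L \<phi> b
    using that B[OF \<mu>(1)] by (auto simp: rep_iso_iff bij_betw_def)
  show "?P \<mu> N f" if "\<And>w. w \<in> fst N \<Longrightarrow> f w = c *\<^sub>c w"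
    unfolding diagonal_on_def using basis that by blast
  show "?P \<mu> N (\<lambda>w. f w + g w)" if fg: "?P \<mu> N f" "?P \<mu> N g"
    unfolding diagonal_on_def
  proof (intro allI impI ballI)
    fix \<phi> b assume "rep_iso (F 1) (V \<mu>) N \<phi>" "b \<in> \<phi> ` B \<mu>"
    then obtain c d where "f b = c *\<^sub>c b" "g b = d *\<^sub>c b"
      using fg unfolding diagonal_on_def by blast
    then have "f b + g b = (c + d) *\<^sub>c b" by (simp only: cfun.scale_left_distrib)
    then show "\<exists>c. f b + g b = c *\<^sub>c b" ..
  qed
  show "?P \<mu> N (\<lambda>w. f (g w))"
    if f: "linear_on (fst N) (fst N) f" and fg: "?P \<mu> N f" "?P \<mu> N g"
    unfolding diagonal_on_def
  proof (intro allI impI ballI)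
    fix \<phi> b assume \<phi>: "rep_iso (F 1) (V \<mu>) N \<phi>" "b \<in> \<phi> ` B \<mu>"
    then obtain c d where cd: "f b = c *\<^sub>c b" "g b = d *\<^sub>c b"
      using fg unfolding diagonal_on_def by blast
    have "b \<in> fst N" using basis[OF \<phi>(1)] \<phi>(2) by blast
    then have "f (g b) = (d * c) *\<^sub>c b"
      unfolding cd(2) by (simp only: linear_on_scale[OF f] cd(1) cfun.scale_scale)
    then show "\<exists>c. f (g b) = c *\<^sub>c b" ..
  qed
  show "?P \<mu> N' g"
    if g: "linear_on (fst N') (fst N') g" and \<psi>: "rep_iso (F 1) N' N \<psi>"
      and eq: "\<And>w. w \<in> fst N' \<Longrightarrow> \<psi> (g w) = f (\<psi> w)" and f: "?P \<mu> N f" and N': "N' \<in> \<mu>"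
    unfolding diagonal_on_def
  proof (intro allI impI ballI)
    fix \<phi> b assume \<phi>: "rep_iso (F 1) (V \<mu>) N' \<phi>" and "b \<in> \<phi> ` B \<mu>"
    then obtain b0 where b0: "b0 \<in> B \<mu>" "b = \<phi> b0" by auto
    have lin: "linear_on (fst N') (fst N) \<psi>" and bij: "bij_betw \<psi> (fst N') (fst N)"
      using \<psi> by (auto simp: rep_iso_iff intertwiner_def)
    note sub = rep_subspace[OF irreducible_is_rep[OF irr_class_irreducible[OF \<mu>(1) N']]]
    have bN: "b \<in> fst N'" using basis[OF \<phi> b0(1)] b0(2) by simp
    have "\<psi> b \<in> (\<lambda>v. \<psi> (\<phi> v)) ` B \<mu>" using b0 by auto
    then obtain c where c: "f (\<psi> b) = c *\<^sub>c \<psi> b"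
      using f rep_iso_trans[OF \<phi> \<psi>] unfolding diagonal_on_def by blast
    have "g b = c *\<^sub>c b"
    proof (rule inj_onD[OF bij_betw_imp_inj_on[OF bij]])
      show "\<psi> (g b) = \<psi> (c *\<^sub>c b)"
        using eq[OF bN] c linear_on_scale[OF lin bN] by metis
    qed (use linear_on_mem[OF g bN] cfun.subspace_scale[OF sub bN] in auto)
    then show "\<exists>c. g b = c *\<^sub>c b" ..
  qed
qed

lemma alg0_eq_gz_alg:
  assumes m: "1 \<le> m" "m \<le> n"
  shows "alg0 F m = gz_condition.gz_alg F scalar_on m"
proof -
  interpret gz_condition F n scalar_on by (rule gz_condition_scalar)
  show ?thesis
  proof
    show "alg0 F m \<subseteq> gz_alg m"
      using gz_alg_scalarI[OF m] unfolding alg0_def by blast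
    show "gz_alg m \<subseteq> alg0 F m"
    proof
      fix a assume a: "a \<in> gz_alg m"
      have "\<exists>c. \<forall>w\<in>W. ga_act (F m) M a w = c *\<^sub>c w"
        if "irreducible_rep (F m) M" "GZ_subspace F m M T W" for M T W
        using gz_alg_condition[OF m a that] by (simp only: scalar_on_def fst_conv)
      then show "a \<in> alg0 F m" using gz_alg_mem[OF a] unfolding alg0_def by blast
    qed
  qed
qed

lemma alg2_eq_gz_alg: "alg2 F m = gz_condition.gz_alg F (\<lambda>_ _ _. True) m"
proof -
  interpret gz_condition F n "\<lambda>_ _ _. True" by (rule gz_condition_trivial)
  show ?thesis unfolding alg2_def gz_alg_def by (simp only: simp_thms)
qed

text \<open>
  An operator that acts diagonally in a basis of \<open>W\<close> preserves \<open>W\<close>; this is where the \<open>B \<mu>\<close> have to span, and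
  where an isomorphism from \<open>V \<mu>\<close> to \<open>W\<close> has to exist.
\<close>

lemma alg1_eq_gz_alg:
  assumes V: "\<And>\<mu>. \<mu> \<in> irr_classes (F 1) \<Longrightarrow> V \<mu> \<in> \<mu>"
    and B: "\<And>\<mu>. \<mu> \<in> irr_classes (F 1) \<Longrightarrow> basis_of (B \<mu>) (fst (V \<mu>))"
    and m: "1 \<le> m" "m \<le> n"
  shows "alg1 V B F m = gz_condition.gz_alg F (diagonal_on (F 1) V B) m"
proof -
  have BV: "B \<mu> \<subseteq> fst (V \<mu>)" if "\<mu> \<in> irr_classes (F 1)" for \<mu>
    using B[OF that] cfun.span_superset[of "B \<mu>"] by (auto simp: basis_of_def)
  interpret gz_condition F n "diagonal_on (F 1) V B"
    using V BV by (rule gz_condition_diagonal)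
  show ?thesis
  proof
    show "gz_alg m \<subseteq> alg1 V B F m"
    proof
      fix a assume a: "a \<in> gz_alg m"
      have "\<forall>b\<in>\<phi> ` B (T 1). \<exists>c. ga_act (F m) M a b = c *\<^sub>c b"
        if "irreducible_rep (F m) M" "GZ_subspace F m M T W" "rep_iso (F 1) (V (T 1)) (W, snd M) \<phi>" for M T W \<phi>
        using gz_alg_condition[OF m a that(1,2)] that(3) unfolding diagonal_on_def by blast
      then show "a \<in> alg1 V B F m" using gz_alg_mem[OF a] unfolding alg1_def by blast
    qed
    show "alg1 V B F m \<subseteq> gz_alg m"
    proof
      fix a assume a: "a \<in> alg1 V B F m"
      then have aG: "a \<in> group_algebra (F m)" by (simp add: alg1_def)
      have diag: "\<forall>b\<in>\<phi> ` B (T 1). \<exists>c. ga_act (F m) M a b = c *\<^sub>c b"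
        if "irreducible_rep (F m) M" "GZ_subspace F m M T W" "rep_iso (F 1) (V (T 1)) (W, snd M) \<phi>" for M T W \<phi>
        using a that unfolding alg1_def by blast
      have "(\<forall>w\<in>W. ga_act (F m) M a w \<in> W) \<and> diagonal_on (F 1) V B (T 1) (W, snd M) (ga_act (F m) M a)"
        if M: "irreducible_rep (F m) M" and GZ: "GZ_subspace F m M T W" for M T W
      proof -
        note rM = irreducible_is_rep[OF M]
        note cls = GZ_bottom_class[OF m rM GZ]
        note sW = GZ_vector_subspace[OF m rM GZ]
        let ?V = "fst (V (T 1))" and ?A = "ga_act (F m) M a"
        obtain \<phi> where \<phi>: "rep_iso (F 1) (V (T 1)) (W, snd M) \<phi>"
          using irr_class_iso[OF cls(2) V[OF cls(2)] cls(1)] by blast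
        then have lin: "linear_on ?V W \<phi>" and bij: "bij_betw \<phi> ?V W"
          by (auto simp: rep_iso_iff intertwiner_def)
        have WM: "w \<in> fst M" if "w \<in> W" for w using GZ_subset[OF m rM GZ] that by auto
        note linA = ga_act_linear[OF rM, of a]
        have sV: "cfun.subspace ?V"
          by (rule rep_subspace[OF irreducible_is_rep[OF irr_class_irreducible[OF cls(2) V[OF cls(2)]]]])
        have "cfun.subspace {v \<in> ?V. ?A (\<phi> v) \<in> W}"
        proof (rule cfun.subspaceI)
          have lin2: "linear_on ?V (fst M) (\<lambda>v. ?A (\<phi> v))"
            using WM by (intro linear_on_comp[OF lin] linear_on_subset[OF linA] linear_on_mem[OF linA]) auto
          show "0 \<in> {v \<in> ?V. ?A (\<phi> v) \<in> W}"
            using linear_on_zero[OF lin2 sV] cfun.subspace_0[OF sV] cfun.subspace_0[OF sW] by simp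
          show "x + y \<in> {v \<in> ?V. ?A (\<phi> v) \<in> W}"
            if "x \<in> {v \<in> ?V. ?A (\<phi> v) \<in> W}" "y \<in> {v \<in> ?V. ?A (\<phi> v) \<in> W}" for x y
          proof -
            have "?A (\<phi> (x + y)) = ?A (\<phi> x) + ?A (\<phi> y)" using that by (intro linear_on_add[OF lin2]) auto
            then show ?thesis using that cfun.subspace_add[OF sV] cfun.subspace_add[OF sW] by auto
          qed
          show "c *\<^sub>c x \<in> {v \<in> ?V. ?A (\<phi> v) \<in> W}" if "x \<in> {v \<in> ?V. ?A (\<phi> v) \<in> W}" for c x
          proof -
            have "?A (\<phi> (c *\<^sub>c x)) = c *\<^sub>c ?A (\<phi> x)" using that by (intro linear_on_scale[OF lin2]) auto
            then show ?thesis using that cfun.subspace_scale[OF sV] cfun.subspace_scale[OF sW] by auto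
          qed
        qed
        moreover have "B (T 1) \<subseteq> {v \<in> ?V. ?A (\<phi> v) \<in> W}"
        proof
          fix b assume b: "b \<in> B (T 1)"
          then have bV: "b \<in> ?V" using BV[OF cls(2)] by auto
          obtain c where "?A (\<phi> b) = c *\<^sub>c \<phi> b" using diag[OF M GZ \<phi>] b by blast
          then have "?A (\<phi> b) \<in> W"
            using cfun.subspace_scale[OF sW linear_on_mem[OF lin bV]] by metis
          then show "b \<in> {v \<in> ?V. ?A (\<phi> v) \<in> W}" using bV by simp
        qed
        \<comment> \<open>the vectors whose image under \<open>\<phi>\<close> is sent into \<open>W\<close> form a subspace containing the basis\<close>
        ultimately have "cfun.span (B (T 1)) \<subseteq> {v \<in> ?V. ?A (\<phi> v) \<in> W}"
          by (intro cfun.span_minimal)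
        then have "?V \<subseteq> {v \<in> ?V. ?A (\<phi> v) \<in> W}" using B[OF cls(2)] by (simp only: basis_of_def)
        then have "\<forall>w\<in>W. ?A w \<in> W" using bij by (auto simp: bij_betw_def)
        moreover have "diagonal_on (F 1) V B (T 1) (W, snd M) ?A"
          unfolding diagonal_on_def using diag[OF M GZ] by blast
        ultimately show ?thesis by blast
      qed
      with aG show "a \<in> gz_alg m" by (rule gz_algI)
    qed
  qed
qed

text \<open>
  An element acting by scalars on every irreducible module commutes there with everything, hence is
  central by faithfulness.
\<close>

lemma alg0_bottom:
  assumes n: "1 \<le> n"
  shows "alg0 F 1 = ga_center (F 1)"
proof
  interpret gz_condition F n scalar_on by (rule gz_condition_scalar)
  interpret G: finite_group "F 1" using n by (intro finite_group_F) auto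
  show "ga_center (F 1) \<subseteq> alg0 F 1"
    using center_le_gz_alg[of 1 1] alg0_eq_gz_alg[of 1] n by simp
  show "alg0 F 1 \<subseteq> ga_center (F 1)"
  proof
    fix a assume a: "a \<in> alg0 F 1"
    have sc: "\<exists>c. \<forall>v\<in>fst M. ga_act (F 1) M a v = c *\<^sub>c v" if M: "irreducible_rep (F 1) M" for M
    proof -
      have "GZ_subspace F 1 M (\<lambda>_. irr_class_of (F 1) M) (fst M)"
        unfolding GZ_subspace_def branching_chain_def
        using irr_class_of_class[OF M] irr_class_of_mem[OF M] by auto
      then show ?thesis using a M unfolding alg0_def by blast
    qed
    have "ga_mult (F 1) a b = ga_mult (F 1) b a" for b
    proof (rule G.irreducibles_faithful_eq[OF ga_mult_closed ga_mult_closed])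
      fix M v assume M: "irreducible_rep (F 1) M" and v: "v \<in> fst M"
      note rM = irreducible_is_rep[OF M]
      note lin = ga_act_linear[OF rM, of b]
      obtain c where c: "\<And>v. v \<in> fst M \<Longrightarrow> ga_act (F 1) M a v = c *\<^sub>c v" using sc[OF M] by blast
      show "ga_act (F 1) M (ga_mult (F 1) a b) v = ga_act (F 1) M (ga_mult (F 1) b a) v"
        by (simp only: G.ga_act_mult[OF rM v] c[OF v] c[OF linear_on_mem[OF lin v]] linear_on_scale[OF lin v])
    qed
    then show "a \<in> ga_center (F 1)" using a by (simp add: ga_center_def alg0_def)
  qed
qed

lemma alg2_bottom:
  assumes n: "1 \<le> n"
  shows "alg2 F 1 = group_algebra (F 1)"
proof -
  have "ga_act (F 1) M a w \<in> W"
    if M: "irreducible_rep (F 1) M" and GZ: "GZ_subspace F 1 M T W" and w: "w \<in> W" for M T W a w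
  proof -
    note cls = GZ_bottom_class[OF _ n irreducible_is_rep[OF M] GZ]
    have "is_rep (F 1) (W, snd M)"
      by (rule irreducible_is_rep[OF irr_class_irreducible[OF cls(2,1)]]) simp_all
    then show ?thesis using linear_on_mem[OF ga_act_linear, of "F 1" "(W, snd M)" w a] w by simp
  qed
  then show ?thesis unfolding alg2_def by blast
qed

end

theorem theorem3p1:
  fixes F :: "nat \<Rightarrow> 'g monoid" and n :: nat
    and V :: "'g rep set \<Rightarrow> 'g rep"
    and B :: "'g rep set \<Rightarrow> (nat \<Rightarrow> complex) set"
  assumes "1 \<le> n"
    and "group_chain F n"
    and "simple_branching F n"
    and "\<And>\<mu>. \<mu> \<in> irr_classes (F 1) \<Longrightarrow> V \<mu> \<in> \<mu>"
    and "\<And>\<mu>. \<mu> \<in> irr_classes (F 1) \<Longrightarrow> basis_of (B \<mu>) (fst (V \<mu>))"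
  shows "alg0 F n = ga_generated (F n) (\<Union>i\<in>{1..n}. ga_center (F i)) \<and>
    alg1 V B F n = ga_generated (F n) (alg1 V B F 1 \<union> (\<Union>i\<in>{1..n}. ga_center (F i))) \<and>
    alg2 F n = ga_generated (F n) (group_algebra (F 1) \<union> (\<Union>i\<in>{1..n}. ga_center (F i)))"
proof (intro conjI)
  note n = assms(1)
  interpret multiplicity_free_chain F n using assms(2,3) by unfold_locales
  have BV: "B \<mu> \<subseteq> fst (V \<mu>)" if "\<mu> \<in> irr_classes (F 1)" for \<mu>
    using assms(5)[OF that] cfun.span_superset[of "B \<mu>"] by (auto simp: basis_of_def)
  \<comment> \<open>The bottom algebra of the scalar condition is \<open>Z\<^sub>1\<close> itself, which is already among the generators.\<close>
  have "ga_center (F 1) \<union> (\<Union>i\<in>{1..n}. ga_center (F i)) = (\<Union>i\<in>{1..n}. ga_center (F i))"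
    using n by auto
  moreover have "alg0 F n = ga_generated (F n) (alg0 F 1 \<union> (\<Union>i\<in>{1..n}. ga_center (F i)))"
    using gz_condition.gz_alg_generated[OF gz_condition_scalar n] n by (simp only: alg0_eq_gz_alg order_refl)
  ultimately show "alg0 F n = ga_generated (F n) (\<Union>i\<in>{1..n}. ga_center (F i))"
    by (simp only: alg0_bottom[OF n])
  show "alg1 V B F n = ga_generated (F n) (alg1 V B F 1 \<union> (\<Union>i\<in>{1..n}. ga_center (F i)))"
    using gz_condition.gz_alg_generated[OF gz_condition_diagonal[OF assms(4) BV] n] n
    by (simp only: alg1_eq_gz_alg[OF assms(4,5)] order_refl)
  show "alg2 F n = ga_generated (F n) (group_algebra (F 1) \<union> (\<Union>i\<in>{1..n}. ga_center (F i)))"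
    using gz_condition.gz_alg_generated[OF gz_condition_trivial n]
    by (simp only: alg2_eq_gz_alg[symmetric] alg2_bottom[OF n])
qed

end
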